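(* Let $k\ge2$ be a fixed integer. For each integer $p\ge k$ let $\zeta_{1,p},\dots,\zeta_{p,p}\in\mathbb{C}$ and $a_{1,p},\dots,a_{p,p}>0$, and let $Q_{2,p},Q_{1,p}\in\mathbb{C}[z]$ be determined by $Q_{2,p}(z)=\prod_{l=1}^{p}(z-\zeta_{l,p})$ and $\frac{Q_{1,p}(z)}{Q_{2,p}(z)}=\sum_{l=1}^{p}\frac{a_{l,p}}{z-\zeta_{l,p}}$. Assume that for every $p\ge k$ the equation $Q_{2,p}y^{(k)}+Q_{1,p}y^{(k-1)}+Vy=0$ is solvable, and that $K\subset\mathbb{C}$ is a convex compact set containing all zeros of $Q_{2,p}$ for every $p\ge k$. For all $p\ge k$ and $n\ge k-1$ let $S_{p,n}$ be a monic higher Heine-Stieltjes polynomial of degree $n$ for this equation and $V_{p,n}$ a corresponding higher Van Vleck polynomial with $\deg V_{p,n}=p-k$, normalized (by multiplication by a nonzero constant) to be monic. Let $p\mapsto n(p)$ be any function with integer values $n(p)\ge k-1$. Then there is an infinite set $\Gamma\subset\mathbb{N}$ such that the weak-$^*$ limits ${}_*\mu_V=\lim_{\Gamma\ni p\to\infty}\mu_{V_{p,n(p)}}$ and ${}_*\mu_{Q_2}=\lim_{\Gamma\ni p\to\infty}\mu_{Q_{2,p}}$ exist and $${}_*\mu_V\prec{}_*\mu_{Q_2}$$ in the Choquet order. Hence there exists a dilation $T$ on $K$ such that ${}_*\mu_{Q_2}=T({}_*\mu_V)$. In particular, $${}_*\mu_V^{(m)}\le{}_*\mu_{Q_2}^{(m)}\quad\text{for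 all integers }m\ge0,$$ and $$U^{{}_*\mu_V}(z)\ge U^{{}_*\mu_{Q_2}}(z)\quad\text{for every }z\in\mathbb{C}\setminus K.$$
   Context: Solvable means: for every $n\in\mathbb{N}=\{1,2,\dots\}$ there are polynomials $V$ with $\deg V\le p-k$ and $S$ with $\deg S=n$ such that $Q_{2,p}S^{(k)}+Q_{1,p}S^{(k-1)}+VS=0$. Such an $S$ is a higher Heine-Stieltjes polynomial and $V$ a corresponding higher Van Vleck polynomial. For a polynomial $P$ of degree $d\ge1$ with zeros $z_1,\dots,z_d$ (with multiplicity), $\mu_P=\frac1d\sum_{i=1}^d\delta_{z_i}$ is its root-counting measure. For a compactly supported probability measure $\mu$ on $\mathbb{C}$, $\mu^{(m)}=\int|w|^m\,d\mu(w)$ and $U^{\mu}(z)=\int\log|z-w|\,d\mu(w)$. Choquet order: for a convex compact set $K\subset\mathbb{C}$ and probability measures $\mu,\nu$ on $K$, $\mu\prec\nu$ means $\int f\,d\mu\le\int f\,d\nu$ for every continuous convex $f:K\to\mathbb{R}$. A dilation on $K$ is a map $T:x\mapsto T_x$ from $K$ to the probability measures on $K$ such that $T_x$ has barycenter $\int y\,dT_x(y)=x$ for every $x\in K$ and $x\mapsto\int f\,dT_x$ is Borel for every continuous $f:K\to\mathbb{R}$. For a probability measure $\mu$ on $K$, $T(\mu)$ is defined by $\int f\,dT(\mu)=\int_K\big(\int f\,dT_x\big)d\mu(x)$ for continuous $f$. *)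

theory Defs
  imports
    "HOL-Probability.Probability"
    "HOL-Computational_Algebra.Computational_Algebra"
begin

definition higher_heine_stieltjes ::
  "nat \<Rightarrow> nat \<Rightarrow> complex poly \<Rightarrow> complex poly \<Rightarrow> nat \<Rightarrow> complex poly \<Rightarrow> complex poly \<Rightarrow> bool" where
  "higher_heine_stieltjes k p Q2 Q1 n S V \<longleftrightarrow>
     degree S = n \<and> degree V \<le> p - k \<and>
     Q2 * (pderiv ^^ k) S + Q1 * (pderiv ^^ (k - 1)) S + V * S = 0"

definition solvable :: "nat \<Rightarrow> nat \<Rightarrow> complex poly \<Rightarrow> complex poly \<Rightarrow> bool" where
  "solvable k p Q2 Q1 \<longleftrightarrow> (\<forall>n\<ge>1. \<exists>V S. higher_heine_stieltjes k p Q2 Q1 n S V)"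

text \<open>A \<^typ>\<open>complex pmf\<close> lives on the discrete sigma-algebra, so it is pushed forward to the
  Borel sets. The value at constant polynomials, which have no root-counting measure, is arbitrary.\<close>

definition root_measure :: "complex poly \<Rightarrow> complex measure" where
  "root_measure P = distr (measure_pmf (pmf_of_multiset (proots P))) borel (\<lambda>z. z)"

lemma sum_count_times:
  fixes f :: "'a \<Rightarrow> real"
  assumes "finite X" "set_mset M \<subseteq> X"
  shows "(\<Sum>x\<in>X. real (count M x) * f x) = (\<Sum>x\<in>#M. f x)"
  using assms(2)
proof (induction M)
  case (add y M)
  have "(\<Sum>x\<in>X. real (count (add_mset y M) x) * f x) =
          (\<Sum>x\<in>X. real (count M x) * f x + (if x = y then f y else 0))"
    by (intro sum.cong) (auto simp: algebra_simps)
  then show ?case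
    using add assms(1) by (simp add: sum.distrib)
qed simp

lemma integral_root_measure:
  fixes f :: "complex \<Rightarrow> real"
  assumes "degree P \<ge> 1" and f: "f \<in> borel_measurable borel"
  shows "(LINT z|root_measure P. f z) = (\<Sum>z\<in>#proots P. f z) / real (degree P)"
proof -
  have ne: "proots P \<noteq> {#}"
    using assms(1) size_proots_complex[of P] by auto
  have "(LINT z|root_measure P. f z) = (LINT z|measure_pmf (pmf_of_multiset (proots P)). f z)"
    unfolding root_measure_def using f by (subst integral_distr) auto
  also have "\<dots> = (\<Sum>z\<in>set_mset (proots P). pmf (pmf_of_multiset (proots P)) z *\<^sub>R f z)"
    using ne by (intro integral_measure_pmf) (auto simp: set_pmf_of_multiset)
  also have "\<dots> = (\<Sum>z\<in>set_mset (proots P). real (count (proots P) z) * f z) / real (degree P)"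
    using ne by (simp add: pmf_of_multiset size_proots_complex sum_divide_distrib del: count_proots)
  also have "(\<Sum>z\<in>set_mset (proots P). real (count (proots P) z) * f z) = (\<Sum>z\<in>#proots P. f z)"
    by (rule sum_count_times) auto
  finally show ?thesis .
qed

definition prob_measure_on :: "complex set \<Rightarrow> complex measure \<Rightarrow> bool" where
  "prob_measure_on K \<mu> \<longleftrightarrow> prob_space \<mu> \<and> sets \<mu> = sets borel \<and> emeasure \<mu> K = 1"

text \<open>Convergence along the indices in \<open>\<Gamma>\<close>. The limit is required to be a
  probability measure, so testing against compactly supported functions would give the same notion.\<close>

definition weak_star_limit :: "nat set \<Rightarrow> (nat \<Rightarrow> complex measure) \<Rightarrow> complex measure \<Rightarrow> bool" where
  "weak_star_limit \<Gamma> M \<mu> \<longleftrightarrow> prob_space \<mu> \<and> sets \<mu> = sets borel \<and>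
     (\<forall>f :: complex \<Rightarrow> real. continuous_on UNIV f \<and> bounded (range f) \<longrightarrow>
        ((\<lambda>p. LINT z|M p. f z) \<longlongrightarrow> (LINT z|\<mu>. f z)) (inf sequentially (principal \<Gamma>)))"

definition choquet_le :: "complex set \<Rightarrow> complex measure \<Rightarrow> complex measure \<Rightarrow> bool" where
  "choquet_le K \<mu> \<nu> \<longleftrightarrow> prob_measure_on K \<mu> \<and> prob_measure_on K \<nu> \<and>
     (\<forall>f :: complex \<Rightarrow> real. continuous_on K f \<and> convex_on K f \<longrightarrow>
        (LINT x:K|\<mu>. f x) \<le> (LINT x:K|\<nu>. f x))"

definition dilation :: "complex set \<Rightarrow> (complex \<Rightarrow> complex measure) \<Rightarrow> bool" where
  "dilation K T \<longleftrightarrow>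
     (\<forall>x\<in>K. prob_measure_on K (T x) \<and> (LINT y:K|T x. y) = x) \<and>
     (\<forall>f :: complex \<Rightarrow> real. continuous_on K f \<longrightarrow>
        (\<lambda>x. LINT y:K|T x. f y) \<in> borel_measurable (restrict_space borel K))"

text \<open>\<open>\<nu> = T(\<mu>)\<close>, as a relation: for compact \<open>K\<close> a probability measure on \<open>K\<close> is determined by
  its integrals of continuous functions.\<close>

definition dilation_image ::
  "complex set \<Rightarrow> (complex \<Rightarrow> complex measure) \<Rightarrow> complex measure \<Rightarrow> complex measure \<Rightarrow> bool" where
  "dilation_image K T \<mu> \<nu> \<longleftrightarrow> prob_measure_on K \<nu> \<and>
     (\<forall>f :: complex \<Rightarrow> real. continuous_on K f \<longrightarrow>
        (LINT y:K|\<nu>. f y) = (LINT x:K|\<mu>. (LINT y:K|T x. f y)))"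

definition abs_moment :: "complex measure \<Rightarrow> nat \<Rightarrow> real" where
  "abs_moment \<mu> m = (LINT w|\<mu>. cmod w ^ m)"

text \<open>Only meaningful when the logarithm is integrable, in particular for \<open>z\<close> outside a compact
  set carrying \<open>\<mu>\<close>.\<close>

definition log_potential :: "complex measure \<Rightarrow> complex \<Rightarrow> real" where
  "log_potential \<mu> z = (LINT w|\<mu>. ln (cmod (z - w)))"

end

theory Submission
  imports Defs
begin

text \<open>The zeros of the weighted logarithmic derivative \<open>R(x) = \<Prod>(x - y\<^sub>i) \<Sum> t\<^sub>i / (x - y\<^sub>i)\<close> are the
  eigenvalues of the compression of \<open>diag(y\<^sub>i)\<close> to the complement of the vector \<open>(\<surd>t\<^sub>i)\<close>, so by Schur
  triangularisation they are averages of the \<open>y\<^sub>i\<close> through a matrix with row sums 1 and column sums at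
  most 1. Applied to \<open>Q\<^sub>2 S\<^sup>(\<^sup>k\<^sup>) + Q\<^sub>1 S\<^sup>(\<^sup>k\<^sup>-\<^sup>1\<^sup>) = -VS\<close> and to repeated derivatives of \<open>S\<close>, this expresses the zeros of
  \<open>V\<close> and \<open>S\<close> as averages of those of \<open>Q\<^sub>2\<close> and \<open>S\<close>; eliminating the zeros of \<open>S\<close> yields a martingale
  coupling of \<open>\<mu>\<^sub>V\<close> with a measure differing from \<open>\<mu>\<^bsub>Q\<^sub>2\<^esub>\<close> by \<open>O(k/p)\<close>. A weak limit of these couplings,
  disintegrated along its first marginal, is the dilation. Convexity says nothing about logarithmic
  potentials; these are compared directly, since outside \<open>K\<close> every monic weighted derivative is bounded
  below by a fixed multiple of its polynomial, whence \<open>|V(z)| \<ge> \<kappa>\<^sup>k |Q\<^sub>2(z)|\<close> with \<open>\<kappa>\<close> depending only on \<open>K\<close> and \<open>z\<close>.\<close>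

section \<open>Averaging majorisation of finite multisets\<close>

text \<open>A theorem of Gauss-Lucas type only places zeros in a convex hull; comparing
  root-counting measures also requires that no point be used too often, and this is what the column
  bound expresses. The two sides have \<open>p - k\<close> and \<open>p\<close> points, so the
  matrices cannot be doubly stochastic, and column sums at most 1 are the best available substitute.
  The degree \<open>n p\<close> of \<open>S\<close> may grow arbitrarily fast compared with
  \<open>p\<close>. An estimate that treats the zeros of \<open>S\<close> as an error term would
  therefore be useless, and they are cancelled exactly for each \<open>p\<close>, before any limit
  is taken. Nothing is assumed about the position of the zeros of \<open>S\<close>, but the
  potential estimate needs them in \<open>K\<close>. This follows because differentiation lowers the
  column bound from 1 to 1 - 1/\<open>degree S\<close>, a strict loss that leaves no room for zeros
  outside \<open>K\<close>. A continuous curve that passes through every point of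
  \<open>K \<times> K\<close> carries the couplings to the real line. There distribution functions
  serve both for extracting the limit and for constructing conditional laws.\<close>

definition averaging ::
  "'i set \<Rightarrow> 'j set \<Rightarrow> real \<Rightarrow> ('i \<Rightarrow> complex) \<Rightarrow> ('j \<Rightarrow> complex) \<Rightarrow> ('i \<Rightarrow> 'j \<Rightarrow> real) \<Rightarrow> bool" where
  "averaging I J c x y M \<longleftrightarrow>
     (\<forall>i\<in>I. \<forall>j\<in>J. 0 \<le> M i j) \<and> (\<forall>i\<in>I. (\<Sum>j\<in>J. M i j) = 1) \<and>
     (\<forall>j\<in>J. (\<Sum>i\<in>I. M i j) \<le> c) \<and> (\<forall>i\<in>I. x i = (\<Sum>j\<in>J. of_real (M i j) * y j))"

text \<open>The points are enumerated by natural numbers so that repeated points get separate rows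
  and columns. The parameter \<open>c\<close> is kept free because values below 1 matter for
  derivatives.\<close>

definition maj :: "real \<Rightarrow> complex multiset \<Rightarrow> complex multiset \<Rightarrow> bool" where
  "maj c X Y \<longleftrightarrow> (\<exists>(x :: nat \<Rightarrow> complex) (y :: nat \<Rightarrow> complex) M.
     image_mset x (mset_set {..<size X}) = X \<and> image_mset y (mset_set {..<size Y}) = Y \<and>
     averaging {..<size X} {..<size Y} c x y M)"

lemma image_mset_eq_obtain_bij:
  assumes "finite I" "finite J" "image_mset x (mset_set I) = image_mset y (mset_set J)"
  obtains f where "bij_betw f I J" "\<And>i. i \<in> I \<Longrightarrow> y (f i) = x i"
proof -
  have "\<exists>f. bij_betw f I J \<and> (\<forall>i\<in>I. y (f i) = x i)"
    using assms
  proof (induction I arbitrary: J rule: finite_induct)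
    case empty
    then have "J = {}" by (simp add: mset_set_empty_iff)
    then show ?case by (simp add: bij_betw_def)
  next
    case (insert a I)
    have "x a \<in># image_mset y (mset_set J)"
      using insert.hyps insert.prems(2)[symmetric] by simp
    then obtain b where b: "b \<in> J" "y b = x a"
      using insert.prems(1) by auto
    have J: "J = insert b (J - {b})" using b by auto
    have "image_mset y (mset_set J) = add_mset (x a) (image_mset y (mset_set (J - {b})))"
      using insert.prems(1) b by (subst J, subst mset_set.insert) auto
    then have "image_mset x (mset_set I) = image_mset y (mset_set (J - {b}))"
      using insert.hyps insert.prems(2) by simp
    with insert.IH[of "J - {b}"] insert.prems(1)
    obtain f where f: "bij_betw f I (J - {b})" "\<forall>i\<in>I. y (f i) = x i" by auto
    have "bij_betw (f(a := b)) (insert a I) (insert b (J - {b}))"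
    proof -
      have "bij_betw (f(a := b)) I (J - {b})"
        using f(1) insert.hyps by (subst bij_betw_cong[of I _ f]) auto
      then have "bij_betw (f(a := b)) (I \<union> {a}) ((J - {b}) \<union> {b})"
        by (rule bij_betw_combine) auto
      then show ?thesis by simp
    qed
    then have "bij_betw (f(a := b)) (insert a I) J" using J by simp
    moreover have "\<forall>i\<in>insert a I. y ((f(a := b)) i) = x i" using f(2) b insert.hyps by auto
    ultimately show ?case by blast
  qed
  with that show ?thesis by blast
qed

lemma averaging_reindex:
  assumes "averaging I J c x y M" "bij_betw f I' I" "bij_betw g J' J"
    and "\<And>i. i \<in> I' \<Longrightarrow> x (f i) = x' i" "\<And>j. j \<in> J' \<Longrightarrow> y (g j) = y' j"
  shows "averaging I' J' c x' y' (\<lambda>i j. M (f i) (g j))"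
proof -
  have fI: "f i \<in> I" if "i \<in> I'" for i using assms(2) that by (auto simp: bij_betw_def)
  have gJ: "g j \<in> J" if "j \<in> J'" for j using assms(3) that by (auto simp: bij_betw_def)
  have row: "(\<Sum>j\<in>J'. h (g j)) = (\<Sum>j\<in>J. h j)" for h :: "_ \<Rightarrow> real"
    by (rule sum.reindex_bij_betw[OF assms(3)])
  have col: "(\<Sum>i\<in>I'. h (f i)) = (\<Sum>i\<in>I. h i)" for h :: "_ \<Rightarrow> real"
    by (rule sum.reindex_bij_betw[OF assms(2)])
  have rowc: "(\<Sum>j\<in>J'. of_real (M i (g j)) * y' j) = (\<Sum>j\<in>J. of_real (M i j) * y j)" for i
    using sum.reindex_bij_betw[OF assms(3), of "\<lambda>j. of_real (M i j) * y j"] assms(5) by simp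
  show ?thesis
    using assms(1,4) fI gJ row col[of "\<lambda>i. M i (g _)"] unfolding averaging_def
    by (auto simp: rowc col[of "\<lambda>i. M i _"] row[of "M _"])
qed

text \<open>The enumerations hidden in \<open>maj\<close> can be traded for prescribed ones. This is
  what allows two matrices to be multiplied along a common middle index set.\<close>

lemma maj_averaging:
  assumes "maj c X Y" "finite I" "finite J"
    and "image_mset x (mset_set I) = X" "image_mset y (mset_set J) = Y"
  obtains M where "averaging I J c x y M"
proof -
  obtain x0 y0 M0 where 1: "image_mset x0 (mset_set {..<size X}) = X" "image_mset y0 (mset_set {..<size Y}) = Y"
     "averaging {..<size X} {..<size Y} c x0 y0 M0" using assms(1) unfolding maj_def by blast
  obtain f where f: "bij_betw f I {..<size X}" "\<And>i. i \<in> I \<Longrightarrow> x0 (f i) = x i"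
    using image_mset_eq_obtain_bij[of I "{..<size X}" x x0] assms 1 by auto
  obtain g where g: "bij_betw g J {..<size Y}" "\<And>i. i \<in> J \<Longrightarrow> y0 (g i) = y i"
    using image_mset_eq_obtain_bij[of J "{..<size Y}" y y0] assms 1 by auto
  show ?thesis using that averaging_reindex[OF 1(3) f(1) g(1)] f(2) g(2) by blast
qed

lemma multiset_indexing:
  obtains x :: "nat \<Rightarrow> 'a" where "image_mset x (mset_set {..<size X}) = X"
proof -
  obtain xs where "mset xs = X" using ex_mset by blast
  then have "image_mset ((!) xs) (mset_set {..<size X}) = X"
    by (metis map_nth mset_map mset_upt size_mset atLeast0LessThan)
  then show ?thesis using that by blast
qed

lemma averaging_maj:
  assumes "averaging I J c x y M" "finite I" "finite J"
  shows "maj c (image_mset x (mset_set I)) (image_mset y (mset_set J))"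
proof -
  let ?X = "image_mset x (mset_set I)" and ?Y = "image_mset y (mset_set J)"
  obtain x0 where x0: "image_mset x0 (mset_set {..<size ?X}) = ?X" using multiset_indexing .
  obtain y0 where y0: "image_mset y0 (mset_set {..<size ?Y}) = ?Y" using multiset_indexing .
  obtain f where f: "bij_betw f {..<size ?X} I" "\<And>i. i \<in> {..<size ?X} \<Longrightarrow> x (f i) = x0 i"
    using image_mset_eq_obtain_bij[OF _ assms(2) x0] by auto
  obtain g where g: "bij_betw g {..<size ?Y} J" "\<And>i. i \<in> {..<size ?Y} \<Longrightarrow> y (g i) = y0 i"
    using image_mset_eq_obtain_bij[OF _ assms(3) y0] by auto
  show ?thesis unfolding maj_def using x0 y0 averaging_reindex[OF assms(1) f(1) g(1) f(2) g(2)]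
    by blast
qed

lemma image_mset_fun_upd_notin:
  "a \<notin> A \<Longrightarrow> image_mset (x(a := w)) (mset_set A) = image_mset x (mset_set A)"
  by (cases "finite A") (auto intro!: image_mset_cong)

lemma image_mset_fun_upd_Suc:
  "image_mset x (mset_set {..<m}) = X \<Longrightarrow> image_mset (x(m := w)) (mset_set {..<Suc m}) = add_mset w X"
  by (simp add: lessThan_Suc image_mset_fun_upd_notin)

text \<open>The matrix product: row sums stay 1 and the column bounds multiply, so a strict bound in
  one factor survives composition with bounds 1.\<close>

lemma maj_trans:
  assumes "maj c X Y" "maj d Y Z" "c \<ge> 0"
  shows "maj (c * d) X Z"
proof -
  obtain x where x: "image_mset x (mset_set {..<size X}) = X" using multiset_indexing .
  obtain y where y: "image_mset y (mset_set {..<size Y}) = Y" using multiset_indexing .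
  obtain z where z: "image_mset z (mset_set {..<size Z}) = Z" using multiset_indexing .
  let ?I = "{..<size X}" and ?J = "{..<size Y}" and ?L = "{..<size Z}"
  obtain M where M: "averaging ?I ?J c x y M" using maj_averaging[OF assms(1) _ _ x y] by auto
  obtain N where N: "averaging ?J ?L d y z N" using maj_averaging[OF assms(2) _ _ y z] by auto
  have "averaging ?I ?L (c * d) x z (\<lambda>i l. \<Sum>j\<in>?J. M i j * N j l)"
    unfolding averaging_def
  proof (intro conjI ballI)
    fix i l assume i: "i \<in> ?I" and l: "l \<in> ?L"
    show "0 \<le> (\<Sum>j\<in>?J. M i j * N j l)"
      using M N i l by (intro sum_nonneg mult_nonneg_nonneg) (auto simp: averaging_def)
  next
    fix i assume i: "i \<in> ?I"
    have "(\<Sum>l\<in>?L. \<Sum>j\<in>?J. M i j * N j l) = (\<Sum>j\<in>?J. M i j * (\<Sum>l\<in>?L. N j l))"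
      by (subst sum.swap) (simp add: sum_distrib_left)
    also have "\<dots> = 1" using M N i by (simp add: averaging_def)
    finally show "(\<Sum>l\<in>?L. \<Sum>j\<in>?J. M i j * N j l) = 1" .
    have "(\<Sum>l\<in>?L. of_real (\<Sum>j\<in>?J. M i j * N j l) * z l)
        = (\<Sum>l\<in>?L. \<Sum>j\<in>?J. of_real (M i j) * (of_real (N j l) * z l))"
      by (simp add: sum_distrib_right mult.assoc)
    also have "\<dots> = (\<Sum>j\<in>?J. of_real (M i j) * (\<Sum>l\<in>?L. of_real (N j l) * z l))"
      by (subst sum.swap) (simp add: sum_distrib_left)
    also have "\<dots> = x i" using M N i by (simp add: averaging_def)
    finally show "x i = (\<Sum>l\<in>?L. of_real (\<Sum>j\<in>?J. M i j * N j l) * z l)" ..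
  next
    fix l assume l: "l \<in> ?L"
    have "(\<Sum>i\<in>?I. \<Sum>j\<in>?J. M i j * N j l) = (\<Sum>j\<in>?J. (\<Sum>i\<in>?I. M i j) * N j l)"
      by (subst sum.swap) (simp add: sum_distrib_right)
    also have "\<dots> \<le> (\<Sum>j\<in>?J. c * N j l)"
      using M N l by (intro sum_mono mult_right_mono) (auto simp: averaging_def)
    also have "\<dots> = c * (\<Sum>j\<in>?J. N j l)" by (simp add: sum_distrib_left)
    also have "\<dots> \<le> c * d" using N l assms(3) by (intro mult_left_mono) (auto simp: averaging_def)
    finally show "(\<Sum>i\<in>?I. \<Sum>j\<in>?J. M i j * N j l) \<le> c * d" .
  qed
  from averaging_maj[OF this] x z show ?thesis by simp
qed

lemma averaging_mono: "averaging I J c x y M \<Longrightarrow> c \<le> d \<Longrightarrow> averaging I J d x y M"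
  unfolding averaging_def by (auto intro: order_trans)

lemma maj_mono: "maj c X Y \<Longrightarrow> c \<le> d \<Longrightarrow> maj d X Y"
  unfolding maj_def using averaging_mono by blast

lemma maj_add_mset:
  assumes "maj 1 X Y"
  shows "maj 1 (add_mset w X) (add_mset w Y)"
proof -
  obtain x y M where M: "image_mset x (mset_set {..<size X}) = X" "image_mset y (mset_set {..<size Y}) = Y"
     "averaging {..<size X} {..<size Y} 1 x y M" using assms unfolding maj_def by blast
  let ?m = "size X" and ?n = "size Y"
  define x' where "x' = x(?m := w)"
  define y' where "y' = y(?n := w)"
  \<comment> \<open>The matrix is extended by a block with single entry 1: the new point is averaged
    from itself alone.\<close>
  define M' where "M' i j = (if i = ?m then of_bool (j = ?n) else if j = ?n then 0 else M i j)" for i j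
  have "averaging {..<Suc ?m} {..<Suc ?n} 1 x' y' M'"
    using M(3) unfolding averaging_def x'_def y'_def M'_def
    by (auto simp: less_Suc_eq)
  moreover have "image_mset x' (mset_set {..<Suc ?m}) = add_mset w X"
    "image_mset y' (mset_set {..<Suc ?n}) = add_mset w Y"
    unfolding x'_def y'_def by (intro image_mset_fun_upd_Suc M(1,2))+
  ultimately show ?thesis
    using averaging_maj[of "{..<Suc ?m}" "{..<Suc ?n}" 1 x' y' M'] by auto
qed

lemma maj_add: "maj 1 X Y \<Longrightarrow> maj 1 (X + W) (Y + W)"
  by (induction W) (auto intro: maj_add_mset)

text \<open>Solving the row of the cancelled point \<open>s\<close> for \<open>s\<close> and substituting into the other rows
  keeps all column sums bounded by 1.\<close>

lemma maj_cancel_mset: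
  assumes "maj 1 (add_mset s X) (add_mset s Y)"
  shows "maj 1 X Y"
proof -
  obtain x where x: "image_mset x (mset_set {..<size X}) = X" using multiset_indexing .
  obtain y where y: "image_mset y (mset_set {..<size Y}) = Y" using multiset_indexing .
  let ?m = "size X" and ?n = "size Y"
  let ?I = "{..<?m}" and ?J = "{..<?n}"
  define x' where "x' = x(?m := s)"
  define y' where "y' = y(?n := s)"
  have "image_mset x' (mset_set {..<Suc ?m}) = add_mset s X"
    "image_mset y' (mset_set {..<Suc ?n}) = add_mset s Y"
    unfolding x'_def y'_def by (intro image_mset_fun_upd_Suc x y)+
  then obtain M where M: "averaging {..<Suc ?m} {..<Suc ?n} 1 x' y' M"
    using maj_averaging[OF assms] by blast
  define d where "d = M ?m ?n"
  have nn: "0 \<le> M i j" if "i \<le> ?m" "j \<le> ?n" for i j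
    using M that by (auto simp: averaging_def)
  have row: "(\<Sum>j\<in>?J. M i j) + M i ?n = 1" if "i \<le> ?m" for i
    using M that by (auto simp: averaging_def)
  have col: "(\<Sum>i\<in>?I. M i j) + M ?m j \<le> 1" if "j \<le> ?n" for j
    using M that by (auto simp: averaging_def)
  have y'J: "(\<Sum>j\<in>?J. of_real (M i j) * y' j) = (\<Sum>j\<in>?J. of_real (M i j) * y j)" for i
    by (rule sum.cong) (auto simp: y'_def)
  have val: "x' i = (\<Sum>j\<in>?J. of_real (M i j) * y j) + of_real (M i ?n) * s" if "i \<le> ?m" for i
    using M that y'J[of i] by (auto simp: averaging_def y'_def less_Suc_eq_le)
  have cols: "(\<Sum>i\<in>?I. M i ?n) \<le> 1 - d" using col[of ?n] by (simp add: d_def)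
  have d1: "d \<le> 1" using cols sum_nonneg[of ?I "\<lambda>i. M i ?n"] nn by (smt (verit) lessThan_iff less_imp_le order_refl)
  \<comment> \<open>Here \<open>d\<close> is the weight that the row of \<open>s\<close> puts on
    \<open>s\<close> itself. That row says that \<open>(1 - d) s\<close> is the sum of
    \<open>M ?m j y j\<close>, so every weight on \<open>s\<close> is passed on along this row
    divided by \<open>1 - d\<close>.\<close>
  define N where "N i j = M i j + M i ?n * (M ?m j / (1 - d))" for i j
  have "averaging ?I ?J 1 x y N"
  proof (cases "d = 1")
    \<comment> \<open>If \<open>s\<close> uses only itself, the column bound at \<open>s\<close>
      leaves no weight on \<open>s\<close> for the other rows. The division by zero in
      \<open>N\<close> yields 0, so \<open>N\<close> is just the restriction of
      \<open>M\<close>.\<close>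
    case True
    have N: "N i j = M i j" for i j by (simp add: N_def True)
    have z: "M i ?n = 0" if "i < ?m" for i
    proof -
      have "M i ?n \<le> (\<Sum>i\<in>?I. M i ?n)" using that nn by (intro member_le_sum) auto
      with cols True nn[of i ?n] that show ?thesis by simp
    qed
    show ?thesis unfolding averaging_def N
    proof (intro conjI ballI)
      fix j assume "j \<in> ?J" then show "(\<Sum>i\<in>?I. M i j) \<le> 1" using col[of j] nn[of ?m j] by auto
    next
      fix i assume "i \<in> ?I" then show "x i = (\<Sum>j\<in>?J. of_real (M i j) * y j)"
        using val[of i] z[of i] by (auto simp: x'_def)
      from \<open>i \<in> ?I\<close> show "(\<Sum>j\<in>?J. M i j) = 1" using row[of i] z[of i] by auto
    qed (use nn in auto)
  next
    case False
    with d1 have d: "1 - d > 0" by simp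
    show ?thesis unfolding averaging_def
    proof (intro conjI ballI)
      fix i j assume "i \<in> ?I" "j \<in> ?J" then show "0 \<le> N i j"
        unfolding N_def using nn d by (auto intro!: add_nonneg_nonneg mult_nonneg_nonneg divide_nonneg_nonneg)
    next
      fix i assume i: "i \<in> ?I"
      have "(\<Sum>j\<in>?J. N i j) = (\<Sum>j\<in>?J. M i j) + M i ?n * ((\<Sum>j\<in>?J. M ?m j) / (1 - d))"
        unfolding N_def sum.distrib sum_distrib_left[symmetric] sum_divide_distrib[symmetric] ..
      also have "(\<Sum>j\<in>?J. M ?m j) = 1 - d" using row[of ?m] by (simp add: d_def)
      finally show "(\<Sum>j\<in>?J. N i j) = 1" using d row[of i] i by simp
      have "(\<Sum>j\<in>?J. of_real (M ?m j) * y j) = of_real (1 - d) * s"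
        using val[of ?m] by (simp add: x'_def d_def algebra_simps)
      moreover have "(\<Sum>j\<in>?J. of_real (N i j) * y j) = (\<Sum>j\<in>?J. of_real (M i j) * y j) +
          of_real (M i ?n / (1 - d)) * (\<Sum>j\<in>?J. of_real (M ?m j) * y j)"
        unfolding N_def by (simp add: sum_distrib_left sum.distrib algebra_simps)
      ultimately show "x i = (\<Sum>j\<in>?J. of_real (N i j) * y j)"
        using val[of i] i d by (simp add: x'_def)
    next
      fix j assume j: "j \<in> ?J"
      have "(\<Sum>i\<in>?I. N i j) = (\<Sum>i\<in>?I. M i j) + (\<Sum>i\<in>?I. M i ?n) * (M ?m j / (1 - d))"
        unfolding N_def sum.distrib sum_distrib_right ..
      \<comment> \<open>The other rows place at most \<open>1 - d\<close> on \<open>s\<close>, which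
        exactly absorbs the normalisation; what remains is the old column sum including the row of
        \<open>s\<close>.\<close>
      also have "\<dots> \<le> (\<Sum>i\<in>?I. M i j) + (1 - d) * (M ?m j / (1 - d))"
        using cols d nn[of ?m j] j by (intro add_left_mono mult_right_mono) auto
      also have "\<dots> \<le> 1" using d col[of j] j by simp
      finally show "(\<Sum>i\<in>?I. N i j) \<le> 1" .
    qed
  qed
  from averaging_maj[OF this] x y show ?thesis by simp
qed

lemma maj_cancel: "maj 1 (X + W) (Y + W) \<Longrightarrow> maj 1 X Y"
  by (induction W) (auto dest: maj_cancel_mset)

text \<open>Jensen's inequality in each row, summed over the rows. Columns are bounded only from
  above, which is why \<open>f\<close> has to be nonnegative on \<open>Y\<close>.\<close>

lemma maj_sum_convex_le:
  assumes maj: "maj c X Y" and f: "convex_on C f" "set_mset Y \<subseteq> C" "\<And>y. y \<in># Y \<Longrightarrow> f y \<ge> 0"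
  shows "(\<Sum>x\<in>#X. f x) \<le> c * (\<Sum>y\<in>#Y. f y)"
proof -
  obtain x y M where M: "image_mset x (mset_set {..<size X}) = X" "image_mset y (mset_set {..<size Y}) = Y"
     "averaging {..<size X} {..<size Y} c x y M" using maj unfolding maj_def by blast
  let ?I = "{..<size X}" and ?J = "{..<size Y}"
  have yY: "y j \<in># Y" if "j \<in> ?J" for j using that by (subst M(2)[symmetric]) auto
  have sX: "(\<Sum>x\<in>#X. f x) = (\<Sum>i\<in>?I. f (x i))"
    by (subst M(1)[symmetric]) (simp add: multiset.map_comp o_def sum_unfold_sum_mset)
  have sY: "(\<Sum>x\<in>#Y. f x) = (\<Sum>i\<in>?J. f (y i))"
    by (subst M(2)[symmetric]) (simp add: multiset.map_comp o_def sum_unfold_sum_mset)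
  have "f (x i) \<le> (\<Sum>j\<in>?J. M i j * f (y j))" if i: "i \<in> ?I" for i
  proof -
    have s1: "(\<Sum>j\<in>?J. M i j) = 1" using M i by (simp add: averaging_def)
    then have "?J \<noteq> {}" by force
    have "x i = (\<Sum>j\<in>?J. M i j *\<^sub>R y j)" using M i by (simp add: averaging_def scaleR_conv_of_real)
    then show ?thesis
      using convex_on_sum[OF _ \<open>?J \<noteq> {}\<close> f(1) s1, of y] M(3) i yY f(2) by (auto simp: averaging_def)
  qed
  then have "(\<Sum>i\<in>?I. f (x i)) \<le> (\<Sum>i\<in>?I. \<Sum>j\<in>?J. M i j * f (y j))" by (rule sum_mono)
  also have "\<dots> = (\<Sum>j\<in>?J. (\<Sum>i\<in>?I. M i j) * f (y j))"
    by (subst sum.swap) (simp add: sum_distrib_right)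
  also have "\<dots> \<le> (\<Sum>j\<in>?J. c * f (y j))"
    using M(3) f(3)[OF yY] by (intro sum_mono mult_right_mono) (auto simp: averaging_def)
  finally show ?thesis by (simp add: sX sY sum_distrib_left)
qed

section \<open>Schur triangularisation of a compressed multiplication operator\<close>

text \<open>Evaluation identifies the polynomials of degree below \<open>card Z\<close> with the
  functions on \<open>Z\<close>, and multiplication by \<open>[:0, 1:]\<close> then is the diagonal
  operator with entries \<open>Z\<close>. Working with polynomials turns invariant subspaces into
  divisibility conditions.\<close>

definition poly_inner :: "complex set \<Rightarrow> (complex \<Rightarrow> real) \<Rightarrow> complex poly \<Rightarrow> complex poly \<Rightarrow> complex" where
  "poly_inner Z w p q = (\<Sum>z\<in>Z. of_real (w z) * (poly p z * cnj (poly q z)))"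

lemma poly_inner_diff_left: "poly_inner Z w (p - q) s = poly_inner Z w p s - poly_inner Z w q s"
  by (simp add: poly_inner_def algebra_simps sum_subtractf)

lemma poly_inner_smult_left: "poly_inner Z w (smult a p) s = a * poly_inner Z w p s"
  by (simp add: poly_inner_def algebra_simps sum_distrib_left)

lemma poly_inner_add_left: "poly_inner Z w (p + q) s = poly_inner Z w p s + poly_inner Z w q s"
  by (simp add: poly_inner_def algebra_simps sum.distrib)

lemma cnj_poly_inner: "cnj (poly_inner Z w p q) = poly_inner Z w q p"
  by (simp add: poly_inner_def mult.commute)

lemma poly_inner_commute_zero: "poly_inner Z w p q = 0 \<Longrightarrow> poly_inner Z w q p = 0"
  using cnj_poly_inner[of Z w p q] by simp

lemma poly_inner_add_right: "poly_inner Z w s (p + q) = poly_inner Z w s p + poly_inner Z w s q"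
  by (simp add: poly_inner_def algebra_simps sum.distrib)

lemma poly_inner_smult_right: "poly_inner Z w s (smult a p) = cnj a * poly_inner Z w s p"
  by (simp add: poly_inner_def algebra_simps sum_distrib_left)

lemma poly_inner_sum_left: "poly_inner Z w (\<Sum>i\<in>I. f i) s = (\<Sum>i\<in>I. poly_inner Z w (f i) s)"
  by (induction I rule: infinite_finite_induct) (simp_all add: poly_inner_add_left, simp_all add: poly_inner_def)

lemma poly_inner_sum_right: "poly_inner Z w s (\<Sum>i\<in>I. f i) = (\<Sum>i\<in>I. poly_inner Z w s (f i))"
  by (induction I rule: infinite_finite_induct) (simp_all add: poly_inner_add_right, simp_all add: poly_inner_def)

definition poly_norm2 :: "complex set \<Rightarrow> (complex \<Rightarrow> real) \<Rightarrow> complex poly \<Rightarrow> real" where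
  "poly_norm2 Z w p = (\<Sum>z\<in>Z. w z * (cmod (poly p z))\<^sup>2)"

lemma poly_inner_self: "poly_inner Z w p p = of_real (poly_norm2 Z w p)"
  by (simp add: poly_inner_def poly_norm2_def complex_norm_square del: of_real_power)

lemma poly_norm2_pos:
  assumes "finite Z" "\<And>z. z \<in> Z \<Longrightarrow> w z > 0" "p \<noteq> 0" "degree p < card Z"
  shows "poly_norm2 Z w p > 0"
proof -
  have "\<not> Z \<subseteq> {z. poly p z = 0}"
  proof
    assume "Z \<subseteq> {z. poly p z = 0}"
    then have "card Z \<le> card {z. poly p z = 0}"
      using assms(3) by (intro card_mono poly_roots_finite) auto
    also have "\<dots> \<le> degree p" using assms(3) by (rule card_poly_roots_bound)
    finally show False using assms(4) by simp
  qed
  then obtain z where z: "z \<in> Z" "poly p z \<noteq> 0" by blast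
  show ?thesis unfolding poly_norm2_def
    by (rule sum_pos2[OF assms(1) z(1)]) (use z assms(2) in \<open>auto intro!: mult_nonneg_nonneg intro: less_imp_le\<close>)
qed

text \<open>Bessel's inequality for the point mass at \<open>z\<close>. The polynomial
  \<open>h\<close> is the reproducing kernel at \<open>z\<close> of the span of the
  \<open>b i\<close>: its value at \<open>z\<close> and its squared norm are the same number
  \<open>s\<close>. Keeping only the term of \<open>z\<close> in the norm gives
  \<open>w z * s\<^sup>2 \<le> s\<close>.\<close>

lemma poly_inner_bessel:
  assumes Z: "finite Z" "z \<in> Z" "\<And>z. z \<in> Z \<Longrightarrow> w z > 0" and I: "finite I"
    and orth: "\<And>i j. i \<in> I \<Longrightarrow> j \<in> I \<Longrightarrow> i \<noteq> j \<Longrightarrow> poly_inner Z w (b i) (b j) = 0"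
    and pos: "\<And>i. i \<in> I \<Longrightarrow> poly_norm2 Z w (b i) > 0"
  shows "(\<Sum>i\<in>I. w z * (cmod (poly (b i) z))\<^sup>2 / poly_norm2 Z w (b i)) \<le> 1"
proof -
  define n where "n i = poly_norm2 Z w (b i)" for i
  define s where "s = (\<Sum>i\<in>I. (cmod (poly (b i) z))\<^sup>2 / n i)"
  define al where "al i = cnj (poly (b i) z) / of_real (n i)" for i
  define h where "h = (\<Sum>i\<in>I. smult (al i) (b i))"
  have npos: "n i > 0" if "i \<in> I" for i using pos that by (simp add: n_def)
  have hz: "poly h z = of_real s"
    unfolding h_def s_def al_def
    by (simp add: poly_sum complex_norm_square mult.commute del: of_real_power)
  have "poly_inner Z w h h = (\<Sum>i\<in>I. \<Sum>j\<in>I. al i * (cnj (al j) * poly_inner Z w (b i) (b j)))"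
    unfolding h_def
    by (subst poly_inner_sum_left) (simp add: poly_inner_smult_left poly_inner_sum_right poly_inner_smult_right sum_distrib_left mult.left_commute)
  also have "\<dots> = (\<Sum>i\<in>I. \<Sum>j\<in>I. if i = j then al i * (cnj (al i) * of_real (n i)) else 0)"
    using orth by (intro sum.cong refl) (auto simp: poly_inner_self n_def)
  also have "\<dots> = (\<Sum>i\<in>I. al i * (cnj (al i) * of_real (n i)))" using I by simp
  also have "\<dots> = (\<Sum>i\<in>I. of_real ((cmod (poly (b i) z))\<^sup>2 / n i))"
  proof (rule sum.cong[OF refl])
    fix i assume "i \<in> I"
    then show "al i * (cnj (al i) * of_real (n i)) = of_real ((cmod (poly (b i) z))\<^sup>2 / n i)"
      using npos[of i] unfolding al_def
      by (simp add: complex_norm_square divide_simps del: of_real_power)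
  qed
  finally have "complex_of_real (poly_norm2 Z w h) = of_real s"
    unfolding poly_inner_self s_def by simp
  then have "poly_norm2 Z w h = s" by (simp only: of_real_eq_iff)
  moreover have "w z * s\<^sup>2 \<le> poly_norm2 Z w h"
    unfolding poly_norm2_def using member_le_sum[OF Z(2), of "\<lambda>z. w z * (cmod (poly h z))\<^sup>2"] Z hz
    by (simp add: less_imp_le)
  ultimately have "w z * s\<^sup>2 \<le> s" by simp
  moreover have "s \<ge> 0" unfolding s_def using npos by (intro sum_nonneg) (simp add: less_imp_le)
  ultimately have "w z * s \<le> 1"
    by (cases "s = 0") (auto simp: power2_eq_square mult.assoc[symmetric])
  then show ?thesis
    unfolding s_def n_def by (simp add: sum_distrib_left)
qed

definition tail_poly :: "nat \<Rightarrow> (nat \<Rightarrow> complex) \<Rightarrow> nat \<Rightarrow> complex poly" where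
  "tail_poly N r m = (\<Prod>l\<in>{m..<N}. [:- r l, 1:])"

text \<open>The polynomials of degree below \<open>N\<close> divisible by \<open>tail_poly N r m = (x - r m) \<dots> (x - r (N-1))\<close> form a flag
  of invariant subspaces for the compression of multiplication by \<open>x\<close>, with eigenvalues \<open>r m\<close>;
  orthonormalising along the flag is Schur triangularisation.\<close>

context
  fixes Z :: "complex set" and w :: "complex \<Rightarrow> real" and N :: nat and r :: "nat \<Rightarrow> complex"
  assumes Z: "finite Z" "card Z = Suc N" and w: "\<And>z. z \<in> Z \<Longrightarrow> w z > 0" and N: "N > 0"
begin

definition flag :: "nat \<Rightarrow> complex poly set" where "flag m = {u. degree u < N \<and> tail_poly N r m dvd u}"

lemma tail_poly_nonzero: "tail_poly N r m \<noteq> 0" and lead_coeff_tail_poly: "lead_coeff (tail_poly N r m) = 1"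
  by (auto simp: tail_poly_def lead_coeff_prod)

lemma degree_tail_poly: "degree (tail_poly N r m) = N - m"
  by (simp add: tail_poly_def degree_prod_sum_eq)

lemma tail_poly_rec: "m < N \<Longrightarrow> tail_poly N r m = [:- r m, 1:] * tail_poly N r (Suc m)"
  by (simp add: tail_poly_def prod.atLeast_Suc_lessThan)

lemma tail_poly_dvd: "m \<le> l \<Longrightarrow> tail_poly N r l dvd tail_poly N r m"
  unfolding tail_poly_def by (intro prod_dvd_prod_subset) auto

lemma flag_0: "u \<in> flag 0 \<Longrightarrow> u = 0"
  using dvd_imp_degree_le[of "tail_poly N r 0" u] degree_tail_poly[of 0] by (auto simp: flag_def)

lemma flag_mono: "m \<le> l \<Longrightarrow> flag m \<subseteq> flag l"
  unfolding flag_def using tail_poly_dvd dvd_trans by blast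

lemma flag_add_smult:
  assumes "u \<in> flag m" "v \<in> flag m" shows "u + smult a v \<in> flag m"
proof -
  have "degree (smult a v) < N" using assms(2) degree_smult_le[of a v] by (auto simp: flag_def)
  then show ?thesis using assms by (auto simp: flag_def intro!: dvd_add dvd_smult degree_add_less)
qed

text \<open>\<open>q\<close> is the component of \<open>tail_poly N r (Suc m)\<close> orthogonal to
  \<open>flag m\<close>, and together with \<open>flag m\<close> it spans
  \<open>flag (Suc m)\<close>. Its cofactor cannot vanish at \<open>r m\<close>, so a suitable
  multiple of \<open>q\<close> removes the value at \<open>r m\<close> of the cofactor of
  \<open>x\<close>; the difference then gains the missing factor.\<close>

lemma flag_step:
  assumes m: "m < N" and u: "u \<in> flag m"
    and orth: "\<forall>x\<in>flag m. poly_inner Z w (tail_poly N r (Suc m) - u) x = 0"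
  defines "q \<equiv> tail_poly N r (Suc m) - u"
  shows "q \<in> flag (Suc m)" "q \<noteq> 0" "x \<in> flag (Suc m) \<Longrightarrow> \<exists>b. x - smult b q \<in> flag m"
proof -
  have gu: "tail_poly N r m dvd u" and gS: "tail_poly N r (Suc m) dvd tail_poly N r m" using u tail_poly_dvd by (auto simp: flag_def)
  have nd: "\<not> tail_poly N r m dvd q"
  proof
    assume "tail_poly N r m dvd q"
    then have "tail_poly N r m dvd tail_poly N r (Suc m)" using gu unfolding q_def by (metis diff_add_cancel dvd_add)
    then show False using dvd_imp_degree_le[of "tail_poly N r m" "tail_poly N r (Suc m)"] m tail_poly_nonzero by (simp add: degree_tail_poly)
  qed
  then show "q \<noteq> 0" by auto
  show q: "q \<in> flag (Suc m)"
    unfolding q_def flag_def using u gS gu N degree_tail_poly[of "Suc m"] m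
    by (intro CollectI conjI degree_diff_less dvd_diff dvd_refl dvd_trans[OF gS]) (auto simp: flag_def)
  assume x: "x \<in> flag (Suc m)"
  from q obtain k where k: "q = tail_poly N r (Suc m) * k" by (auto simp: flag_def elim: dvdE)
  from x obtain h where h: "x = tail_poly N r (Suc m) * h" by (auto simp: flag_def elim: dvdE)
  have knz: "poly k (r m) \<noteq> 0"
  proof
    assume "poly k (r m) = 0"
    then have "[:- r m, 1:] dvd k" by (simp add: poly_eq_0_iff_dvd)
    then have "tail_poly N r m dvd q" unfolding k tail_poly_rec[OF m] by (metis mult.commute mult_dvd_mono dvd_refl)
    with nd show False by simp
  qed
  define b where "b = poly h (r m) / poly k (r m)"
  have "poly (h - smult b k) (r m) = 0" using knz by (simp add: b_def)
  then have "[:- r m, 1:] dvd h - smult b k" by (simp only: poly_eq_0_iff_dvd)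
  then have "tail_poly N r m dvd tail_poly N r (Suc m) * (h - smult b k)"
    unfolding tail_poly_rec[OF m] by (metis mult.commute mult_dvd_mono dvd_refl)
  moreover have "tail_poly N r (Suc m) * (h - smult b k) = x - smult b q" unfolding h k by (simp add: algebra_simps)
  moreover have "degree (x - smult b q) < N"
    using x q degree_smult_le[of b q] by (intro degree_diff_less) (auto simp: flag_def)
  ultimately show "\<exists>b. x - smult b q \<in> flag m" by (auto simp: flag_def)
qed

lemma poly_norm2_flag_pos: "u \<in> flag m \<Longrightarrow> u \<noteq> 0 \<Longrightarrow> poly_norm2 Z w u > 0"
  using Z w by (intro poly_norm2_pos) (auto simp: flag_def)

text \<open>Orthogonal projection onto \<open>flag m\<close>, by Gram-Schmidt: each stage adds the
  one direction \<open>q\<close> supplied by \<open>flag_step\<close>. The vector \<open>v\<close>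
  is arbitrary in the induction because the projection of \<open>tail_poly N r (Suc m)\<close>
  itself is needed to produce \<open>q\<close>.\<close>

lemma flag_projection:
  "m \<le> N \<Longrightarrow> \<exists>u\<in>flag m. \<forall>x\<in>flag m. poly_inner Z w (v - u) x = 0"
proof (induction m arbitrary: v)
  case 0
  have "0 \<in> flag 0" using N by (simp add: flag_def)
  then show ?case by (intro bexI[of _ 0]) (auto simp: poly_inner_def dest!: flag_0)
next
  case (Suc m)
  then have m: "m < N" by simp
  obtain u0 where u0: "u0 \<in> flag m" "\<forall>x\<in>flag m. poly_inner Z w (tail_poly N r (Suc m) - u0) x = 0"
    using Suc.IH[of "tail_poly N r (Suc m)"] m by auto
  define q where "q = tail_poly N r (Suc m) - u0"
  note step = flag_step[OF m u0, folded q_def]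
  have qn: "poly_norm2 Z w q > 0" using step(1,2) by (rule poly_norm2_flag_pos)
  have q: "poly_inner Z w q x = 0" if "x \<in> flag m" for x using u0 that by (simp add: q_def)
  obtain u where u: "u \<in> flag m" "\<And>x. x \<in> flag m \<Longrightarrow> poly_inner Z w (v - u) x = 0"
    using Suc.IH[of v] m by auto
  define a where "a = poly_inner Z w v q / poly_inner Z w q q"
  have "u + smult a q \<in> flag (Suc m)"
    using flag_add_smult u(1) step(1) flag_mono[of m "Suc m"] by auto
  moreover have "poly_inner Z w (v - (u + smult a q)) x = 0" if x: "x \<in> flag (Suc m)" for x
  proof -
    obtain b where b: "x - smult b q \<in> flag m" using step(3)[OF x] by blast
    have eq: "v - (u + smult a q) = (v - u) - smult a q" by simp
    have 1: "poly_inner Z w (v - (u + smult a q)) (x - smult b q) = 0"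
      unfolding eq poly_inner_diff_left poly_inner_smult_left using u(2)[OF b] q[OF b] by (simp add: poly_inner_diff_left)
    have "poly_inner Z w u q = 0" using q[OF u(1)] by (rule poly_inner_commute_zero)
    then have 2: "poly_inner Z w (v - (u + smult a q)) q = 0"
      unfolding eq poly_inner_diff_left poly_inner_smult_left using qn by (simp add: a_def poly_inner_self)
    have "x = (x - smult b q) + smult b q" by simp
    then show ?thesis using 1 2 by (metis poly_inner_add_right poly_inner_smult_right add.right_neutral mult_zero_right)
  qed
  ultimately show ?case by blast
qed

lemma flag_orthogonal:
  assumes m: "m < N"
  shows "\<exists>q\<in>flag (Suc m). q \<noteq> 0 \<and> (\<forall>x\<in>flag m. poly_inner Z w q x = 0)"
proof -
  obtain u where u: "u \<in> flag m" "\<forall>x\<in>flag m. poly_inner Z w (tail_poly N r (Suc m) - u) x = 0"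
    using flag_projection[of m "tail_poly N r (Suc m)"] m by auto
  show ?thesis
    by (rule bexI[OF _ flag_step(1)[OF m u]]) (use flag_step(2)[OF m u] u(2) in auto)
qed

text \<open>Multiplying \<open>q\<close> by \<open>[:- r m, 1:]\<close> supplies the factor needed
  for \<open>flag m\<close>, but may raise the degree to \<open>N\<close>. Subtracting a multiple of
  \<open>tail_poly N r 0\<close> corrects the degree without losing divisibility. Both the corrected
  polynomial and \<open>tail_poly N r 0\<close> are orthogonal to \<open>q\<close>, so the Rayleigh
  quotient of \<open>q\<close> is \<open>r m\<close>.\<close>

lemma flag_rayleigh:
  assumes m: "m < N" and q: "q \<in> flag (Suc m)" "\<And>x. x \<in> flag m \<Longrightarrow> poly_inner Z w q x = 0"
    and g0: "poly_inner Z w (tail_poly N r 0) q = 0"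
  shows "poly_inner Z w ([:0, 1:] * q) q = r m * poly_inner Z w q q"
proof -
  let ?p = "[:- r m, 1:] * q"
  define y where "y = ?p - smult (coeff ?p N) (tail_poly N r 0)"
  have d: "degree ?p \<le> N"
    using degree_mult_le[of "[:- r m, 1:]" q] q(1) by (auto simp: flag_def)
  have "degree y \<le> N" unfolding y_def
    using d degree_tail_poly[of 0] degree_smult_le[of "coeff ?p N" "tail_poly N r 0"] by (intro degree_diff_le) auto
  moreover have "coeff y N = 0"
    unfolding y_def using lead_coeff_tail_poly[of 0] degree_tail_poly[of 0] by simp
  ultimately have "degree y < N"
    using N by (metis degree_0 le_neq_implies_less leading_coeff_0_iff)
  moreover have "tail_poly N r m dvd ?p"
    unfolding tail_poly_rec[OF m] by (rule mult_dvd_mono) (use q(1) in \<open>auto simp: flag_def\<close>)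
  then have "tail_poly N r m dvd y" unfolding y_def using tail_poly_dvd[of 0 m] by (intro dvd_diff dvd_smult) auto
  ultimately have "poly_inner Z w y q = 0" using q(2)[of y] by (auto simp: flag_def intro: poly_inner_commute_zero)
  then have "poly_inner Z w ?p q = 0" using g0 unfolding y_def by (simp add: poly_inner_diff_left poly_inner_smult_left)
  moreover have "?p = [:0, 1:] * q - smult (r m) q" by simp
  ultimately show ?thesis by (metis poly_inner_diff_left poly_inner_smult_left eq_iff_diff_eq_0)
qed

text \<open>The entries are the squared moduli of the coordinates of an orthonormal Schur basis.
  Normalisation gives the row sums, the Rayleigh quotients give the values \<open>r l\<close>. The
  hypothesis says that \<open>tail_poly N r 0\<close> is the direction removed by the compression;
  including it in Bessel's inequality produces the deficit in the column sums.\<close>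

lemma flag_averaging:
  assumes g0: "\<And>x. degree x < N \<Longrightarrow> poly_inner Z w x (tail_poly N r 0) = 0"
  shows "\<exists>M. (\<forall>l<N. \<forall>z\<in>Z. 0 \<le> M l z) \<and> (\<forall>l<N. (\<Sum>z\<in>Z. M l z) = 1) \<and>
     (\<forall>z\<in>Z. (\<Sum>l<N. M l z) \<le> 1 - w z * (cmod (poly (tail_poly N r 0) z))\<^sup>2 / poly_norm2 Z w (tail_poly N r 0)) \<and>
     (\<forall>l<N. r l = (\<Sum>z\<in>Z. of_real (M l z) * z))"
proof -
  obtain e where e: "\<And>m. m < N \<Longrightarrow> e m \<in> flag (Suc m) \<and> e m \<noteq> 0 \<and> (\<forall>x\<in>flag m. poly_inner Z w (e m) x = 0)"
    using flag_orthogonal by metis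
  have deg_e: "degree (e m) < N" if "m < N" for m using e[OF that] by (simp add: flag_def)
  have pos: "poly_norm2 Z w (e m) > 0" if "m < N" for m using e[OF that] poly_norm2_flag_pos by blast
  have pos0: "poly_norm2 Z w (tail_poly N r 0) > 0"
    using Z w tail_poly_nonzero degree_tail_poly[of 0] by (intro poly_norm2_pos) auto
  have orth': "poly_inner Z w (e l) (e m) = 0" if "m < l" "l < N" for l m
    using e[OF that(2)] e[of m] flag_mono[of "Suc m" l] that by auto
  have orth: "poly_inner Z w (e l) (e m) = 0" if "m \<noteq> l" "l < N" "m < N" for l m
    using orth'[of m l] orth'[of l m] poly_inner_commute_zero that by (metis linorder_neqE_nat)
  have ge: "poly_inner Z w (tail_poly N r 0) (e m) = 0" if "m < N" for m
    using g0[OF deg_e[OF that]] by (rule poly_inner_commute_zero)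
  define M where "M m z = w z * (cmod (poly (e m) z))\<^sup>2 / poly_norm2 Z w (e m)" for m z
  have "r m = (\<Sum>z\<in>Z. of_real (M m z) * z)" if m: "m < N" for m
  proof -
    have "poly_inner Z w ([:0, 1:] * e m) (e m) = r m * poly_inner Z w (e m) (e m)"
      using e[OF m] ge[OF m] m by (intro flag_rayleigh) auto
    moreover have "poly_inner Z w ([:0, 1:] * e m) (e m) = (\<Sum>z\<in>Z. of_real (w z * (cmod (poly (e m) z))\<^sup>2) * z)"
      unfolding poly_inner_def by (intro sum.cong refl) (simp add: complex_norm_square algebra_simps del: of_real_power)
    ultimately show ?thesis
      using pos[OF m] unfolding M_def by (simp add: poly_inner_self sum_divide_distrib[symmetric] field_simps)
  qed
  moreover have "(\<Sum>z\<in>Z. M m z) = 1" if "m < N" for m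
    using pos[OF that] unfolding M_def poly_norm2_def by (simp add: sum_divide_distrib[symmetric])
  moreover have "(\<Sum>l<N. M l z) \<le> 1 - w z * (cmod (poly (tail_poly N r 0) z))\<^sup>2 / poly_norm2 Z w (tail_poly N r 0)" if z: "z \<in> Z" for z
  proof -
    \<comment> \<open>Position \<open>N\<close> holds the removed direction, which completes the
      \<open>e i\<close> to an orthogonal family of \<open>N + 1\<close> vectors.\<close>
    define b where "b i = (if i = N then tail_poly N r 0 else e i)" for i
    have "(\<Sum>i\<in>{..<Suc N}. w z * (cmod (poly (b i) z))\<^sup>2 / poly_norm2 Z w (b i)) \<le> 1"
    proof (rule poly_inner_bessel[OF Z(1) z w])
      fix i j assume "i \<in> {..<Suc N}" "j \<in> {..<Suc N}" "i \<noteq> j"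
      then show "poly_inner Z w (b i) (b j) = 0"
        unfolding b_def using orth ge g0 deg_e by (auto simp: less_Suc_eq)
    qed (use pos pos0 in \<open>auto simp: b_def less_Suc_eq\<close>)
    then show ?thesis by (simp add: b_def M_def)
  qed
  moreover have "0 \<le> M m z" if "m < N" "z \<in> Z" for m z
    using w[OF that(2)] pos[OF that(1)] unfolding M_def by (intro divide_nonneg_pos) auto
  ultimately show ?thesis by blast
qed

end

text \<open>The sum is the coefficient of degree \<open>N\<close> in the Lagrange interpolant of
  \<open>p\<close> at the \<open>N + 1\<close> points of \<open>Z\<close>. The interpolant is
  \<open>p\<close> itself, whose degree is smaller.\<close>

lemma sum_lagrange_eq_0:
  fixes Z :: "complex set"
  assumes Z: "finite Z" "card Z = Suc N" and p: "degree p < N"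
  shows "(\<Sum>z\<in>Z. poly p z / (\<Prod>y\<in>Z - {z}. z - y)) = 0"
proof -
  define d where "d z = (\<Prod>y\<in>Z - {z}. z - y)" for z
  define L where "L z = (\<Prod>y\<in>Z - {z}. [:- y, 1:])" for z
  define q where "q = (\<Sum>z\<in>Z. smult (poly p z / d z) (L z))"
  have dnz: "d z \<noteq> 0" for z using Z by (auto simp: d_def)
  have degL: "degree (L z) = N" if "z \<in> Z" for z
    using Z that by (simp add: L_def degree_prod_sum_eq)
  have lcL: "coeff (L z) N = 1" if "z \<in> Z" for z
  proof -
    have "lead_coeff (L z) = 1" by (simp add: L_def lead_coeff_prod)
    then show ?thesis using degL[OF that] by simp
  qed
  have Lz: "poly (L z) x = (if x = z then d z else 0)" if "x \<in> Z" "z \<in> Z" for x z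
    using Z that by (auto simp: L_def d_def poly_prod intro!: prod_zero)
  have qz: "poly q x = poly p x" if "x \<in> Z" for x
  proof -
    have "poly q x = (\<Sum>z\<in>Z. if x = z then poly p z else 0)"
      unfolding q_def poly_sum using Lz[OF that] dnz by (intro sum.cong) auto
    then show ?thesis using Z that by simp
  qed
  have dq: "degree q \<le> N" unfolding q_def
    using Z degL by (intro degree_sum_le) (auto intro: order_trans[OF degree_smult_le])
  have "p - q = 0"
  proof (rule ccontr)
    assume nz: "p - q \<noteq> 0"
    have "Z \<subseteq> {x. poly (p - q) x = 0}" using qz by auto
    then have "card Z \<le> card {x. poly (p - q) x = 0}"
      using nz by (intro card_mono poly_roots_finite)
    also have "\<dots> \<le> degree (p - q)" using nz by (rule card_poly_roots_bound)
    also have "\<dots> \<le> N" using dq p by (intro degree_diff_le) auto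
    finally show False using Z by simp
  qed
  then have "coeff q N = 0" using p by (simp add: coeff_eq_0)
  then show ?thesis using lcL unfolding q_def d_def by (simp add: coeff_sum)
qed

text \<open>The hypothesis on \<open>r\<close> states that the monic polynomial with zeros
  \<open>r l\<close> is the numerator of the sum of \<open>t z / (x - z)\<close> divided by
  \<open>sum t Z\<close>, tested at the points of \<open>Z\<close>. It is exactly what makes this
  polynomial orthogonal to all polynomials of degree below \<open>N\<close> for a suitable
  weight.\<close>

lemma schur_averaging:
  fixes Z :: "complex set" and t :: "complex \<Rightarrow> real"
  assumes Z: "finite Z" "card Z = Suc N" and t: "\<And>z. z \<in> Z \<Longrightarrow> t z > 0"
    and r: "\<And>z. z \<in> Z \<Longrightarrow> of_real (sum t Z) * (\<Prod>l<N. z - r l) = of_real (t z) * (\<Prod>y\<in>Z - {z}. z - y)"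
  shows "\<exists>M. (\<forall>l<N. \<forall>z\<in>Z. 0 \<le> M l z) \<and> (\<forall>l<N. (\<Sum>z\<in>Z. M l z) = 1) \<and>
     (\<forall>z\<in>Z. (\<Sum>l<N. M l z) \<le> 1 - t z / sum t Z) \<and>
     (\<forall>l<N. r l = (\<Sum>z\<in>Z. of_real (M l z) * z))"
proof (cases "N = 0")
  case True
  then obtain z where "Z = {z}" using Z by (auto simp: card_1_singleton_iff)
  then show ?thesis using True t by auto
next
  case False
  then have N: "N > 0" by simp
  define T where "T = sum t Z"
  have T: "T > 0" unfolding T_def using Z t by (intro sum_pos) auto
  define g0 where "g0 = tail_poly N r 0"
  \<comment> \<open>With this weight \<open>w z * cnj (poly g0 z)\<close> equals
    \<open>t z / poly g0 z\<close>, which by \<open>r\<close> is \<open>T\<close> divided by the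
    product of the \<open>z - y\<close>. Orthogonality to \<open>g0\<close> thus becomes the
    vanishing of a Lagrange sum, and the deficit at \<open>z\<close> in the columns becomes
    \<open>t z / T\<close>.\<close>
  define w where "w z = t z / (cmod (poly g0 z))\<^sup>2" for z
  have g0: "poly g0 z = (\<Prod>l<N. z - r l)" for z
    unfolding g0_def tail_poly_def by (simp add: poly_prod atLeast0LessThan)
  have g0nz: "poly g0 z \<noteq> 0" if z: "z \<in> Z" for z
  proof -
    have "(\<Prod>y\<in>Z - {z}. z - y) \<noteq> 0" using Z by (simp add: prod_zero_iff)
    then have "of_real (sum t Z) * (\<Prod>l<N. z - r l) \<noteq> 0" using r[OF z] t[OF z] by simp
    then show ?thesis unfolding g0 by simp
  qed
  have w: "w z > 0" if "z \<in> Z" for z using t g0nz that by (simp add: w_def)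
  have wg: "w z * (cmod (poly g0 z))\<^sup>2 = t z" if "z \<in> Z" for z
    using g0nz[OF that] by (simp add: w_def)
  then have n: "poly_norm2 Z w g0 = T" by (simp add: poly_norm2_def T_def)
  have "poly_inner Z w x g0 = 0" if "degree x < N" for x
  proof -
    have "poly_inner Z w x g0 = (\<Sum>z\<in>Z. of_real T * (poly x z / (\<Prod>y\<in>Z - {z}. z - y)))"
      unfolding poly_inner_def
    proof (intro sum.cong refl)
      fix z assume z: "z \<in> Z"
      have d: "(\<Prod>y\<in>Z - {z}. z - y) \<noteq> 0" using Z by auto
      have "of_real (w z) * (poly x z * cnj (poly g0 z)) = of_real (t z) * poly x z / poly g0 z"
        using g0nz[OF z] unfolding w_def
        by (simp add: complex_norm_square divide_simps del: of_real_power)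
      also have "\<dots> = of_real T * (poly x z / (\<Prod>y\<in>Z - {z}. z - y))"
        using r[OF z] g0nz[OF z] d unfolding g0[symmetric] T_def[symmetric] by (simp add: field_simps)
      finally show "of_real (w z) * (poly x z * cnj (poly g0 z)) = \<dots>" .
    qed
    also have "\<dots> = 0" using sum_lagrange_eq_0[OF Z that] by (simp only: sum_distrib_left[symmetric] mult_zero_right)
    finally show ?thesis .
  qed
  then have "poly_inner Z w x (tail_poly N r 0) = 0" if "degree x < N" for x using that by (simp add: g0_def)
  from flag_averaging[OF Z w N this] obtain M where
    "(\<forall>l<N. \<forall>z\<in>Z. 0 \<le> M l z) \<and> (\<forall>l<N. (\<Sum>z\<in>Z. M l z) = 1) \<and>
     (\<forall>z\<in>Z. (\<Sum>l<N. M l z) \<le> 1 - w z * (cmod (poly g0 z))\<^sup>2 / poly_norm2 Z w g0) \<and>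
     (\<forall>l<N. r l = (\<Sum>z\<in>Z. of_real (M l z) * z))" unfolding g0_def by blast
  then show ?thesis using wg n unfolding T_def by (intro exI[of _ M]) auto
qed

section \<open>Zeros of weighted derivatives\<close>

lemma maj_subset:
  assumes maj: "maj c X Y" and C: "convex C" "set_mset Y \<subseteq> C"
  shows "set_mset X \<subseteq> C"
proof -
  obtain x y M where M: "image_mset x (mset_set {..<size X}) = X" "image_mset y (mset_set {..<size Y}) = Y"
     "averaging {..<size X} {..<size Y} c x y M" using maj unfolding maj_def by blast
  have yC: "y j \<in> C" if "j < size Y" for j
    using that C(2) by (subst (asm) M(2)[symmetric]) auto
  have "x i \<in> C" if i: "i < size X" for i
  proof -
    have "(\<Sum>j<size Y. M i j *\<^sub>R y j) \<in> C"
      using M(3) i yC by (intro convex_sum C(1)) (auto simp: averaging_def)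
    then show ?thesis using M(3) i by (simp add: averaging_def scaleR_conv_of_real)
  qed
  then show ?thesis by (subst M(1)[symmetric]) auto
qed

lemma sum_count_times_complex:
  fixes f :: "'a \<Rightarrow> complex"
  assumes "finite X" "set_mset M \<subseteq> X"
  shows "(\<Sum>x\<in>X. of_nat (count M x) * f x) = (\<Sum>x\<in>#M. f x)"
  using assms(2)
proof (induction M)
  case (add y M)
  have "(\<Sum>x\<in>X. of_nat (count (add_mset y M) x) * f x) =
          (\<Sum>x\<in>X. of_nat (count M x) * f x + (if x = y then f y else 0))"
    by (intro sum.cong) (auto simp: algebra_simps)
  then show ?case using add assms(1) by (simp add: sum.distrib)
qed simp

lemma poly_eq_off_finite:
  fixes p q :: "complex poly"
  assumes "finite A" "\<And>x. x \<notin> A \<Longrightarrow> poly p x = poly q x"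
  shows "p = q"
proof (rule ccontr)
  assume "p \<noteq> q"
  then have "finite {x. poly (p - q) x = 0}" by (intro poly_roots_finite) simp
  moreover have "UNIV = A \<union> {x. poly (p - q) x = 0}" using assms(2) by auto
  ultimately show False using assms(1) infinite_UNIV_char_0[where 'a = complex] by (metis finite_UnI)
qed

text \<open>The weight \<open>t v\<close> is shared by all copies of \<open>v\<close> in \<open>Y\<close>.\<close>

definition weighted_deriv :: "complex multiset \<Rightarrow> (complex \<Rightarrow> real) \<Rightarrow> complex poly \<Rightarrow> bool" where
  "weighted_deriv Y t R \<longleftrightarrow> Y \<noteq> {#} \<and> (\<forall>v\<in>#Y. t v > 0) \<and>
     (\<forall>x. x \<notin># Y \<longrightarrow>
        poly R x = (\<Prod>y\<in>#Y. x - y) * (\<Sum>v\<in>set_mset Y. of_real (t v) / (x - v)))"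

text \<open>The numerator of the sum of \<open>t v / (x - v)\<close> over the common denominator of
  the distinct points. Repeated points are split off beforehand, since the compression argument
  needs distinct diagonal entries.\<close>

definition reduced_deriv :: "complex set \<Rightarrow> (complex \<Rightarrow> real) \<Rightarrow> complex poly" where
  "reduced_deriv Z t = (\<Sum>v\<in>Z. smult (of_real (t v)) (\<Prod>y\<in>Z - {v}. [:- y, 1:]))"

lemma weighted_deriv_factor:
  assumes "weighted_deriv Y t R"
  shows "R = (\<Prod>v\<in>set_mset Y. [:- v, 1:] ^ (count Y v - 1)) * reduced_deriv (set_mset Y) t"
proof (rule poly_eq_off_finite[of "set_mset Y"])
  fix x assume x: "x \<notin> set_mset Y"
  let ?Z = "set_mset Y"
  have "(\<Prod>y\<in>#Y. x - y) = (\<Prod>v\<in>?Z. (x - v) ^ count Y v)"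
    by (simp add: image_prod_mset_multiplicity)
  also have "\<dots> = (\<Prod>v\<in>?Z. (x - v) ^ (count Y v - 1) * (x - v))"
    by (intro prod.cong refl) (metis Suc_diff_1 count_greater_zero_iff power_Suc2)
  finally have 1: "(\<Prod>y\<in>#Y. x - y) = (\<Prod>v\<in>?Z. (x - v) ^ (count Y v - 1)) * (\<Prod>v\<in>?Z. x - v)"
    by (simp add: prod.distrib)
  have "(\<Prod>v\<in>?Z. x - v) * (\<Sum>v\<in>?Z. of_real (t v) / (x - v))
      = (\<Sum>v\<in>?Z. of_real (t v) * (\<Prod>y\<in>?Z - {v}. x - y))"
    unfolding sum_distrib_left
  proof (intro sum.cong refl)
    fix v assume v: "v \<in> ?Z"
    then have "(\<Prod>v\<in>?Z. x - v) = (x - v) * (\<Prod>y\<in>?Z - {v}. x - y)" by (simp add: prod.remove)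
    then show "(\<Prod>v\<in>?Z. x - v) * (of_real (t v) / (x - v)) = of_real (t v) * (\<Prod>y\<in>?Z - {v}. x - y)"
      using v x by auto
  qed
  with 1 show "poly R x = poly ((\<Prod>v\<in>?Z. [:- v, 1:] ^ (count Y v - 1)) * reduced_deriv ?Z t) x"
    using assms x unfolding weighted_deriv_def reduced_deriv_def
    by (simp add: poly_prod poly_sum poly_power mult.assoc)
qed auto

text \<open>Positive weights cannot cancel in the coefficient of degree \<open>N\<close>, so the
  degree is exactly \<open>N\<close> and there are \<open>N\<close> zeros.\<close>

lemma reduced_deriv_decompose:
  assumes Z: "finite Z" "card Z = Suc N" and t: "\<And>z. z \<in> Z \<Longrightarrow> t z > 0"
  obtains r where "reduced_deriv Z t = smult (of_real (sum t Z)) (\<Prod>l<N. [:- r l, 1:])"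
proof -
  have T: "sum t Z > 0" using Z t by (intro sum_pos) auto
  let ?L = "\<lambda>v. \<Prod>y\<in>Z - {v}. [:- y, 1:]"
  have degL: "degree (?L v) = N" if "v \<in> Z" for v
    using Z that by (simp add: degree_prod_sum_eq)
  have "lead_coeff (?L v) = 1" for v by (simp add: lead_coeff_prod)
  then have lc: "coeff (?L v) N = 1" if "v \<in> Z" for v using degL[OF that] by metis
  have cN: "coeff (reduced_deriv Z t) N = of_real (sum t Z)"
    unfolding reduced_deriv_def using lc by (simp add: coeff_sum)
  have "degree (reduced_deriv Z t) \<le> N" unfolding reduced_deriv_def
    using Z degL by (intro degree_sum_le) (auto intro: order_trans[OF degree_smult_le])
  moreover have "degree (reduced_deriv Z t) \<ge> N"
  proof (rule le_degree)
    show "coeff (reduced_deriv Z t) N \<noteq> 0" unfolding cN using T by (simp only: of_real_eq_0_iff)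
  qed
  ultimately have "degree (reduced_deriv Z t) = N" by simp
  with cN that show ?thesis using complex_poly_decompose'[of "reduced_deriv Z t"] by metis
qed

lemma lead_coeff_weighted_deriv:
  assumes "weighted_deriv Y t R"
  shows "lead_coeff R = of_real (sum t (set_mset Y))" "R \<noteq> 0"
proof -
  let ?Z = "set_mset Y"
  have Z: "finite ?Z" "card ?Z = Suc (card ?Z - 1)" using assms by (auto simp: weighted_deriv_def card_gt_0_iff)
  have t: "t z > 0" if "z \<in> ?Z" for z using assms that by (simp add: weighted_deriv_def)
  obtain r where r: "reduced_deriv ?Z t = smult (of_real (sum t ?Z)) (\<Prod>l<card ?Z - 1. [:- r l, 1:])"
    using reduced_deriv_decompose[OF Z t] .
  show *: "lead_coeff R = of_real (sum t (set_mset Y))"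
    unfolding weighted_deriv_factor[OF assms] r by (simp add: lead_coeff_mult lead_coeff_prod lead_coeff_power)
  have "sum t ?Z > 0" using t assms by (intro sum_pos) (auto simp: weighted_deriv_def)
  then have "complex_of_real (sum t ?Z) \<noteq> 0" by (simp only: of_real_eq_0_iff)
  with * show "R \<noteq> 0" by (metis leading_coeff_0_iff)
qed

lemma proots_image_linear: "finite I \<Longrightarrow> proots (\<Prod>l\<in>I. [:- r l, 1:]) = image_mset r (mset_set I)"
  by (subst proots_prod) (auto simp: sum_unfold_sum_mset)

text \<open>A point of multiplicity \<open>m\<close> contributes \<open>m - 1\<close> zeros of
  \<open>R\<close> at itself; these are spread evenly over its \<open>m\<close> copies.\<close>

lemma maj_weighted_deriv:
  assumes wd: "weighted_deriv Y t R"
    and c: "\<And>v. v \<in># Y \<Longrightarrow> real (count Y v) - t v / sum t (set_mset Y) \<le> c * real (count Y v)"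
  shows "maj c (proots R) Y"
proof -
  let ?Z = "set_mset Y"
  define N where "N = card ?Z - 1"
  have Z: "finite ?Z" "card ?Z = Suc N" using wd by (auto simp: weighted_deriv_def card_gt_0_iff N_def)
  have t: "t z > 0" if "z \<in> ?Z" for z using wd that by (simp add: weighted_deriv_def)
  define T where "T = sum t ?Z"
  have T: "T > 0" unfolding T_def using Z t by (intro sum_pos) auto
  obtain r where r: "reduced_deriv ?Z t = smult (of_real T) (\<Prod>l<N. [:- r l, 1:])"
    unfolding T_def using reduced_deriv_decompose[OF Z t] .
  have "of_real T * (\<Prod>l<N. z - r l) = of_real (t z) * (\<Prod>y\<in>?Z - {z}. z - y)" if z: "z \<in> ?Z" for z
  proof -
    have "of_real T * (\<Prod>l<N. z - r l) = poly (reduced_deriv ?Z t) z" unfolding r by (simp add: poly_prod)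
    also have "\<dots> = (\<Sum>v\<in>?Z. of_real (t v) * (\<Prod>y\<in>?Z - {v}. z - y))"
      by (simp add: reduced_deriv_def poly_sum poly_prod)
    also have "\<dots> = (\<Sum>v\<in>?Z. if v = z then of_real (t z) * (\<Prod>y\<in>?Z - {z}. z - y) else 0)"
      using z by (intro sum.cong refl) (auto simp: prod_zero_iff)
    finally show ?thesis using z by simp
  qed
  from schur_averaging[OF Z t this[unfolded T_def]] obtain A where
    "(\<forall>l<N. \<forall>z\<in>?Z. 0 \<le> A l z) \<and> (\<forall>l<N. (\<Sum>z\<in>?Z. A l z) = 1) \<and>
     (\<forall>z\<in>?Z. (\<Sum>l<N. A l z) \<le> 1 - t z / T) \<and>
     (\<forall>l<N. r l = (\<Sum>z\<in>?Z. of_real (A l z) * z))"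
    unfolding T_def by blast
  then have A0: "\<And>l z. l < N \<Longrightarrow> z \<in> ?Z \<Longrightarrow> 0 \<le> A l z" and A1: "\<And>l. l < N \<Longrightarrow> (\<Sum>z\<in>?Z. A l z) = 1"
    and A2: "\<And>z. z \<in> ?Z \<Longrightarrow> (\<Sum>l<N. A l z) \<le> 1 - t z / T"
    and A3: "\<And>l. l < N \<Longrightarrow> r l = (\<Sum>z\<in>?Z. of_real (A l z) * z)" by blast+
  define m where "m v = count Y v" for v
  have mpos: "m v > 0" if "v \<in> ?Z" for v using that by (simp add: m_def)
  let ?B = "Sigma ?Z (\<lambda>v. {..<m v - 1})" and ?J = "Sigma ?Z (\<lambda>v. {..<m v})"
  let ?I = "{..<N} <+> ?B"
  define x where "x = case_sum r (fst :: complex \<times> nat \<Rightarrow> complex)"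
  define M where "M i j = (case i of Inl l \<Rightarrow> A l (fst j) / m (fst j)
      | Inr b \<Rightarrow> of_bool (fst b = fst j) / m (fst j))" for i :: "nat + complex \<times> nat" and j :: "complex \<times> nat"
  have sumJ: "(\<Sum>j\<in>?J. f (fst j) / of_nat (m (fst j))) = (\<Sum>v\<in>?Z. f v)" for f :: "complex \<Rightarrow> 'b :: field_char_0"
  proof -
    have "(\<Sum>j\<in>?J. f (fst j) / of_nat (m (fst j))) = (\<Sum>v\<in>?Z. \<Sum>i<m v. f v / of_nat (m v))"
      by (subst sum.Sigma) (auto simp: case_prod_beta)
    also have "\<dots> = (\<Sum>v\<in>?Z. f v)" using mpos by (intro sum.cong) auto
    finally show ?thesis .
  qed
  have "averaging ?I ?J c x fst M"
    unfolding averaging_def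
  proof (intro conjI ballI)
    fix i j assume "i \<in> ?I" "j \<in> ?J"
    then show "0 \<le> M i j" unfolding M_def using A0 by (auto split: sum.split)
  next
    fix i assume i: "i \<in> ?I"
    show "(\<Sum>j\<in>?J. M i j) = 1"
    proof (cases i)
      case (Inl l)
      then show ?thesis using i A1[of l] sumJ[of "A l"] by (auto simp: M_def)
    next
      case (Inr b)
      then show ?thesis using i sumJ[of "\<lambda>v. of_bool (fst b = v)"] by (auto simp: M_def)
    qed
    show "x i = (\<Sum>j\<in>?J. of_real (M i j) * fst j)"
    proof (cases i)
      case (Inl l)
      then show ?thesis using i A3[of l] sumJ[of "\<lambda>v. of_real (A l v) * v"] by (auto simp: M_def x_def)
    next
      case (Inr b)
      have "(\<Sum>v\<in>?Z. of_real (of_bool (fst b = v)) * v) = (\<Sum>v\<in>?Z. if v = fst b then fst b else 0)"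
        by (rule sum.cong) auto
      also have "\<dots> = fst b" using i Inr by auto
      finally show ?thesis using i Inr sumJ[of "\<lambda>v. of_real (of_bool (fst b = v)) * v"]
        by (simp add: M_def x_def)
    qed
  next
    \<comment> \<open>A copy of \<open>v\<close> receives at most \<open>(1 - t v / T) / m v\<close>
      from the zeros of \<open>reduced_deriv\<close> and \<open>(m v - 1) / m v\<close> from the
      zeros that stay at \<open>v\<close>. The total is \<open>(m v - t v / T) / m v\<close>, which
      explains the form of the hypothesis \<open>c\<close>.\<close>
    fix j assume j: "j \<in> ?J"
    define v where "v = fst j"
    have v: "v \<in> ?Z" using j by (auto simp: v_def)
    have "(\<Sum>i\<in>?I. M i j) = (\<Sum>l<N. A l v / m v) + (\<Sum>b\<in>?B. of_bool (fst b = v) / m v)"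
      by (subst sum.Plus) (auto simp: M_def v_def)
    also have "(\<Sum>b\<in>?B. of_bool (fst b = v) / real (m v)) = (\<Sum>u\<in>?Z. if u = v then (m v - 1) / real (m v) else 0)"
    proof -
      have "(\<Sum>b\<in>?B. of_bool (fst b = v) / real (m v))
          = (\<Sum>u\<in>?Z. \<Sum>i<m u - 1. of_bool (u = v) / real (m v))"
        by (subst sum.Sigma) (auto simp: case_prod_beta)
      also have "\<dots> = (\<Sum>u\<in>?Z. if u = v then (m v - 1) / real (m v) else 0)"
        by (rule sum.cong) auto
      finally show ?thesis .
    qed
    also have "\<dots> = (m v - 1) / real (m v)" using v by simp
    also have "(\<Sum>l<N. A l v / m v) = (\<Sum>l<N. A l v) / m v" by (simp add: sum_divide_distrib)
    also have "(\<Sum>l<N. A l v) / m v + (m v - 1) / real (m v) \<le> (1 - t v / T) / m v + (m v - 1) / real (m v)"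
      using A2[OF v] by (intro add_right_mono divide_right_mono) auto
    also have "\<dots> = (m v - t v / T) / m v" using mpos[OF v] by (simp add: field_simps of_nat_diff)
    also have "\<dots> \<le> c" using c[OF v] mpos[OF v] by (simp add: m_def T_def field_simps)
    finally show "(\<Sum>i\<in>?I. M i j) \<le> c" .
  qed
  then have *: "maj c (image_mset x (mset_set ?I)) (image_mset fst (mset_set ?J))"
    by (rule averaging_maj) auto
  have fstS: "image_mset fst (mset_set (Sigma ?Z (\<lambda>v. {..<n v}))) = (\<Sum>v\<in>?Z. replicate_mset (n v) v)" for n :: "complex \<Rightarrow> nat"
  proof (rule multiset_eqI)
    fix u
    let ?S = "Sigma ?Z (\<lambda>v. {..<n v})"
    have "count (image_mset fst (mset_set ?S)) u
        = (\<Sum>p | p \<in># mset_set ?S \<and> u = fst p. count (mset_set ?S) p)" by (rule count_image_mset')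
    also have "\<dots> = (\<Sum>p\<in>{p \<in> ?S. fst p = u}. 1)" by (rule sum.cong) auto
    finally have "count (image_mset fst (mset_set ?S)) u = card {p \<in> ?S. fst p = u}" by simp
    also have "{p \<in> Sigma ?Z (\<lambda>v. {..<n v}). fst p = u} = (if u \<in> ?Z then {u} \<times> {..<n u} else {})"
      by auto
    also have "card \<dots> = count (\<Sum>v\<in>?Z. replicate_mset (n v) v) u"
      by (simp add: count_sum)
    finally show "count (image_mset fst (mset_set (Sigma ?Z (\<lambda>v. {..<n v})))) u
        = count (\<Sum>v\<in>?Z. replicate_mset (n v) v) u" .
  qed
  have "image_mset fst (mset_set ?J) = Y"
    unfolding fstS m_def by (rule multiset_eqI) (simp add: count_sum not_in_iff)
  moreover have "image_mset x (mset_set ?I) = proots R"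
  proof -
    have "mset_set ?I = image_mset Inl (mset_set {..<N}) + image_mset Inr (mset_set ?B)"
      unfolding Plus_def by (subst mset_set_Union) (auto simp: image_mset_mset_set)
    then have "image_mset x (mset_set ?I) = image_mset r (mset_set {..<N}) + image_mset fst (mset_set ?B)"
      by (simp add: x_def multiset.map_comp o_def)
    also have "image_mset fst (mset_set ?B) = (\<Sum>v\<in>?Z. replicate_mset (m v - 1) v)" by (rule fstS)
    also have "\<dots> = proots (\<Prod>v\<in>?Z. [:- v, 1:] ^ (m v - 1))"
      by (subst proots_prod) (auto simp: proots_power intro!: sum.cong multiset_eqI)
    also have "image_mset r (mset_set {..<N}) = proots (reduced_deriv ?Z t)"
      unfolding r using T by (simp add: proots_image_linear)
    also have "proots (reduced_deriv ?Z t) + proots (\<Prod>v\<in>?Z. [:- v, 1:] ^ (m v - 1)) = proots R"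
      using lead_coeff_weighted_deriv(2)[OF wd]
      unfolding weighted_deriv_factor[OF wd] m_def by (subst proots_mult) (auto simp: add.commute)
    finally show ?thesis .
  qed
  ultimately show ?thesis using * by simp
qed

text \<open>A line separates \<open>z\<close> from \<open>K\<close>, so all terms
  \<open>t v / (z - v)\<close> point into one half-plane and cannot cancel: their sum has modulus at
  least a fixed multiple of the total weight. The total weight is also the leading coefficient of
  \<open>R\<close>, so it drops out and the constant depends only on \<open>K\<close> and
  \<open>z\<close>.\<close>

lemma weighted_deriv_prod_bound:
  assumes K: "convex K" "compact K" and z: "z \<notin> K"
  obtains \<kappa> where "\<kappa> > 0"
    "\<And>Y t R. weighted_deriv Y t R \<Longrightarrow> set_mset Y \<subseteq> K \<Longrightarrow>
       \<kappa> * (\<Prod>y\<in>#Y. cmod (z - y)) \<le> (\<Prod>y\<in>#proots R. cmod (z - y))"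
proof -
  obtain a b where ab: "inner a z < b" "\<And>x. x \<in> K \<Longrightarrow> inner a x > b"
    using separating_hyperplane_closed_point[OF K(1) compact_imp_closed[OF K(2)] z] by blast
  define \<delta> where "\<delta> = b - inner a z"
  have \<delta>: "\<delta> > 0" using ab by (simp add: \<delta>_def)
  obtain D0 where D0: "\<And>x. x \<in> K \<Longrightarrow> cmod x \<le> D0" using compact_imp_bounded[OF K(2)] by (auto simp: bounded_iff)
  define D where "D = \<bar>D0\<bar> + cmod z + 1"
  have D: "D > 0" "\<And>x. x \<in> K \<Longrightarrow> cmod (x - z) \<le> D"
    using D0 norm_triangle_ineq4[of _ z] by (auto simp: D_def intro: add_nonneg_pos) (smt (verit))
  \<comment> \<open>\<open>\<delta> / D\<^sup>2\<close> bounds the real part of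
    \<open>a / (v - z)\<close> from below on \<open>K\<close>. Adding 1 to \<open>cmod a\<close>
    keeps the denominator positive even when \<open>a\<close> is zero.\<close>
  define \<kappa> where "\<kappa> = \<delta> / (D\<^sup>2 * (cmod a + 1))"
  have a1: "cmod a + 1 > 0" by (simp add: add_nonneg_pos)
  have "\<kappa> > 0" unfolding \<kappa>_def using \<delta> D(1) a1 by simp
  moreover have "\<kappa> * (\<Prod>y\<in>#Y. cmod (z - y)) \<le> (\<Prod>y\<in>#proots R. cmod (z - y))"
    if wd: "weighted_deriv Y t R" and YK: "set_mset Y \<subseteq> K" for Y t R
  proof -
    define T where "T = sum t (set_mset Y)"
    have t: "t v > 0" if "v \<in># Y" for v using wd that by (simp add: weighted_deriv_def)
    have T: "T > 0" unfolding T_def using t wd by (intro sum_pos) (auto simp: weighted_deriv_def)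
    define s where "s = (\<Sum>v\<in>set_mset Y. of_real (t v) / (z - v))"
    have "T * (\<delta> / D\<^sup>2) \<le> (\<Sum>v\<in>set_mset Y. Re (- a * (of_real (t v) / (z - v))))"
      unfolding T_def sum_distrib_right
    proof (rule sum_mono)
      fix v assume v: "v \<in> set_mset Y"
      then have vK: "v \<in> K" and vz: "v \<noteq> z" using YK z by auto
      have n: "cmod (v - z) > 0" using vz by simp
      have "a / (v - z) = a * cnj (v - z) / (cmod (v - z))\<^sup>2" by (rule complex_div_cnj)
      then have "Re (a / (v - z)) = inner a (v - z) / (cmod (v - z))\<^sup>2"
        by (simp add: inner_complex_def algebra_simps flip: of_real_power)
      moreover have "\<delta> / D\<^sup>2 \<le> inner a (v - z) / (cmod (v - z))\<^sup>2"
        using ab(2)[OF vK] \<delta> D(2)[OF vK] n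
        by (intro frac_le power_mono) (auto simp: \<delta>_def inner_diff_right)
      moreover have "- a * (of_real (t v) / (z - v)) = of_real (t v) * (a / (v - z))"
        using vz by (simp add: divide_simps) (simp add: algebra_simps)
      moreover have "Re (of_real (t v) * (a / (v - z))) = t v * Re (a / (v - z))"
        by (simp del: times_divide_eq_right)
      ultimately show "t v * (\<delta> / D\<^sup>2) \<le> Re (- a * (of_real (t v) / (z - v)))"
        using t[of v] v by (metis less_imp_le mult_left_mono)
    qed
    also have "\<dots> = Re (- a * s)" unfolding s_def sum_distrib_left Re_sum ..
    also have "\<dots> \<le> cmod (- a * s)" by (rule complex_Re_le_cmod)
    also have "\<dots> \<le> (cmod a + 1) * cmod s" by (simp add: norm_mult mult_right_mono)
    finally have "T * (\<delta> / D\<^sup>2) / (cmod a + 1) \<le> cmod s"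
      using a1 by (simp only: pos_divide_le_eq mult.commute)
    then have s: "T * \<kappa> \<le> cmod s" by (simp add: \<kappa>_def)
    have Rnz: "R \<noteq> 0" and lc: "lead_coeff R = of_real T"
      using lead_coeff_weighted_deriv[OF wd] by (auto simp: T_def)
    have cm: "cmod (\<Prod>y\<in>#X. z - y) = (\<Prod>y\<in>#X. cmod (z - y))" for X
      by (induction X) (auto simp: norm_mult)
    have "poly R z = of_real T * (\<Prod>y\<in>#proots R. z - y)"
      by (subst complex_poly_decompose_multiset[of R, symmetric])
         (simp add: lc poly_prod_mset multiset.map_comp o_def)
    moreover have "poly R z = (\<Prod>y\<in>#Y. z - y) * s"
      using wd YK z unfolding weighted_deriv_def s_def by blast
    ultimately have "T * (\<Prod>y\<in>#proots R. cmod (z - y)) = (\<Prod>y\<in>#Y. cmod (z - y)) * cmod s"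
      using T by (metis abs_of_pos cm norm_mult norm_of_real)
    also have "\<dots> \<ge> (\<Prod>y\<in>#Y. cmod (z - y)) * (T * \<kappa>)"
      using s by (intro mult_left_mono) (simp_all flip: cm)
    finally show ?thesis using T by (simp add: mult.commute mult.left_commute)
  qed
  ultimately show ?thesis using that by blast
qed

section \<open>Zeros of Van Vleck polynomials\<close>

lemma maj_refl: "maj 1 X X"
proof -
  have "averaging {} {} 1 (\<lambda>_. 0) (\<lambda>_. 0) (\<lambda>(_ :: nat) (_ :: nat). 0)" by (simp add: averaging_def)
  from averaging_maj[OF this] have "maj 1 {#} {#}" by simp
  from maj_add[OF this, of X] show ?thesis by simp
qed

section \<open>Logarithmic derivatives and the zeros of iterated derivatives\<close>

lemma poly_pderiv_linear_factors:
  fixes x :: complex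
  assumes "x \<notin># Y"
  shows "poly (pderiv (\<Prod>y\<in>#Y. [:- y, 1:])) x = (\<Prod>y\<in>#Y. x - y) * (\<Sum>y\<in>#Y. 1 / (x - y))"
  using assms
proof (induction Y)
  case (add y Y)
  let ?P = "\<Prod>y\<in>#Y. [:- y, 1:]"
  have P: "poly ?P x = (\<Prod>y\<in>#Y. x - y)"
    by (simp add: poly_prod_mset multiset.map_comp o_def)
  have "pderiv [:- y, 1:] = 1" by (simp add: pderiv_pCons)
  then have D: "poly (pderiv ([:- y, 1:] * ?P)) x = (x - y) * poly (pderiv ?P) x + poly ?P x"
    by (simp only: pderiv_mult poly_add poly_mult) simp
  have "poly (pderiv (\<Prod>y\<in>#add_mset y Y. [:- y, 1:])) x
      = (x - y) * ((\<Prod>y\<in>#Y. x - y) * (\<Sum>y\<in>#Y. 1 / (x - y))) + (\<Prod>y\<in>#Y. x - y)"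
    unfolding image_mset_add_mset prod_mset.add_mset D P using add by simp
  also have "\<dots> = (\<Prod>y\<in>#add_mset y Y. x - y) * (\<Sum>y\<in>#add_mset y Y. 1 / (x - y))"
    using add.prems by (simp add: field_simps)
  finally show ?case .
qed (simp add: pderiv_1)

lemma poly_linear_factors:
  "poly P x = lead_coeff P * (\<Prod>y\<in>#proots P. x - y)" for x :: complex
  by (subst complex_poly_decompose_multiset[of P, symmetric])
     (simp add: poly_prod_mset multiset.map_comp o_def)

lemma poly_pderiv_log:
  fixes x :: complex
  assumes "x \<notin># proots P"
  shows "poly (pderiv P) x = lead_coeff P * (\<Prod>y\<in>#proots P. x - y) * (\<Sum>y\<in>#proots P. 1 / (x - y))"
  by (subst complex_poly_decompose_multiset[of P, symmetric])
     (simp add: pderiv_smult poly_pderiv_linear_factors[OF assms])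

lemma weighted_deriv_pderiv:
  assumes "degree P \<ge> 1"
  shows "weighted_deriv (proots P) (\<lambda>v. real (count (proots P) v)) (smult (1 / lead_coeff P) (pderiv P))"
  unfolding weighted_deriv_def
proof (intro conjI allI impI ballI)
  show "proots P \<noteq> {#}" using assms size_proots_complex[of P] by auto
next
  fix v assume "v \<in># proots P" then show "real (count (proots P) v) > 0"
    by (simp del: count_proots)
next
  fix x assume x: "x \<notin># proots P"
  have lc: "lead_coeff P \<noteq> 0" using assms by auto
  have "(\<Sum>v\<in>set_mset (proots P). of_nat (count (proots P) v) * (1 / (x - v))) = (\<Sum>y\<in>#proots P. 1 / (x - y))"
    by (rule sum_count_times_complex) auto
  then show "poly (smult (1 / lead_coeff P) (pderiv P)) x = (\<Prod>y\<in>#proots P. x - y) *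
      (\<Sum>v\<in>set_mset (proots P). of_real (real (count (proots P) v)) / (x - v))"
    using lc poly_pderiv_log[OF x] by (simp del: count_proots)
qed

lemma sum_count_proots: "(\<Sum>v\<in>set_mset X. real (count X v)) = real (size X)"
  by (simp add: size_multiset_overloaded_eq)

text \<open>For an ordinary derivative the weight of \<open>v\<close> is its multiplicity and the
  total weight is the degree. The column condition then holds with equality for 1 -
  1/\<open>degree P\<close>.\<close>

lemma maj_pderiv:
  assumes "degree P \<ge> 1"
  shows "maj (1 - 1 / real (degree P)) (proots (pderiv P)) (proots P)"
proof -
  have lc: "lead_coeff P \<noteq> 0" using assms by auto
  have "maj (1 - 1 / real (degree P)) (proots (smult (1 / lead_coeff P) (pderiv P))) (proots P)"
    by (rule maj_weighted_deriv[OF weighted_deriv_pderiv[OF assms]])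
       (simp add: sum_count_proots size_proots_complex algebra_simps del: count_proots)
  then show ?thesis using lc by simp
qed

lemma pderiv_iter:
  fixes P :: "complex poly"
  assumes "j \<le> degree P" "P \<noteq> 0"
  shows "degree ((pderiv ^^ j) P) = degree P - j" "(pderiv ^^ j) P \<noteq> 0"
proof -
  have "degree ((pderiv ^^ j) P) = degree P - j \<and> (pderiv ^^ j) P \<noteq> 0"
    using assms
  proof (induction j)
    case (Suc j)
    then have "degree ((pderiv ^^ j) P) = degree P - j" "degree ((pderiv ^^ j) P) \<noteq> 0" by auto
    then show ?case by (auto simp: degree_pderiv pderiv_eq_0_iff)
  qed simp
  then show "degree ((pderiv ^^ j) P) = degree P - j" "(pderiv ^^ j) P \<noteq> 0" by auto
qed

lemma maj_pderiv_iter: "j \<le> degree P \<Longrightarrow> maj 1 (proots ((pderiv ^^ j) P)) (proots P)"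
proof (induction j)
  case (Suc j)
  then have P: "P \<noteq> 0" by auto
  have "degree ((pderiv ^^ j) P) \<ge> 1" using pderiv_iter(1)[of j P] Suc.prems P by simp
  from maj_mono[OF maj_pderiv[OF this], of 1]
  have "maj 1 (proots ((pderiv ^^ Suc j) P)) (proots ((pderiv ^^ j) P))" by simp
  from maj_trans[OF this Suc.IH] Suc.prems show ?case by simp
qed (simp add: maj_refl)

text \<open>One derivative contributes the strict factor, and the remaining ones are estimated by
  1.\<close>

lemma maj_pderiv_iter_strict:
  assumes "1 \<le> j" "j \<le> degree P"
  shows "maj (1 - 1 / real (degree P)) (proots ((pderiv ^^ j) P)) (proots P)"
proof -
  obtain i where j: "j = Suc i" using assms by (cases j) auto
  have "i \<le> degree (pderiv P)" using assms by (simp add: j degree_pderiv)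
  from maj_trans[OF maj_pderiv_iter[OF this] maj_pderiv] assms
  show ?thesis by (simp add: j funpow_swap1)
qed

lemma prod_dist_pderiv_iter:
  assumes K: "convex K" and \<kappa>: "\<kappa> > 0"
    "\<And>Y t R. weighted_deriv Y t R \<Longrightarrow> set_mset Y \<subseteq> K \<Longrightarrow>
       \<kappa> * (\<Prod>y\<in>#Y. cmod (z - y)) \<le> (\<Prod>y\<in>#proots R. cmod (z - y))"
    and P: "set_mset (proots P) \<subseteq> K"
  shows "j \<le> degree P \<Longrightarrow>
    \<kappa> ^ j * (\<Prod>y\<in>#proots P. cmod (z - y)) \<le> (\<Prod>y\<in>#proots ((pderiv ^^ j) P). cmod (z - y))"
proof (induction j)
  case (Suc j)
  then have nz: "P \<noteq> 0" by auto
  let ?D = "(pderiv ^^ j) P"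
  have d: "degree ?D \<ge> 1" using pderiv_iter(1)[of j P] Suc.prems nz by simp
  then have lc: "lead_coeff ?D \<noteq> 0" by auto
  have sub: "set_mset (proots ?D) \<subseteq> K" using maj_subset[OF maj_pderiv_iter K P] Suc.prems by simp
  have "\<kappa> ^ Suc j * (\<Prod>y\<in>#proots P. cmod (z - y)) \<le> \<kappa> * (\<Prod>y\<in>#proots ?D. cmod (z - y))"
    using Suc.IH Suc.prems \<kappa>(1) by (simp add: mult.assoc)
  also have "\<dots> \<le> (\<Prod>y\<in>#proots (smult (1 / lead_coeff ?D) (pderiv ?D)). cmod (z - y))"
    by (rule \<kappa>(2)[OF weighted_deriv_pderiv[OF d] sub])
  finally show ?case using lc by simp
qed simp

text \<open>The equation for one fixed \<open>p\<close>. The actual Van Vleck polynomial is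
  \<open>smult c V\<close>; the scalar \<open>c\<close> undoes the monic normalisation and does not
  affect the zeros.\<close>

locale heine_stieltjes =
  fixes k p :: nat and \<zeta> :: "nat \<Rightarrow> complex" and a :: "nat \<Rightarrow> real" and Q2 Q1 S V :: "complex poly" and c :: complex
  assumes k: "k \<ge> 2" and p: "p \<ge> 1"
    and a_pos: "\<And>l. l \<in> {1..p} \<Longrightarrow> a l > 0"
    and Q2: "Q2 = (\<Prod>l=1..p. [:- \<zeta> l, 1:])"
    and Q1: "\<And>z. poly Q2 z \<noteq> 0 \<Longrightarrow> poly Q1 z / poly Q2 z = (\<Sum>l=1..p. of_real (a l) / (z - \<zeta> l))"
    and S: "degree S \<ge> k - 1" "S \<noteq> 0" and V: "V \<noteq> 0" and c: "c \<noteq> 0"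
    and eq: "Q2 * (pderiv ^^ k) S + Q1 * (pderiv ^^ (k - 1)) S + smult c V * S = 0"
begin

definition W :: "complex poly" where "W = (pderiv ^^ (k - 1)) S"

text \<open>The residue at \<open>v\<close> of \<open>W' / W + Q1 / Q2\<close>. A zero of
  \<open>W\<close> may coincide with some \<open>\<zeta> l\<close>, and several
  \<open>\<zeta> l\<close> may coincide, so their contributions are pooled.\<close>

definition wt :: "complex \<Rightarrow> real" where
  "wt v = real (count (proots W) v) + (\<Sum>l | l \<in> {1..p} \<and> \<zeta> l = v. a l)"

text \<open>Up to the leading coefficient this is \<open>W * Q2\<close> times
  \<open>W' / W + Q1 / Q2\<close>. The scaling matches \<open>weighted_deriv\<close>, where the
  product of linear factors is monic.\<close>

definition R :: "complex poly" where "R = smult (1 / lead_coeff W) (Q2 * pderiv W + Q1 * W)"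

lemma W_nz: "W \<noteq> 0" unfolding W_def using S by (intro pderiv_iter)

lemma proots_Q2: "proots Q2 = image_mset \<zeta> (mset_set {1..p})"
  unfolding Q2 by (rule proots_image_linear) simp

lemma proots_R: "proots R = proots V + proots S"
proof -
  have "(pderiv ^^ k) S = pderiv W" using k by (simp add: W_def flip: funpow.simps(2)[THEN fun_cong, unfolded o_apply])
  then have "R = smult (- c / lead_coeff W) (V * S)"
    using eq unfolding R_def W_def[symmetric] by (simp add: add_eq_0_iff2)
  then show ?thesis using W_nz V S c by (simp add: proots_mult)
qed

lemma weighted_deriv_R: "weighted_deriv (proots W + proots Q2) wt R"
  unfolding weighted_deriv_def
proof (intro conjI allI impI ballI)
  show "proots W + proots Q2 \<noteq> {#}" using p by (simp add: proots_Q2 mset_set_empty_iff)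
next
  fix v assume v: "v \<in># proots W + proots Q2"
  have nn: "(\<Sum>l | l \<in> {1..p} \<and> \<zeta> l = v. a l) \<ge> 0" using a_pos by (intro sum_nonneg) (auto intro: less_imp_le)
  show "wt v > 0"
  proof (cases "v \<in># proots W")
    case True
    then have "count (proots W) v > 0" by (simp del: count_proots)
    then show ?thesis unfolding wt_def using nn by linarith
  next
    case False
    then obtain l where "l \<in> {1..p}" "\<zeta> l = v" using v by (auto simp: proots_Q2)
    then have "(\<Sum>l | l \<in> {1..p} \<and> \<zeta> l = v. a l) > 0" using a_pos by (intro sum_pos) auto
    then show ?thesis unfolding wt_def by linarith
  qed
next
  fix x assume x: "x \<notin># proots W + proots Q2"
  let ?Z = "set_mset (proots W + proots Q2)"
  have Q2x: "poly Q2 x \<noteq> 0" using x Q2 by (auto simp: proots_Q2 poly_prod prod_zero_iff)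
  have lcQ: "lead_coeff Q2 = 1" by (simp add: Q2 lead_coeff_prod)
  have xW: "x \<notin># proots W" using x by auto
  have lcW: "lead_coeff W \<noteq> 0" using W_nz by simp
  have 1: "(\<Sum>v\<in>?Z. of_nat (count (proots W) v) * (1 / (x - v))) = (\<Sum>y\<in>#proots W. 1 / (x - y))"
    by (rule sum_count_times_complex) auto
  have "(\<Sum>l=1..p. of_real (a l) / (x - \<zeta> l))
      = (\<Sum>v\<in>?Z. \<Sum>l | l \<in> {1..p} \<and> \<zeta> l = v. of_real (a l) / (x - \<zeta> l))"
    by (rule sum.group[symmetric]) (auto simp: proots_Q2)
  also have "\<dots> = (\<Sum>v\<in>?Z. of_real (\<Sum>l | l \<in> {1..p} \<and> \<zeta> l = v. a l) * (1 / (x - v)))"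
    by (intro sum.cong refl) (simp add: sum_divide_distrib)
  finally have 2: "(\<Sum>l=1..p. of_real (a l) / (x - \<zeta> l)) = \<dots>" .
  have "(\<Sum>v\<in>?Z. of_real (wt v) / (x - v))
      = (\<Sum>v\<in>?Z. of_nat (count (proots W) v) * (1 / (x - v)) + of_real (\<Sum>l | l \<in> {1..p} \<and> \<zeta> l = v. a l) * (1 / (x - v)))"
    unfolding wt_def by (intro sum.cong refl) (simp add: add_divide_distrib del: count_proots)
  also have "\<dots> = (\<Sum>y\<in>#proots W. 1 / (x - y)) + poly Q1 x / poly Q2 x"
    unfolding sum.distrib 1 2[symmetric] Q1[OF Q2x] ..
  finally have s: "(\<Sum>v\<in>?Z. of_real (wt v) / (x - v)) = \<dots>" .
  have "poly R x * lead_coeff W = poly Q2 x * poly (pderiv W) x + poly Q1 x * poly W x"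
    using lcW by (simp add: R_def)
  also have "\<dots> = lead_coeff W * (\<Prod>y\<in>#proots W. x - y) * poly Q2 x * ((\<Sum>y\<in>#proots W. 1 / (x - y)) + poly Q1 x / poly Q2 x)"
    using Q2x unfolding poly_pderiv_log[OF xW] poly_linear_factors[of W x] by (simp add: algebra_simps)
  also have "poly Q2 x = (\<Prod>y\<in>#proots Q2. x - y)" using poly_linear_factors[of Q2 x] lcQ by simp
  finally show "poly R x = (\<Prod>y\<in>#proots W + proots Q2. x - y) * (\<Sum>v\<in>?Z. of_real (wt v) / (x - v))"
    unfolding s using lcW poly_linear_factors[of Q2 x] lcQ by (simp add: mult.commute mult.left_commute mult.assoc)
qed

lemma maj_VS: "maj 1 (proots V + proots S) (proots W + proots Q2)"
  unfolding proots_R[symmetric]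
proof (rule maj_weighted_deriv[OF weighted_deriv_R])
  fix v assume v: "v \<in># proots W + proots Q2"
  have "wt u > 0" if "u \<in># proots W + proots Q2" for u
    using weighted_deriv_R that by (simp add: weighted_deriv_def)
  then have "wt v / sum wt (set_mset (proots W + proots Q2)) \<ge> 0"
    using v by (intro divide_nonneg_nonneg sum_nonneg) (auto intro: less_imp_le)
  then show "real (count (proots W + proots Q2) v) - wt v / sum wt (set_mset (proots W + proots Q2))
      \<le> 1 * real (count (proots W + proots Q2) v)" by linarith
qed

text \<open>Replacing the zeros of \<open>W\<close> by those of \<open>S\<close> on the right puts
  \<open>proots S\<close> on both sides, where it cancels. The result no longer involves the degree
  of \<open>S\<close>.\<close>

lemma maj_V_Q2: "maj 1 (proots V) (proots Q2)"
proof -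
  have "maj 1 (proots W) (proots S)" unfolding W_def by (rule maj_pderiv_iter[OF S(1)])
  from maj_trans[OF maj_VS maj_add[OF this]]
  have "maj 1 (proots V + proots S) (proots Q2 + proots S)" by (simp add: add.commute)
  then show ?thesis by (rule maj_cancel)
qed

text \<open>Write F for the sum over a multiset of the positive part of an affine function that is
  positive at an alleged zero outside \<open>K\<close> and negative on \<open>K\<close>. Then F(S)
  \<le> F(V) + F(S) \<le> F(W) + F(Q2) = F(W) \<le> (1 - 1/\<open>degree S\<close>) F(S), so F(S)
  \<le> 0, which is absurd.\<close>

lemma proots_S_subset:
  assumes K: "convex K" "closed K" and Q2K: "set_mset (proots Q2) \<subseteq> K"
  shows "set_mset (proots S) \<subseteq> K"
proof
  fix s assume s: "s \<in># proots S"
  show "s \<in> K"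
  proof (rule ccontr)
    assume "s \<notin> K"
    then obtain u b where ub: "inner u s < b" "\<And>x. x \<in> K \<Longrightarrow> inner u x > b"
      using separating_hyperplane_closed_point[OF K] by blast
    define f where "f x = max 0 (b - inner u x)" for x
    have fnn: "f x \<ge> 0" and fge: "b - inner u x \<le> f x" for x by (simp_all add: f_def)
    have f: "convex_on UNIV f"
    proof (rule convex_onI)
      fix t :: real and x y assume t: "0 < t" "t < 1"
      have "b - inner u ((1 - t) *\<^sub>R x + t *\<^sub>R y) = (1 - t) * (b - inner u x) + t * (b - inner u y)"
        by (simp add: inner_add_right algebra_simps)
      also have "\<dots> \<le> (1 - t) * f x + t * f y"
        using t fge by (intro add_mono mult_left_mono) auto
      finally have "b - inner u ((1 - t) *\<^sub>R x + t *\<^sub>R y) \<le> (1 - t) * f x + t * f y" .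
      moreover have "0 \<le> (1 - t) * f x + t * f y" using t fnn by simp
      ultimately show "f ((1 - t) *\<^sub>R x + t *\<^sub>R y) \<le> (1 - t) * f x + t * f y"
        unfolding f_def[of "(1 - t) *\<^sub>R x + t *\<^sub>R y"] by simp
    qed simp
    have nn: "(\<Sum>x\<in>#X. f x) \<ge> 0" for X by (induction X) (auto simp: fnn)
    have "(\<Sum>x\<in>#proots Q2. f x) = (\<Sum>x\<in>#proots Q2. 0)"
      using ub(2) Q2K by (intro arg_cong[where f = sum_mset] image_mset_cong) (force simp: f_def)
    then have "(\<Sum>x\<in>#proots Q2. f x) = 0" by simp
    moreover have "(\<Sum>x\<in>#proots W. f x) \<le> (1 - 1 / degree S) * (\<Sum>x\<in>#proots S. f x)"
      unfolding W_def using k S by (intro maj_sum_convex_le[OF maj_pderiv_iter_strict f]) (auto simp: fnn)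
    moreover have "(\<Sum>x\<in>#proots V + proots S. f x) \<le> 1 * (\<Sum>x\<in>#proots W + proots Q2. f x)"
      by (intro maj_sum_convex_le[OF maj_VS f]) (auto simp: fnn)
    ultimately have "1 / degree S * (\<Sum>x\<in>#proots S. f x) \<le> 0"
      using nn[of "proots V"] by (simp add: algebra_simps)
    moreover have "degree S \<ge> 1" using k S by simp
    ultimately have "(\<Sum>x\<in>#proots S. f x) \<le> 0" by (simp add: field_simps)
    moreover obtain X where "proots S = add_mset s X" using s by (metis mset_add)
    moreover have "f s > 0" using ub by (simp add: f_def)
    ultimately show False using nn[of X] by simp
  qed
qed

text \<open>At \<open>z\<close>, with products of distances to the zeros: VS is at least \<kappa>
  times W Q2, and W is at least \<open>\<kappa> ^ (k - 1)\<close> times S, one factor for each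
  derivative. The product for \<open>S\<close> is positive because its zeros lie in
  \<open>K\<close>, so it can be divided out.\<close>

lemma prod_dist_bound:
  assumes K: "convex K" "closed K" and Q2K: "set_mset (proots Q2) \<subseteq> K" and z: "z \<notin> K"
    and \<kappa>: "\<kappa> > 0"
    "\<And>Y t R. weighted_deriv Y t R \<Longrightarrow> set_mset Y \<subseteq> K \<Longrightarrow>
       \<kappa> * (\<Prod>y\<in>#Y. cmod (z - y)) \<le> (\<Prod>y\<in>#proots R. cmod (z - y))"
  shows "\<kappa> ^ k * (\<Prod>y\<in>#proots Q2. cmod (z - y)) \<le> (\<Prod>y\<in>#proots V. cmod (z - y))"
proof -
  let ?D = "\<lambda>X. \<Prod>y\<in>#X. cmod (z - y)"
  have SK: "set_mset (proots S) \<subseteq> K" by (rule proots_S_subset[OF K Q2K])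
  have pos: "?D X > 0" if "set_mset X \<subseteq> K" for X
    using that z by (induction X) (auto intro!: mult_pos_pos)
  have 1: "\<kappa> ^ (k - 1) * ?D (proots S) \<le> ?D (proots W)"
    unfolding W_def by (rule prod_dist_pderiv_iter[OF K(1) \<kappa> SK S(1)])
  have WK: "set_mset (proots W) \<subseteq> K"
    unfolding W_def by (rule maj_subset[OF maj_pderiv_iter[OF S(1)] K(1) SK])
  have "\<kappa> * (?D (proots W) * ?D (proots Q2)) \<le> ?D (proots V) * ?D (proots S)"
    using \<kappa>(2)[OF weighted_deriv_R] WK Q2K by (simp add: proots_R)
  moreover have "\<kappa> * (\<kappa> ^ (k - 1) * ?D (proots S) * ?D (proots Q2)) \<le> \<kappa> * (?D (proots W) * ?D (proots Q2))"
    using 1 \<kappa>(1) pos[OF Q2K] by (intro mult_left_mono mult_right_mono) auto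
  moreover have "\<kappa> * (\<kappa> ^ (k - 1) * ?D (proots S) * ?D (proots Q2)) = \<kappa> ^ k * ?D (proots Q2) * ?D (proots S)"
    using k by (cases k) auto
  ultimately have "\<kappa> ^ k * ?D (proots Q2) * ?D (proots S) \<le> ?D (proots V) * ?D (proots S)" by linarith
  then show ?thesis using pos[OF SK] by simp
qed

end

text \<open>The coupling gives mass \<open>M i j / size X\<close> to the pair
  \<open>(x i, y j)\<close>. Row sums make the first marginal uniform on \<open>X\<close>; the
  barycenter of each row is the martingale identity, stated through real inner products so that only
  real integrals occur. The second marginal is not uniform on \<open>Y\<close>, and the third clause
  measures the defect.\<close>

lemma maj_coupling:
  assumes maj: "maj 1 X Y" and X: "X \<noteq> {#}"
  obtains q :: "(complex \<times> complex) pmf" where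
    "set_pmf q \<subseteq> set_mset X \<times> set_mset Y"
    "\<And>f :: complex \<Rightarrow> real. (LINT z|measure_pmf q. f (fst z)) = (\<Sum>x\<in>#X. f x) / real (size X)"
    "\<And>(f :: complex \<Rightarrow> real) B. (\<And>y. y \<in># Y \<Longrightarrow> \<bar>f y\<bar> \<le> B) \<Longrightarrow>
       \<bar>(LINT z|measure_pmf q. f (snd z)) - (\<Sum>y\<in>#Y. f y) / real (size Y)\<bar> \<le> 2 * B * (real (size Y) - real (size X)) / real (size Y)"
    "\<And>(h :: complex \<Rightarrow> real) u. (LINT z|measure_pmf q. h (fst z) * inner u (snd z - fst z)) = 0"
    "\<And>C f. convex_on C f \<Longrightarrow> set_mset Y \<subseteq> C \<Longrightarrow> (LINT z|measure_pmf q. f (fst z)) \<le> (LINT z|measure_pmf q. f (snd z))"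
proof -
  obtain x y M where XY: "image_mset x (mset_set {..<size X}) = X" "image_mset y (mset_set {..<size Y}) = Y"
     "averaging {..<size X} {..<size Y} 1 x y M" using maj unfolding maj_def by blast
  define m where "m = size X"
  define n where "n = size Y"
  let ?I = "{..<m}" and ?J = "{..<n}"
  have nn: "\<And>i j. i < m \<Longrightarrow> j < n \<Longrightarrow> 0 \<le> M i j" and row: "\<And>i. i < m \<Longrightarrow> (\<Sum>j<n. M i j) = 1"
    and col: "\<And>j. j < n \<Longrightarrow> (\<Sum>i<m. M i j) \<le> 1"
    and val: "\<And>i. i < m \<Longrightarrow> x i = (\<Sum>j<n. of_real (M i j) * y j)"
    using XY(3) unfolding averaging_def m_def n_def by auto
  have m: "m > 0" unfolding m_def using X by (simp add: nonempty_has_size)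
  have xX: "x i \<in># X" if "i < m" for i using that unfolding m_def by (subst XY(1)[symmetric]) auto
  have yY: "y j \<in># Y" if "j < n" for j using that unfolding n_def by (subst XY(2)[symmetric]) auto
  have sX: "(\<Sum>x\<in>#X. f x) = (\<Sum>i<m. f (x i))" for f :: "complex \<Rightarrow> real"
    unfolding m_def by (subst (1) XY(1)[symmetric]) (simp add: multiset.map_comp o_def sum_unfold_sum_mset)
  have sY: "(\<Sum>x\<in>#Y. f x) = (\<Sum>i<n. f (y i))" for f :: "complex \<Rightarrow> real"
    unfolding n_def by (subst (1) XY(2)[symmetric]) (simp add: multiset.map_comp o_def sum_unfold_sum_mset)
  define w where "w = (\<lambda>(i, j). if i < m \<and> j < n then M i j / real m else 0)"
  have w0: "w ij \<ge> 0" for ij using nn by (auto simp: w_def split: prod.splits)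
  have "(\<Sum>ij\<in>?I \<times> ?J. w ij) = (\<Sum>i<m. \<Sum>j<n. w (i, j))"
    by (subst sum.cartesian_product) simp
  also have "\<dots> = (\<Sum>i<m. (\<Sum>j<n. M i j) / real m)"
    unfolding sum_divide_distrib by (intro sum.cong refl) (auto simp: w_def)
  also have "\<dots> = 1" using row m by simp
  finally have w1: "(\<Sum>ij\<in>?I \<times> ?J. w ij) = 1" .
  have "(\<integral>\<^sup>+ ij. ennreal (w ij) \<partial>count_space UNIV) = (\<Sum>ij\<in>?I \<times> ?J. ennreal (w ij))"
    by (intro nn_integral_count_space') (auto simp: w_def split: if_splits)
  also have "\<dots> = 1" using w1 w0 by (simp add: sum_ennreal)
  finally have pw: "pmf (embed_pmf w) ij = w ij" for ij using w0 by (intro pmf_embed_pmf) auto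
  define q where "q = map_pmf (\<lambda>(i, j). (x i, y j)) (embed_pmf w)"
  have set_w: "set_pmf (embed_pmf w) \<subseteq> ?I \<times> ?J" by (auto simp: set_pmf_iff pw) (auto simp: w_def split: if_splits)
  have E: "(LINT z|measure_pmf q. G z) = (\<Sum>i<m. \<Sum>j<n. M i j * G (x i, y j)) / real m" for G :: "complex \<times> complex \<Rightarrow> real"
  proof -
    have "(LINT z|measure_pmf q. G z) = (LINT ij|measure_pmf (embed_pmf w). G (x (fst ij), y (snd ij)))"
      unfolding q_def by (simp add: case_prod_beta)
    also have "\<dots> = (\<Sum>ij\<in>?I \<times> ?J. G (x (fst ij), y (snd ij)) * w ij)"
      using set_w by (subst integral_measure_pmf_real[of "?I \<times> ?J"]) (auto simp: pw)
    also have "\<dots> = (\<Sum>i<m. \<Sum>j<n. G (x i, y j) * w (i, j))"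
      by (subst sum.cartesian_product) (simp add: case_prod_beta)
    also have "\<dots> = (\<Sum>i<m. \<Sum>j<n. M i j * G (x i, y j) / real m)"
      by (intro sum.cong refl) (auto simp: w_def)
    finally show ?thesis by (simp add: sum_divide_distrib)
  qed
  have Ex: "(LINT z|measure_pmf q. f (fst z)) = (\<Sum>i<m. f (x i)) / real m" for f :: "complex \<Rightarrow> real"
    unfolding E using row by (simp flip: sum_distrib_right)
  define C where "C j = (\<Sum>i<m. M i j)" for j
  have C: "0 \<le> C j" "C j \<le> 1" if "j < n" for j using nn col that by (auto simp: C_def intro!: sum_nonneg)
  have sC: "(\<Sum>j<n. C j) = m" unfolding C_def by (subst sum.swap) (simp add: row)
  have Ey: "(LINT z|measure_pmf q. f (snd z)) = (\<Sum>j<n. C j * f (y j)) / real m" for f :: "complex \<Rightarrow> real"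
    unfolding E C_def by (subst sum.swap) (simp add: sum_distrib_right)
  show ?thesis
  proof (rule that)
    show "set_pmf q \<subseteq> set_mset X \<times> set_mset Y" unfolding q_def using set_w xX yY by auto
  next
    fix f :: "complex \<Rightarrow> real"
    show "(LINT z|measure_pmf q. f (fst z)) = (\<Sum>x\<in>#X. f x) / real (size X)" unfolding Ex sX m_def ..
  next
    fix f :: "complex \<Rightarrow> real" and B
    assume "\<And>y. y \<in># Y \<Longrightarrow> \<bar>f y\<bar> \<le> B"
    then have B: "\<bar>f (y j)\<bar> \<le> B" if "j < n" for j using yY that by blast
    \<comment> \<open>The sum over \<open>Y\<close> splits into the part \<open>SC\<close> carried
      by the column sums and the missing part \<open>D\<close>. Their weights add up to
      \<open>m\<close> and \<open>n - m\<close>, hence the bounds \<open>m B\<close> and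
      \<open>(n - m) B\<close>. Renormalising \<open>SC\<close> from \<open>n\<close> to
      \<open>m\<close> costs a further \<open>(n - m) B\<close>, which accounts for the factor
      2.\<close>
    define SC where "SC = (\<Sum>j<n. C j * f (y j))"
    define D where "D = (\<Sum>j<n. (1 - C j) * f (y j))"
    have "real m \<le> (\<Sum>j<n. 1)" unfolding sC[symmetric] using C by (intro sum_mono) auto
    then have mn: "m \<le> n" by simp
    have "\<bar>SC\<bar> \<le> (\<Sum>j<n. \<bar>C j * f (y j)\<bar>)" unfolding SC_def by (rule sum_abs)
    also have "\<dots> \<le> (\<Sum>j<n. C j * B)" using C B by (intro sum_mono) (simp add: abs_mult mult_left_mono)
    also have "\<dots> = real m * B" by (simp add: sC flip: sum_distrib_right)
    finally have SC: "\<bar>SC\<bar> \<le> real m * B" .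
    have "\<bar>D\<bar> \<le> (\<Sum>j<n. \<bar>(1 - C j) * f (y j)\<bar>)" unfolding D_def by (rule sum_abs)
    also have "\<dots> \<le> (\<Sum>j<n. (1 - C j) * B)" using C B by (intro sum_mono) (simp add: abs_mult mult_left_mono)
    also have "\<dots> = real (n - m) * B" using mn by (simp add: sC sum_subtractf of_nat_diff flip: sum_distrib_right)
    finally have D: "\<bar>D\<bar> \<le> real (n - m) * B" .
    have n0: "real n > 0" "real m > 0" using m mn by auto
    have "(\<Sum>j<n. f (y j)) = SC + D" unfolding SC_def D_def by (simp flip: sum.distrib add: algebra_simps)
    then have "SC / real m - (\<Sum>j<n. f (y j)) / real n = (SC * ((real n - real m) / real m) - D) / real n"
      using n0 by (simp add: field_simps)
    also have "\<bar>\<dots>\<bar> \<le> (\<bar>SC\<bar> * ((real n - real m) / real m) + \<bar>D\<bar>) / real n"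
    proof -
      have "\<bar>SC * ((real n - real m) / real m) - D\<bar> \<le> \<bar>SC * ((real n - real m) / real m)\<bar> + \<bar>D\<bar>" by (rule abs_triangle_ineq4)
      also have "\<bar>SC * ((real n - real m) / real m)\<bar> = \<bar>SC\<bar> * ((real n - real m) / real m)" using mn by (simp add: abs_mult)
      finally show ?thesis using n0 by (simp add: divide_right_mono)
    qed
    also have "\<dots> \<le> ((real m * B) * ((real n - real m) / real m) + real (n - m) * B) / real n"
      using SC D mn n0 by (intro divide_right_mono add_mono mult_right_mono) auto
    also have "\<dots> = 2 * B * (real n - real m) / real n" 
    proof -
      have "(real m * B) * ((real n - real m) / real m) = B * (real n - real m)" using n0 by simp
      then show ?thesis using mn by (simp only: of_nat_diff) (simp add: algebra_simps)
    qed
    finally show "\<bar>(LINT z|measure_pmf q. f (snd z)) - (\<Sum>y\<in>#Y. f y) / real (size Y)\<bar> \<le> 2 * B * (real (size Y) - real (size X)) / real (size Y)"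
      unfolding Ey sY SC_def by (simp add: m_def n_def)
  next
    fix h :: "complex \<Rightarrow> real" and u
    have "(\<Sum>j<n. M i j * (h (x i) * inner u (y j - x i))) = 0" if i: "i < m" for i
    proof -
      have "(\<Sum>j<n. M i j * (h (x i) * inner u (y j - x i)))
          = h (x i) * (inner u (\<Sum>j<n. M i j *\<^sub>R y j) - (\<Sum>j<n. M i j) * inner u (x i))"
        by (simp add: inner_diff_right inner_sum_right sum_distrib_left sum_distrib_right sum_subtractf algebra_simps)
      also have "(\<Sum>j<n. M i j *\<^sub>R y j) = x i" using val[OF i] by (simp add: scaleR_conv_of_real)
      finally show ?thesis using row[OF i] by simp
    qed
    then show "(LINT z|measure_pmf q. h (fst z) * inner u (snd z - fst z)) = 0" unfolding E by simp
  next
    fix S f assume f: "convex_on S f" "set_mset Y \<subseteq> S"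
    have "f (x i) \<le> (\<Sum>j<n. M i j * f (y j))" if i: "i < m" for i
    proof -
      have ne: "?J \<noteq> {}" using row[OF i] by force
      have "x i = (\<Sum>j<n. M i j *\<^sub>R y j)" using val[OF i] by (simp add: scaleR_conv_of_real)
      then show ?thesis
        using convex_on_sum[OF _ ne f(1) row[OF i], of y] nn i yY f(2) by auto
    qed
    then have "(\<Sum>i<m. f (x i)) \<le> (\<Sum>i<m. \<Sum>j<n. M i j * f (y j))" by (intro sum_mono) auto
    then show "(LINT z|measure_pmf q. f (fst z)) \<le> (LINT z|measure_pmf q. f (snd z))"
      unfolding Ex E snd_conv by (intro divide_right_mono) auto
  qed
qed

section \<open>A space-filling curve\<close>

text \<open>A continuous function of period 2 that is 0 on [0, 1/3] and 1 on [2/3, 1]. On a ternary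
  expansion with digits 0 and 2 it reads off the leading fractional digit, as in Schoenberg's
  space-filling curve.\<close>

definition schoenberg_step :: "real \<Rightarrow> real" where
  "schoenberg_step t = max 0 (min 1 (1 / 2 - cos (pi * t)))"

lemma schoenberg_step_bounds: "0 \<le> schoenberg_step t" "schoenberg_step t \<le> 1"
  by (auto simp: schoenberg_step_def)

lemma continuous_on_schoenberg_step [continuous_intros]:
  fixes f :: "real \<Rightarrow> real"
  shows "continuous_on A f \<Longrightarrow> continuous_on A (\<lambda>x. schoenberg_step (f x))"
  unfolding schoenberg_step_def by (intro continuous_intros)

text \<open>The form of the argument is that of \<open>3 ^ n * t\<close> when all ternary digits of
  \<open>t\<close> are 0 or 2: the integer part is even, \<open>b\<close> encodes the next digit,
  and the later digits add at most 1/3.\<close>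

lemma schoenberg_step_digit:
  assumes "0 \<le> s" "s \<le> 1 / 3"
  shows "schoenberg_step (2 * of_nat m + 2 * of_bool b / 3 + s) = of_bool b"
proof -
  have per: "cos (pi * (2 * of_nat m + u)) = cos (pi * u)" for u
  proof (induction m)
    case (Suc m)
    have "pi * (2 * of_nat (Suc m) + u) = pi * (2 * of_nat m + u) + 2 * pi" by (simp add: algebra_simps)
    then show ?case unfolding Suc.IH[symmetric] by (simp only: cos_periodic)
  qed simp
  have s: "0 \<le> pi * s" "pi * s \<le> pi / 3" using assms by (auto simp: field_simps)
  have c: "cos (pi * s) \<ge> 1 / 2"
    using cos_monotone_0_pi_le[OF s] by (simp add: cos_60)
  show ?thesis
  proof (cases b)
    case True
    have "cos (pi * (2 / 3 + s)) = - cos (pi / 3 - pi * s)"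
      using cos_minus_pi[of "pi / 3 - pi * s"] by (subst cos_minus[symmetric]) (simp add: algebra_simps)
    moreover have "cos (pi / 3 - pi * s) \<ge> 1 / 2"
      using cos_monotone_0_pi_le[of "pi / 3 - pi * s" "pi / 3"] s by (simp add: cos_60)
    ultimately show ?thesis using per[of "2 / 3 + s"] True by (simp add: schoenberg_step_def add.assoc)
  next
    case False
    then show ?thesis using per[of s] c by (simp add: schoenberg_step_def)
  qed
qed

lemma binary_expansion:
  fixes u :: real
  assumes "0 \<le> u" "u \<le> 1"
  shows "\<exists>b :: nat \<Rightarrow> bool. (\<lambda>n. of_bool (b n) / 2 ^ Suc n) sums u"
proof -
  \<comment> \<open>The remainder under repeated doubling, with digit 1 exactly when it is at least
    1/2. The endpoint 1 is a fixed point and gets the expansion with all digits 1.\<close>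
  define r where "r = rec_nat u (\<lambda>_ v. 2 * v - of_bool (v \<ge> 1 / 2))"
  have r0: "r 0 = u" and rS: "r (Suc n) = 2 * r n - of_bool (r n \<ge> 1 / 2)" for n by (simp_all add: r_def)
  have bd: "0 \<le> r n \<and> r n \<le> 1" for n
    by (induction n) (use assms in \<open>auto simp: r0 rS of_bool_def\<close>)
  define b where "b n \<longleftrightarrow> r n \<ge> 1 / 2" for n
  have *: "(\<Sum>m<n. of_bool (b m) / 2 ^ Suc m) = u - r n / 2 ^ n" for n
    by (induction n) (auto simp: r0 rS b_def field_simps)
  have "(\<lambda>n. r n / 2 ^ n) \<longlonglongrightarrow> 0"
  proof (rule tendsto_sandwich[where f = "\<lambda>_. 0" and h = "\<lambda>n. (1 / 2) ^ n"])
    show "\<forall>\<^sub>F n in sequentially. r n / 2 ^ n \<le> (1 / 2) ^ n"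
      using bd by (auto simp: power_one_over divide_right_mono intro!: always_eventually)
  qed (use bd in \<open>auto intro!: always_eventually LIMSEQ_realpow_zero\<close>)
  then have "(\<lambda>n. \<Sum>m<n. of_bool (b m) / 2 ^ Suc m) \<longlonglongrightarrow> u - 0"
    unfolding * by (intro tendsto_intros)
  then show ?thesis unfolding sums_def by auto
qed

text \<open>The \<open>j\<close>-th coordinate uses the ternary digits at the positions congruent to
  \<open>j\<close> modulo 4. Four interleaved coordinates are needed because
  \<open>K \<times> K\<close> has four real dimensions.\<close>

definition schoenberg_coord :: "nat \<Rightarrow> real \<Rightarrow> real" where
  "schoenberg_coord j t = (\<Sum>n. schoenberg_step (3 ^ (4 * n + j) * t) / 2 ^ Suc n)"

lemma summable_half_powers: "summable (\<lambda>n. 1 / 2 ^ Suc n :: real)"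
  using sums_summable[OF power_half_series] by (simp add: power_one_over)

lemma schoenberg_coord_bounds: "0 \<le> schoenberg_coord j t" "schoenberg_coord j t \<le> 1"
proof -
  have s: "summable (\<lambda>n. schoenberg_step (3 ^ (4 * n + j) * t) / 2 ^ Suc n)"
    by (rule summable_comparison_test'[OF summable_half_powers])
       (auto simp: schoenberg_step_bounds divide_right_mono)
  show "0 \<le> schoenberg_coord j t" unfolding schoenberg_coord_def
    using s by (intro suminf_nonneg) (auto simp: schoenberg_step_bounds)
  have "schoenberg_coord j t \<le> (\<Sum>n. 1 / 2 ^ Suc n)" unfolding schoenberg_coord_def
    using s by (intro suminf_le summable_half_powers divide_right_mono) (auto simp: schoenberg_step_bounds)
  also have "\<dots> = 1" using sums_unique[OF power_half_series] by (simp add: power_one_over)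
  finally show "schoenberg_coord j t \<le> 1" .
qed

lemma continuous_on_schoenberg_coord: "continuous_on UNIV (schoenberg_coord j)"
proof -
  have "uniform_limit UNIV (\<lambda>n t. \<Sum>i<n. schoenberg_step (3 ^ (4 * i + j) * t) / 2 ^ Suc i)
      (\<lambda>t. \<Sum>i. schoenberg_step (3 ^ (4 * i + j) * t) / 2 ^ Suc i) sequentially"
    by (rule Weierstrass_m_test[OF _ summable_half_powers])
       (auto simp: schoenberg_step_bounds divide_right_mono)
  then show ?thesis unfolding schoenberg_coord_def[abs_def]
    by (rule uniform_limit_theorem[rotated]) (auto intro!: always_eventually continuous_intros)
qed

lemma schoenberg_surj:
  assumes "\<And>j. 0 \<le> u j" "\<And>j :: nat. u j \<le> (1 :: real)"
  shows "\<exists>t\<in>{0..1}. \<forall>j<4. schoenberg_coord j t = u j"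
proof -
  obtain b :: "nat \<Rightarrow> nat \<Rightarrow> bool" where b: "\<And>j. (\<lambda>n. of_bool (b j n) / 2 ^ Suc n) sums u j"
    using binary_expansion[OF assms] by metis
  \<comment> \<open>The binary digits of the four prescribed coordinates are interleaved and become
    the ternary digits 0 or 2 of \<open>t\<close>.\<close>
  define a where "a m = b (m mod 4) (m div 4)" for m
  define d where "d m = 2 * of_bool (a m) / (3 :: real) ^ Suc m" for m
  have geo: "(\<lambda>m. 2 / (3 :: real) ^ Suc m) sums 1"
    using sums_mult[OF geometric_sums[of "1 / 3 :: real"], of "2 / 3"] by (simp add: power_one_over)
  have dle: "0 \<le> d m" "d m \<le> 2 / 3 ^ Suc m" for m by (auto simp: d_def divide_right_mono)
  have d: "summable d"
    by (rule summable_comparison_test'[OF sums_summable[OF geo]]) (use dle in auto)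
  define t where "t = (\<Sum>m. d m)"
  have t: "0 \<le> t" "t \<le> 1"
    unfolding t_def using suminf_nonneg[OF d] suminf_le[OF _ d sums_summable[OF geo]] dle sums_unique[OF geo] by auto
  have "schoenberg_step (3 ^ n * t) = of_bool (a n)" for n
  proof -
    define s where "s = (\<Sum>i. 3 ^ n * d (i + Suc n))"
    have sd: "summable (\<lambda>i. d (i + Suc n))" using d by (rule summable_ignore_initial_segment)
    have "t = (\<Sum>i. d (i + Suc n)) + (\<Sum>i<Suc n. d i)"
      unfolding t_def by (rule suminf_split_initial_segment[OF d])
    moreover have "s = 3 ^ n * (\<Sum>i. d (i + Suc n))" unfolding s_def by (rule suminf_mult[OF sd])
    ultimately have "3 ^ n * t = s + 3 ^ n * (\<Sum>i<Suc n. d i)" by (simp only: distrib_left)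
    also have "3 ^ n * (\<Sum>i<Suc n. d i) = (\<Sum>i<n. 3 ^ n * d i) + 2 * of_bool (a n) / 3"
      by (simp add: d_def distrib_left sum_distrib_left)
    also have "(\<Sum>i<n. 3 ^ n * d i) = (\<Sum>i<n. 2 * of_nat (of_bool (a i) * 3 ^ (n - Suc i)))"
    proof (intro sum.cong refl)
      fix i assume "i \<in> {..<n}"
      then have "(3 :: real) ^ n = 3 ^ Suc i * 3 ^ (n - Suc i)" by (subst power_add[symmetric]) simp
      then show "3 ^ n * d i = 2 * of_nat (of_bool (a i) * 3 ^ (n - Suc i))" by (simp add: d_def)
    qed
    also have "\<dots> = 2 * of_nat (\<Sum>i<n. of_bool (a i) * 3 ^ (n - Suc i))" by (simp only: of_nat_sum sum_distrib_left)
    finally have eq: "3 ^ n * t = 2 * of_nat (\<Sum>i<n. of_bool (a i) * 3 ^ (n - Suc i)) + 2 * of_bool (a n) / 3 + s"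
      by simp
    have dterm: "0 \<le> 3 ^ n * d (i + Suc n)" "3 ^ n * d (i + Suc n) \<le> 2 / 3 ^ Suc i * (1 / 3)" for i
    proof -
      have "3 ^ n * d (i + Suc n) \<le> 3 ^ n * (2 / 3 ^ Suc (i + Suc n))"
        by (rule mult_left_mono[OF dle(2)]) simp
      also have "\<dots> = 2 / 3 ^ Suc i * (1 / 3)" by (simp add: power_add)
      finally show "3 ^ n * d (i + Suc n) \<le> 2 / 3 ^ Suc i * (1 / 3)" .
    qed (use dle in auto)
    have g3: "(\<lambda>i. 2 / 3 ^ Suc i * (1 / 3)) sums (1 * (1 / 3) :: real)" by (rule sums_mult2[OF geo])
    have "0 \<le> s" unfolding s_def using dterm sd by (intro suminf_nonneg summable_mult) auto
    moreover have "s \<le> 1 / 3"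
      unfolding s_def using suminf_le[OF dterm(2) summable_mult[OF sd] sums_summable[OF g3]] sums_unique[OF g3] by simp
    ultimately show ?thesis unfolding eq by (rule schoenberg_step_digit)
  qed
  then have "schoenberg_coord j t = u j" if "j < 4" for j
    using b[of j] that unfolding schoenberg_coord_def by (simp add: a_def sums_iff)
  then show ?thesis using t by (intro bexI[of _ t]) auto
qed

lemma space_filling_pair:
  fixes K :: "complex set"
  assumes "bounded K"
  obtains \<phi> \<psi> :: "real \<Rightarrow> complex" where "continuous_on UNIV \<phi>" "continuous_on UNIV \<psi>"
    "bounded (range \<phi>)" "bounded (range \<psi>)"
    "\<And>x y. x \<in> K \<Longrightarrow> y \<in> K \<Longrightarrow> \<exists>t\<in>{0..1}. \<phi> t = x \<and> \<psi> t = y"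
proof -
  obtain B0 where B0: "\<And>x. x \<in> K \<Longrightarrow> cmod x \<le> B0" using assms by (auto simp: bounded_iff)
  define B where "B = \<bar>B0\<bar> + 1"
  have B: "B > 0" by (simp add: B_def)
  have BK: "\<bar>Re x\<bar> \<le> B" "\<bar>Im x\<bar> \<le> B" if "x \<in> K" for x
    using B0[OF that] abs_Re_le_cmod[of x] abs_Im_le_cmod[of x] by (auto simp: B_def)
  define sc where "sc j t = 2 * B * schoenberg_coord j t - B" for j t
  have c: "continuous_on UNIV (sc j)" for j
    unfolding sc_def by (intro continuous_intros continuous_on_schoenberg_coord)
  have bd: "\<bar>sc j t\<bar> \<le> B" for j t
  proof -
    have "2 * B * schoenberg_coord j t \<le> 2 * B * 1" "0 \<le> 2 * B * schoenberg_coord j t"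
      using B schoenberg_coord_bounds[of j t] by (auto intro!: mult_left_mono)
    then show ?thesis unfolding sc_def by (simp add: abs_le_iff)
  qed
  define \<phi> where "\<phi> t = Complex (sc 0 t) (sc 1 t)" for t
  define \<psi> where "\<psi> t = Complex (sc 2 t) (sc 3 t)" for t
  have "norm (Complex u v) \<le> 2 * B" if "\<bar>u\<bar> \<le> B" "\<bar>v\<bar> \<le> B" for u v
    using cmod_le[of "Complex u v"] that by simp
  then have "bounded (range \<phi>)" "bounded (range \<psi>)"
    unfolding bounded_iff using bd by (auto simp: \<phi>_def \<psi>_def intro!: exI[of _ "2 * B"])
  moreover have "continuous_on UNIV \<phi>" "continuous_on UNIV \<psi>"
    unfolding \<phi>_def \<psi>_def using c by (auto intro!: continuous_on_Complex)
  moreover have "\<exists>t\<in>{0..1}. \<phi> t = x \<and> \<psi> t = y" if xy: "x \<in> K" "y \<in> K" for x y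
  proof -
    \<comment> \<open>Reduction modulo 4 keeps \<open>v j\<close> bounded for every
      \<open>j\<close>, since \<open>schoenberg_surj\<close> expects a whole sequence of values in
      the unit interval.\<close>
    define v where "v j = [Re x, Im x, Re y, Im y] ! (j mod 4)" for j :: nat
    have v: "\<bar>v j\<bar> \<le> B" for j
    proof -
      have "v j \<in> set [Re x, Im x, Re y, Im y]" unfolding v_def by (intro nth_mem) simp
      then show ?thesis using BK xy by auto
    qed
    then have "0 \<le> (v j + B) / (2 * B) \<and> (v j + B) / (2 * B) \<le> 1" for j
    proof -
      have "0 \<le> v j + B" "v j + B \<le> 2 * B" using v[of j] by linarith+
      then show ?thesis using B by simp
    qed
    then obtain t where t: "t \<in> {0..1}" "\<And>j. j < 4 \<Longrightarrow> schoenberg_coord j t = (v j + B) / (2 * B)"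
      using schoenberg_surj[of "\<lambda>j. (v j + B) / (2 * B)"] by auto
    have "sc j t = v j" if "j < 4" for j using t(2)[OF that] B by (simp add: sc_def)
    then have "\<phi> t = x" "\<psi> t = y" unfolding \<phi>_def \<psi>_def by (auto simp: v_def complex_eq_iff)
    then show ?thesis using t by blast
  qed
  ultimately show ?thesis using that by blast
qed

section \<open>Conditional distributions and dilations\<close>

text \<open>The set where \<open>g < f\<close> is the critical test set. Finiteness of the integral
  of \<open>g\<close> makes the comparison of integrals on it strict.\<close>

lemma AE_le_if_set_nn_integral_le:
  fixes f g :: "'a \<Rightarrow> ennreal"
  assumes [measurable]: "f \<in> borel_measurable M" "g \<in> borel_measurable M"
    and le: "\<And>A. A \<in> sets M \<Longrightarrow> (\<integral>\<^sup>+x\<in>A. f x \<partial>M) \<le> (\<integral>\<^sup>+x\<in>A. g x \<partial>M)"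
    and fin: "(\<integral>\<^sup>+x. g x \<partial>M) \<noteq> \<infinity>"
  shows "AE x in M. f x \<le> g x"
proof -
  define A where "A = {x \<in> space M. g x < f x}"
  have [measurable]: "A \<in> sets M" unfolding A_def by measurable
  have "AE x in M. f x * indicator A x \<le> g x * indicator A x"
  proof (rule ccontr)
    assume "\<not> ?thesis"
    then have "(\<integral>\<^sup>+x. g x * indicator A x \<partial>M) < (\<integral>\<^sup>+x. f x * indicator A x \<partial>M)"
    proof (intro nn_integral_less)
      have "(\<integral>\<^sup>+x. g x * indicator A x \<partial>M) \<le> (\<integral>\<^sup>+x. g x \<partial>M)"
        by (intro nn_integral_mono) (auto split: split_indicator)
      then show "(\<integral>\<^sup>+x. g x * indicator A x \<partial>M) \<noteq> \<infinity>" using fin by (auto simp: top_unique)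
      show "AE x in M. g x * indicator A x \<le> f x * indicator A x"
        by (auto simp: A_def split: split_indicator)
    qed auto
    with le[of A] show False by (simp add: not_le)
  qed
  moreover have "AE x in M. x \<in> space M" by simp
  ultimately show ?thesis
  proof eventually_elim
    case (elim x)
    then show ?case by (cases "g x < f x") (auto simp: A_def indicator_def split: if_splits)
  qed
qed

text \<open>The conditional distribution functions at real points are Radon-Nikodym derivatives, which at
  rational points are monotone with the right limits outside a null set; the right-continuous version
  is then the conditional measure.\<close>

theorem real_regular_conditional_distribution:
  fixes P :: "real measure"
  assumes P: "real_distribution P" and X: "X \<in> P \<rightarrow>\<^sub>M N"
  shows "\<exists>\<kappa>. \<kappa> \<in> N \<rightarrow>\<^sub>M prob_algebra borel \<and>
    (\<forall>A\<in>sets N. density P (indicator (X -` A)) = density (distr P N X) (indicator A) \<bind> \<kappa>)"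
proof -
  interpret P: real_distribution P by fact
  note [measurable] = X
  have spP [simp]: "space P = UNIV" using P.events_eq_borel sets_eq_imp_space_eq[of P borel] by simp
  have XN: "X w \<in> space N" for w using measurable_space[OF X] by simp
  have XA [measurable]: "X -` A \<in> sets borel" if "A \<in> sets N" for A
    using measurable_sets[OF X that] by simp
  define \<mu> where "\<mu> = distr P N X"
  interpret \<mu>: prob_space \<mu> unfolding \<mu>_def by (rule P.prob_space_distr) simp
  have sets_\<mu> [measurable_cong, simp]: "sets \<mu> = sets N" and space_\<mu> [simp]: "space \<mu> = space N"
    by (simp_all add: \<mu>_def)
  \<comment> \<open>The law of \<open>X\<close> restricted to the event that the sample point is at
    most \<open>r\<close>. Its density \<open>h r\<close> is thus the conditional probability of
    this event given \<open>X\<close>.\<close>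
  define \<nu> where "\<nu> r = distr (density P (indicator {..r})) N X" for r
  have sets_\<nu> [simp]: "sets (\<nu> r) = sets N" for r by (simp add: \<nu>_def)
  have \<nu>: "emeasure (\<nu> r) A = emeasure P (X -` A \<inter> {..r})" if "A \<in> sets N" for r A
    using that unfolding \<nu>_def
    by (subst emeasure_distr) (auto simp: emeasure_density nn_integral_indicator Int_commute
        simp flip: indicator_inter_arith)
  have \<mu>A: "emeasure \<mu> A = emeasure P (X -` A)" if "A \<in> sets N" for A
    using that unfolding \<mu>_def by (subst emeasure_distr) auto
  have ac: "absolutely_continuous \<mu> (\<nu> r)" for r
    unfolding absolutely_continuous_def
  proof
    fix A assume A: "A \<in> null_sets \<mu>"
    then have AN: "A \<in> sets N" by (auto dest: null_setsD2)
    then have "emeasure P (X -` A) = 0" using A \<mu>A[of A] by (simp add: null_setsD1)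
    moreover note AN
    moreover from this have "emeasure P (X -` A \<inter> {..r}) \<le> emeasure P (X -` A)"
      by (intro emeasure_mono) auto
    ultimately show "A \<in> null_sets (\<nu> r)" using \<nu> by (auto simp: null_sets_def)
  qed
  define h where "h r = RN_deriv \<mu> (\<nu> r)" for r
  have [measurable]: "h r \<in> borel_measurable N" for r
    using borel_measurable_RN_deriv[of \<mu> "\<nu> r"] unfolding h_def by (simp cong: measurable_cong_sets)
  have h: "(\<integral>\<^sup>+x\<in>A. h r x \<partial>\<mu>) = emeasure P (X -` A \<inter> {..r})" if A: "A \<in> sets N" for A r
  proof -
    have "emeasure (density \<mu> (h r)) A = emeasure (\<nu> r) A"
      unfolding h_def using \<mu>.density_RN_deriv[OF ac] by simp
    then show ?thesis using \<nu>[OF A] A by (simp add: emeasure_density)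
  qed
  have le_fin: "(\<integral>\<^sup>+x. h r x \<partial>\<mu>) \<le> 1" for r
  proof -
    have "(\<integral>\<^sup>+x. h r x \<partial>\<mu>) = (\<integral>\<^sup>+x\<in>space N. h r x \<partial>\<mu>)" by (intro nn_integral_cong) auto
    also have "\<dots> \<le> 1" unfolding h[OF sets.top] using P.emeasure_le_1 by simp
    finally show ?thesis .
  qed
  have AE_mono: "AE x in \<mu>. h r x \<le> h s x" if "r \<le> s" for r s
  proof (rule AE_le_if_set_nn_integral_le)
    fix A assume "A \<in> sets \<mu>" then show "(\<integral>\<^sup>+x\<in>A. h r x \<partial>\<mu>) \<le> (\<integral>\<^sup>+x\<in>A. h s x \<partial>\<mu>)"
      using that by (auto simp: h intro!: emeasure_mono)
  next
    show "(\<integral>\<^sup>+x. h s x \<partial>\<mu>) \<noteq> \<infinity>" using le_fin[of s] by (auto simp: top_unique)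
  qed (auto cong: measurable_cong_sets)
  have AE_mono_rat: "AE x in \<mu>. \<forall>q s :: rat. q \<le> s \<longrightarrow> h (of_rat q) x \<le> h (of_rat s) x"
    unfolding AE_all_countable using AE_mono by (auto simp: of_rat_less_eq)
  have AE_top: "AE x in \<mu>. (SUP n. h (real n) x) = 1"
  proof -
    have inc: "AE x in \<mu>. \<forall>i. h (real i) x \<le> h (real (Suc i)) x"
      unfolding AE_all_countable using AE_mono by auto
    have "(\<integral>\<^sup>+x\<in>A. (SUP n. h (real n) x) \<partial>\<mu>) = (\<integral>\<^sup>+x\<in>A. 1 \<partial>\<mu>)" if A: "A \<in> sets \<mu>" for A
    proof -
      have "(\<integral>\<^sup>+x\<in>A. (SUP n. h (real n) x) \<partial>\<mu>) = (\<integral>\<^sup>+x. (SUP n. h (real n) x * indicator A x) \<partial>\<mu>)"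
        by (simp add: SUP_mult_right_ennreal)
      also have "\<dots> = (SUP n. \<integral>\<^sup>+x\<in>A. h (real n) x \<partial>\<mu>)"
        using A by (intro nn_integral_monotone_convergence_SUP_AE)
          (use inc in \<open>auto elim!: eventually_mono intro: mult_right_mono cong: measurable_cong_sets\<close>)
      also have "\<dots> = (SUP n. emeasure P (X -` A \<inter> {..real n}))" using A by (simp add: h)
      also have "\<dots> = emeasure P (\<Union>n. X -` A \<inter> {..real n})"
        using A by (intro SUP_emeasure_incseq) (auto simp: incseq_def)
      also have "(\<Union>n. X -` A \<inter> {..real n}) = X -` A" using real_arch_simple by auto
      also have "emeasure P (X -` A) = (\<integral>\<^sup>+x\<in>A. 1 \<partial>\<mu>)" using A \<mu>A by simp
      finally show ?thesis .
    qed
    then have eq: "(\<integral>\<^sup>+x\<in>A. (SUP n. h (real n) x) \<partial>\<mu>) = (\<integral>\<^sup>+x\<in>A. 1 \<partial>\<mu>)" if "A \<in> sets \<mu>" for A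
      using that .
    have "(\<integral>\<^sup>+x. (SUP n. h (real n) x) \<partial>\<mu>) = (\<integral>\<^sup>+x\<in>space \<mu>. (SUP n. h (real n) x) \<partial>\<mu>)"
      by (intro nn_integral_cong) auto
    also have "\<dots> = 1" using eq[OF sets.top] \<mu>.emeasure_space_1 by simp
    finally have fin: "(\<integral>\<^sup>+x. (SUP n. h (real n) x) \<partial>\<mu>) \<noteq> \<infinity>" by simp
    have "AE x in \<mu>. (SUP n. h (real n) x) \<le> 1"
      by (rule AE_le_if_set_nn_integral_le) (auto simp: eq \<mu>.emeasure_space_1 cong: measurable_cong_sets)
    moreover have "AE x in \<mu>. 1 \<le> (SUP n. h (real n) x)"
      by (rule AE_le_if_set_nn_integral_le[OF _ _ _ fin]) (auto simp: eq cong: measurable_cong_sets)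
    ultimately show ?thesis by eventually_elim simp
  qed
  have AE_bot: "AE x in \<mu>. (INF n. h (- real n) x) = 0"
  proof -
    have "(\<integral>\<^sup>+x. (INF n. h (- real n) x) \<partial>\<mu>) \<le> emeasure P {.. - real n}" for n
    proof -
      have "(\<integral>\<^sup>+x. (INF n. h (- real n) x) \<partial>\<mu>) \<le> (\<integral>\<^sup>+x\<in>space N. h (- real n) x \<partial>\<mu>)"
        by (intro nn_integral_mono) (auto intro: INF_lower)
      also have "\<dots> = emeasure P {.. - real n}" unfolding h[OF sets.top] using XN by (intro arg_cong[where f = "emeasure P"]) auto
      finally show ?thesis .
    qed
    moreover have "(\<lambda>n. emeasure P {.. - real n}) \<longlonglongrightarrow> emeasure P (\<Inter>n. {.. - real n})"
      by (intro Lim_emeasure_decseq) (auto simp: decseq_def)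
    moreover have "(\<Inter>n. {.. - real n}) = {}"
    proof -
      have "\<exists>n. \<not> y \<le> - real n" for y
        using reals_Archimedean2[of "- y"] by (auto simp: not_le minus_less_iff)
      then show ?thesis by auto
    qed
    ultimately have "(\<integral>\<^sup>+x. (INF n. h (- real n) x) \<partial>\<mu>) \<le> 0"
      by (intro LIMSEQ_le_const[of "\<lambda>n. emeasure P {.. - real n}"]) auto
    then show ?thesis by (subst (asm) le_zero_eq, subst (asm) nn_integral_0_iff_AE) (auto cong: measurable_cong_sets)
  qed
  \<comment> \<open>Only countably many conditions occur, each valid almost everywhere, so
    \<open>G\<close> has full measure. On \<open>G\<close> the values at rational points rise from 0
    to 1.\<close>
  define G where "G = {x \<in> space N. (\<forall>q s :: rat. q \<le> s \<longrightarrow> h (of_rat q) x \<le> h (of_rat s) x) \<and>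
      (SUP n. h (real n) x) = 1 \<and> (INF n. h (- real n) x) = 0}"
  have G [measurable]: "G \<in> sets N" unfolding G_def by measurable
  have AE_G: "AE x in \<mu>. x \<in> G"
    using AE_mono_rat AE_top AE_bot AE_space by eventually_elim (auto simp: G_def)
  \<comment> \<open>Taking rationals strictly above \<open>r\<close> enforces right continuity in
    \<open>r\<close>.\<close>
  define J where "J r x = (INF q\<in>{q :: rat. of_rat q > r}. h (of_rat q) x)" for r :: real and x
  have [measurable]: "J r \<in> borel_measurable N" for r unfolding J_def by measurable
  define F where "F x r = enn2real (J r x)" for x r
  \<comment> \<open>Off \<open>G\<close> a fixed point mass is used, so that
    \<open>\<kappa> x\<close> is a probability measure for every \<open>x\<close> and measurability
    is preserved.\<close>
  define \<kappa> where "\<kappa> x = (if x \<in> G then interval_measure (F x) else return borel 0)" for x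
  have Gx: "h (of_rat q) x \<le> h (of_rat s) x" if "x \<in> G" "q \<le> s" for x q s using that by (simp add: G_def)
  have h1: "h (of_rat q) x \<le> 1" if x: "x \<in> G" for x q
  proof -
    obtain n where "of_rat q \<le> real n" using real_arch_simple by blast
    then have "q \<le> of_nat n" by (metis of_rat_less_eq of_rat_of_nat_eq)
    then have "h (of_rat q) x \<le> h (real n) x" using Gx[OF x, of q "of_nat n"] by simp
    also have "\<dots> \<le> (SUP n. h (real n) x)" by (rule SUP_upper) simp
    also have "\<dots> = 1" using x by (simp add: G_def)
    finally show ?thesis .
  qed
  have J1: "J r x \<le> 1" if "x \<in> G" for r x
  proof -
    obtain q :: rat where "of_rat q > r" using of_rat_dense[of r "r + 1"] by auto
    then have "J r x \<le> h (of_rat q) x" unfolding J_def by (intro INF_lower) simp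
    then show ?thesis using h1[OF that, of q] by simp
  qed
  have FJ: "ennreal (F x r) = J r x" if "x \<in> G" for x r
    unfolding F_def using J1[OF that, of r] by (intro ennreal_enn2real) (auto simp: less_top[symmetric] top_unique)
  have Jmono: "J r x \<le> J s x" if "r \<le> s" for r s x
    unfolding J_def using that by (intro INF_superset_mono) auto
  have F0: "0 \<le> F x r" for x r by (simp add: F_def)
  have Fle: "F x r \<le> F x s \<longleftrightarrow> J r x \<le> J s x" if "x \<in> G" for x r s
    using FJ[OF that] F0 by (metis ennreal_le_iff)
  have dist: "real_distribution (interval_measure (F x))" and
       cdf: "emeasure (interval_measure (F x)) {..r} = J r x" if x: "x \<in> G" for x r
  proof -
    have mono: "F x r \<le> F x s" if "r \<le> s" for r s using Fle[OF x] Jmono[OF that] by simp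
    have rc: "continuous (at_right r) (F x)" for r
    proof (subst continuous_at_right_real_increasing[OF mono], simp, intro allI impI)
      fix e :: real assume e: "e > 0"
      have "J r x < ennreal (F x r + e)" using FJ[OF x, of r] F0[of x r] e by (metis ennreal_less_iff less_add_same_cancel1)
      then obtain q :: rat where q: "of_rat q > r" "h (of_rat q) x < ennreal (F x r + e)"
        unfolding J_def INF_less_iff by auto
      obtain d where d: "d > 0" "r + d < of_rat q" using dense[OF q(1)] by (metis add.commute diff_add_cancel diff_gt_0_iff_gt)
      have "J (r + d) x \<le> h (of_rat q) x" unfolding J_def using d by (intro INF_lower) simp
      with q(2) have "ennreal (F x (r + d)) < ennreal (F x r + e)" using FJ[OF x] by simp
      then have "F x (r + d) < F x r + e" using F0 by (simp add: ennreal_less_iff)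
      with d show "\<exists>d>0. F x (r + d) - F x r < e" by (intro exI[of _ d]) simp
    qed
    have bot: "(F x \<longlongrightarrow> 0) at_bot"
    proof (rule order_tendstoI)
      fix e :: real assume "e > 0"
      then have "(INF n. h (- real n) x) < ennreal e" using x by (simp add: G_def)
      then obtain n where n: "h (- real n) x < ennreal e" by (auto simp: INF_less_iff)
      have "F x r < e" if "r < - real n" for r
      proof -
        have "J r x \<le> h (of_rat (- of_nat n)) x" unfolding J_def
          by (rule INF_lower) (use that in \<open>simp add: of_rat_minus\<close>)
        then have "ennreal (F x r) < ennreal e" using n FJ[OF x] by (simp add: of_rat_minus)
        then show ?thesis using F0 by (simp add: ennreal_less_iff)
      qed
      then show "\<forall>\<^sub>F r in at_bot. F x r < e" by (auto simp: eventually_at_bot_dense)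
    qed (use F0 in \<open>auto intro!: always_eventually intro: less_le_trans\<close>)
    have top: "(F x \<longlongrightarrow> 1) at_top"
    proof (rule order_tendstoI)
      fix e :: real assume e: "e < 1"
      show "\<forall>\<^sub>F r in at_top. e < F x r"
      proof (cases "e < 0")
        case True then show ?thesis using F0 by (auto intro!: always_eventually intro: less_le_trans)
      next
        case False
        then have "ennreal e < (SUP n. h (real n) x)" using x e by (simp add: G_def ennreal_less_one_iff)
        then obtain n where n: "ennreal e < h (real n) x" by (auto simp: less_SUP_iff)
        have "e < F x r" if "r > real n" for r
        proof -
          have "h (of_rat (of_nat n)) x \<le> J r x" unfolding J_def
          proof (rule INF_greatest)
            fix q :: rat assume "q \<in> {q. of_rat q > r}"
            then have "real_of_rat q \<ge> real_of_rat (of_nat n)" using that by simp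
            then show "h (of_rat (of_nat n)) x \<le> h (of_rat q) x" using Gx[OF x] by (simp only: of_rat_less_eq)
          qed
          then have "ennreal e < ennreal (F x r)" using n FJ[OF x] by simp
          then show ?thesis using False by (simp add: ennreal_less_iff)
        qed
        then show ?thesis by (auto simp: eventually_at_top_dense)
      qed
    next
      fix e :: real assume "1 < e"
      moreover have "F x r \<le> 1" for r using FJ[OF x, of r] J1[OF x, of r] by (metis ennreal_le_1)
      ultimately show "\<forall>\<^sub>F r in at_top. F x r < e" by (auto intro!: always_eventually intro: le_less_trans)
    qed
    show "real_distribution (interval_measure (F x))" by (rule real_distribution_interval_measure[OF mono rc bot top])
    show "emeasure (interval_measure (F x)) {..r} = J r x"
      using emeasure_interval_measure_Iic[OF mono rc bot] FJ[OF x] by simp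
  qed
  have borel_atMost: "sets (borel :: real measure) = sigma_sets UNIV (range atMost)"
    unfolding borel_eq_atMost by simp
  have \<kappa>: "\<kappa> \<in> N \<rightarrow>\<^sub>M prob_algebra borel"
  proof (rule measurable_prob_algebra_generated[OF borel_atMost])
    show "Int_stable (range atMost :: real set set)" by (auto simp: Int_stable_def)
    fix x
    show "prob_space (\<kappa> x)"
      using dist[of x] by (auto simp: \<kappa>_def real_distribution_def intro: prob_space_return)
    show "sets (\<kappa> x) = sets borel" by (auto simp: \<kappa>_def)
  next
    fix A :: "real set" assume "A \<in> range atMost"
    then obtain r where A: "A = {..r}" by auto
    have "emeasure (\<kappa> x) A = (if x \<in> G then J r x else indicator {..r} 0)" for x
      by (auto simp: \<kappa>_def A cdf)
    then show "(\<lambda>x. emeasure (\<kappa> x) A) \<in> borel_measurable N" by simp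
  qed simp
  \<comment> \<open>Almost everywhere \<open>J r\<close> lies above \<open>h r\<close> and below
    \<open>h q\<close> for each rational \<open>q > r\<close>. Letting \<open>q\<close> decrease to
    \<open>r\<close>, continuity from above of \<open>P\<close> identifies the integral.\<close>
  have J_int: "(\<integral>\<^sup>+x\<in>A. J r x \<partial>\<mu>) = emeasure P (X -` A \<inter> {..r})" if A: "A \<in> sets N" for A r
  proof (rule antisym)
    have "AE x in \<mu>. \<forall>q :: rat. of_rat q > r \<longrightarrow> h r x \<le> h (of_rat q) x"
      unfolding AE_all_countable using AE_mono by (auto intro: less_imp_le)
    then have "AE x in \<mu>. h r x \<le> J r x" by eventually_elim (auto simp: J_def intro: INF_greatest)
    then have "(\<integral>\<^sup>+x\<in>A. h r x \<partial>\<mu>) \<le> (\<integral>\<^sup>+x\<in>A. J r x \<partial>\<mu>)"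
      by (intro nn_integral_mono_AE) (auto elim!: eventually_mono intro: mult_right_mono)
    then show "emeasure P (X -` A \<inter> {..r}) \<le> (\<integral>\<^sup>+x\<in>A. J r x \<partial>\<mu>)" using h[OF A] by simp
    have "(\<integral>\<^sup>+x\<in>A. J r x \<partial>\<mu>) \<le> emeasure P (X -` A \<inter> {..r + 1 / Suc n})" for n
    proof -
      obtain q :: rat where q: "r < of_rat q" "of_rat q < r + 1 / Suc n"
        using of_rat_dense[of r "r + 1 / Suc n"] by auto
      have "(\<integral>\<^sup>+x\<in>A. J r x \<partial>\<mu>) \<le> (\<integral>\<^sup>+x\<in>A. h (of_rat q) x \<partial>\<mu>)"
        unfolding J_def using q by (intro nn_integral_mono mult_right_mono INF_lower) auto
      also have "\<dots> = emeasure P (X -` A \<inter> {..of_rat q})" by (rule h[OF A])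
      also have "\<dots> \<le> emeasure P (X -` A \<inter> {..r + 1 / Suc n})"
        using q A by (intro emeasure_mono) auto
      finally show ?thesis .
    qed
    moreover have "(\<lambda>n. emeasure P (X -` A \<inter> {..r + 1 / Suc n})) \<longlonglongrightarrow> emeasure P (\<Inter>n. X -` A \<inter> {..r + 1 / Suc n})"
      using A by (intro Lim_emeasure_decseq) (auto simp: decseq_def frac_le intro: order_trans)
    moreover have "(\<Inter>n. X -` A \<inter> {..r + 1 / Suc n}) = X -` A \<inter> {..r}"
    proof -
      have "y \<le> r" if "\<And>n. y \<le> r + 1 / Suc n" for y
      proof (rule ccontr)
        assume "\<not> y \<le> r"
        then obtain n where "inverse (real (Suc n)) < y - r" using reals_Archimedean[of "y - r"] by auto
        with that[of n] show False by (simp add: inverse_eq_divide)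
      qed
      then show ?thesis by (auto intro: order_trans)
    qed
    ultimately show "(\<integral>\<^sup>+x\<in>A. J r x \<partial>\<mu>) \<le> emeasure P (X -` A \<inter> {..r})"
      by (intro LIMSEQ_le_const[of "\<lambda>n. emeasure P (X -` A \<inter> {..r + 1 / Suc n})"]) auto
  qed
  have "density P (indicator (X -` A)) = density \<mu> (indicator A) \<bind> \<kappa>" if A: "A \<in> sets N" for A
  proof -
    have ne: "space (density \<mu> (indicator A)) \<noteq> {}" using \<mu>.not_empty by simp
    have \<kappa>': "\<kappa> \<in> density \<mu> (indicator A) \<rightarrow>\<^sub>M subprob_algebra borel"
      using measurable_prob_algebraD[OF \<kappa>] by (simp cong: measurable_cong_sets)
    have E1: "emeasure (density P (indicator (X -` A))) {..r} = emeasure P (X -` A \<inter> {..r})" for r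
      using A by (subst emeasure_density) (auto simp: nn_integral_indicator simp flip: indicator_inter_arith)
    have E2: "emeasure (density \<mu> (indicator A) \<bind> \<kappa>) {..r} = emeasure P (X -` A \<inter> {..r})" for r
    proof -
      have "emeasure (density \<mu> (indicator A) \<bind> \<kappa>) {..r} = (\<integral>\<^sup>+x. emeasure (\<kappa> x) {..r} \<partial>density \<mu> (indicator A))"
        using \<kappa>' ne by (intro emeasure_bind) auto
      also have "\<dots> = (\<integral>\<^sup>+x. indicator A x * emeasure (\<kappa> x) {..r} \<partial>\<mu>)"
        using A measurable_prob_algebraD[OF \<kappa>]
        by (intro nn_integral_density) (auto cong: measurable_cong_sets)
      also have "\<dots> = (\<integral>\<^sup>+x\<in>A. J r x \<partial>\<mu>)"
        using AE_G by (intro nn_integral_cong_AE) (auto elim!: eventually_mono simp: \<kappa>_def cdf mult.commute)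
      finally show ?thesis using J_int[OF A] by simp
    qed
    show ?thesis
    proof (rule measure_eqI_generator_eq[of "range atMost" UNIV _ _ "\<lambda>n. {..real n}"])
      show "Int_stable (range atMost :: real set set)" by (auto simp: Int_stable_def)
      show "emeasure (density P (indicator (X -` A))) B = emeasure (density \<mu> (indicator A) \<bind> \<kappa>) B"
        if "B \<in> range atMost" for B using that E1 E2 by auto
      show "sets (density P (indicator (X -` A))) = sigma_sets UNIV (range atMost)"
        using borel_atMost by simp
      show "sets (density \<mu> (indicator A) \<bind> \<kappa>) = sigma_sets UNIV (range atMost)"
        using sets_bind[OF sets_kernel[OF \<kappa>'] ne] borel_atMost by simp
      show "(\<Union>n. {..real n}) = UNIV" using real_arch_simple by auto
      show "emeasure (density P (indicator (X -` A))) {..real n} \<noteq> \<infinity>" for n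
        unfolding E1 by simp
    qed auto
  qed
  with \<kappa> show ?thesis unfolding \<mu>_def by blast
qed

text \<open>Nonemptiness matters because \<open>infdist\<close> to the empty set is 0 by
  convention.\<close>

lemma indicator_closed_limit:
  fixes F :: "'a :: metric_space set"
  assumes "closed F" "F \<noteq> {}"
  shows "(\<lambda>n. max 0 (1 - real n * infdist x F)) \<longlonglongrightarrow> indicator F x"
proof (cases "x \<in> F")
  case False
  then have pos: "infdist x F > 0"
    using assms by (simp add: infdist_pos_not_in_closed)
  obtain N where N: "1 < real N * infdist x F" using reals_Archimedean3[OF pos] by blast
  have "max 0 (1 - real n * infdist x F) = 0" if "n \<ge> N" for n
  proof -
    have "real N * infdist x F \<le> real n * infdist x F" using that pos by (intro mult_right_mono) auto
    then show ?thesis using N by simp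
  qed
  then have "\<forall>\<^sub>F n in sequentially. max 0 (1 - real n * infdist x F) = 0"
    by (auto simp: eventually_sequentially)
  then show ?thesis using False by (simp add: tendsto_eventually)
qed simp

text \<open>Passage from continuous test functions to Borel sets: closed sets by dominated
  convergence along \<open>indicator_closed_limit\<close>, all others by Dynkin's argument from the
  intersection-stable closed sets.\<close>

lemma martingale_set_integral_zero:
  fixes \<phi> :: "real \<Rightarrow> complex" and D :: "real \<Rightarrow> real"
  assumes P: "real_distribution P" and [measurable]: "\<phi> \<in> borel_measurable borel" "D \<in> borel_measurable borel"
    and D: "\<And>t. \<bar>D t\<bar> \<le> B"
    and mart: "\<And>h :: complex \<Rightarrow> real. continuous_on UNIV h \<Longrightarrow> bounded (range h) \<Longrightarrow> (LINT t|P. h (\<phi> t) * D t) = 0"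
    and A: "A \<in> sets borel"
  shows "(LINT t:\<phi> -` A|P. D t) = 0"
proof -
  interpret real_distribution P by fact
  have B: "0 \<le> B" using D[of 0] by linarith
  have Dint: "integrable P D"
    by (rule integrable_const_bound[of _ B]) (use D in auto)
  have Dset: "set_integrable P C D" if "C \<in> sets borel" for C
    unfolding set_integrable_def using that Dint by (intro integrable_mult_indicator) auto
  have meas: "\<phi> -` C \<in> sets borel" if "C \<in> sets borel" for C
    using that measurable_sets[of \<phi> borel borel C] by simp
  have closed: "(LINT t:\<phi> -` F|P. D t) = 0" if F: "closed F" for F
  proof (cases "F = {}")
    case False
    define h where "h n x = max 0 (1 - real n * infdist x F)" for n x
    have hb: "0 \<le> h n x" "h n x \<le> 1" for n x by (auto simp: h_def infdist_nonneg)
    have hc: "continuous_on UNIV (h n)" for n unfolding h_def by (intro continuous_intros)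
    have [measurable]: "h n \<in> borel_measurable borel" for n by (rule borel_measurable_continuous_onI[OF hc])
    have [measurable]: "F \<in> sets borel" using F by simp
    have "(\<lambda>n. LINT t|P. h n (\<phi> t) * D t) \<longlonglongrightarrow> (LINT t|P. indicator F (\<phi> t) * D t)"
    proof (rule integral_dominated_convergence[where w = "\<lambda>_. B"])
      show "AE t in P. (\<lambda>n. h n (\<phi> t) * D t) \<longlonglongrightarrow> indicator F (\<phi> t) * D t"
        unfolding h_def by (intro AE_I2 tendsto_intros indicator_closed_limit F False)
      fix n show "AE t in P. norm (h n (\<phi> t) * D t) \<le> B"
        using mult_mono[OF hb(2) D zero_le_one abs_ge_zero] hb by (intro AE_I2) (simp add: abs_mult)
    qed auto
    moreover have "(LINT t|P. h n (\<phi> t) * D t) = 0" for n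
      by (rule mart[OF hc]) (auto simp: bounded_iff intro!: exI[of _ 1] simp: hb)
    ultimately have "(LINT t|P. indicator F (\<phi> t) * D t) = 0" by (simp add: LIMSEQ_const_iff)
    then show ?thesis by (simp add: set_lebesgue_integral_def indicator_def cong: if_cong)
  qed (simp add: set_lebesgue_integral_def)
  have "Int_stable (Collect closed :: complex set set)" by (auto simp: Int_stable_def)
  moreover have "Collect closed \<subseteq> Pow (UNIV :: complex set)" by simp
  moreover have "A \<in> sigma_sets UNIV (Collect closed)" using A by (simp add: borel_eq_closed)
  ultimately show ?thesis
  proof (induction rule: sigma_sets_induct_disjoint)
    case (basic F) then show ?case using closed by simp
  next
    case empty show ?case by (simp add: set_lebesgue_integral_def)
  next
    case (compl C)
    then have C: "C \<in> sets borel" by (simp add: borel_eq_closed)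
    have "(LINT t:\<phi> -` C \<union> \<phi> -` (UNIV - C)|P. D t) = (LINT t:\<phi> -` C|P. D t) + (LINT t:\<phi> -` (UNIV - C)|P. D t)"
      using C meas by (intro set_integral_Un Dset) auto
    moreover have "\<phi> -` C \<union> \<phi> -` (UNIV - C) = \<phi> -` UNIV" by auto
    ultimately show ?case using compl closed[of UNIV] by simp
  next
    case (union C)
    then have C: "C i \<in> sets borel" for i by (auto simp: borel_eq_closed)
    have "(LINT t:(\<Union>i. \<phi> -` C i)|P. D t) = (\<Sum>i. LINT t:\<phi> -` C i|P. D t)"
    proof (rule lebesgue_integral_countable_add)
      show "\<phi> -` C i \<inter> \<phi> -` C j = {}" if "i \<noteq> j" for i j
        using union(1) that unfolding disjoint_family_on_def by blast
    qed (use C meas in \<open>auto intro!: Dset\<close>)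
    then show ?case using union by (simp add: vimage_UN)
  qed
qed

text \<open>\<open>\<kappa> x\<close> is the conditional law of the sample point given that
  \<open>\<phi>\<close> takes the value \<open>x\<close>, and the dilation sends \<open>x\<close> to
  the image of this law under \<open>\<psi>\<close>. The martingale identity is what places its
  barycenter at \<open>x\<close>.\<close>

lemma martingale_dilation:
  fixes \<phi> \<psi> :: "real \<Rightarrow> complex"
  assumes P: "real_distribution P" and [measurable]: "\<phi> \<in> borel_measurable borel" "\<psi> \<in> borel_measurable borel"
    and bd: "\<And>t. cmod (\<phi> t) \<le> B" "\<And>t. cmod (\<psi> t) \<le> B"
    and K: "compact K" and \<phi>K: "AE t in P. \<phi> t \<in> K" and \<psi>K: "AE t in P. \<psi> t \<in> K"
    and mart: "\<And>(h :: complex \<Rightarrow> real) u. continuous_on UNIV h \<Longrightarrow> bounded (range h) \<Longrightarrow>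
        (LINT t|P. h (\<phi> t) * inner u (\<psi> t - \<phi> t)) = 0"
  shows "\<exists>T. dilation K T \<and> dilation_image K T (distr P borel \<phi>) (distr P borel \<psi>)"
proof -
  interpret P: real_distribution P by fact
  have [measurable]: "K \<in> sets borel" using K by (simp add: borel_compact)
  define \<mu> where "\<mu> = distr P borel \<phi>"
  interpret \<mu>: prob_space \<mu> unfolding \<mu>_def by (rule P.prob_space_distr) simp
  have [simp, measurable_cong]: "sets \<mu> = sets borel" and [simp]: "space \<mu> = UNIV" by (simp_all add: \<mu>_def)
  have "\<phi> \<in> P \<rightarrow>\<^sub>M borel" by measurable
  from real_regular_conditional_distribution[OF P this] obtain \<kappa>
    where \<kappa> [measurable]: "\<kappa> \<in> borel \<rightarrow>\<^sub>M prob_algebra borel"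
    and dis: "\<And>A. A \<in> sets borel \<Longrightarrow>
       density P (indicator (\<phi> -` A)) = density \<mu> (indicator A) \<bind> \<kappa>"
    unfolding \<mu>_def by blast
  have [measurable]: "\<kappa> \<in> borel \<rightarrow>\<^sub>M subprob_algebra borel" by (rule measurable_prob_algebraD[OF \<kappa>])
  have \<kappa>p: "prob_space (\<kappa> x)" and \<kappa>s [simp, measurable_cong]: "sets (\<kappa> x) = sets borel" for x
    using measurable_space[OF \<kappa>, of x] by (auto simp: space_prob_algebra)
  have meas\<phi>: "\<phi> -` C \<in> sets borel" if "C \<in> sets borel" for C
    using that measurable_sets[of \<phi> borel borel C] by simp
  have int: "(LINT t:\<phi> -` A|P. f t) = (LINT x:A|\<mu>. (LINT t|\<kappa> x. f t))"
    if A: "A \<in> sets borel" and f [measurable]: "f \<in> borel_measurable borel" and C: "\<And>t. \<bar>f t\<bar> \<le> C"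
    for A and f :: "real \<Rightarrow> real" and C
  proof -
    have [measurable]: "A \<in> sets borel" "\<phi> -` A \<in> sets borel" using A meas\<phi> by auto
    have "(LINT t:\<phi> -` A|P. f t) = (LINT t|density P (\<lambda>t. ennreal (indicator (\<phi> -` A) t)). f t)"
      unfolding set_lebesgue_integral_def by (subst integral_density) auto
    also have "\<dots> = (LINT t|(density \<mu> (indicator A) \<bind> \<kappa>). f t)"
      using dis[OF A] by (simp add: ennreal_indicator)
    also have "\<dots> = (LINT x|density \<mu> (indicator A). (LINT t|\<kappa> x. f t))"
    proof (rule integral_bind[where K = borel and B = C and B' = 1])
      show "\<kappa> \<in> density \<mu> (indicator A) \<rightarrow>\<^sub>M subprob_algebra borel" by measurable
      show "finite_measure (density \<mu> (indicator A))"
      proof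
        have "emeasure (density \<mu> (indicator A)) UNIV = emeasure \<mu> A"
          by (subst emeasure_density) auto
        then show "emeasure (density \<mu> (indicator A)) (space (density \<mu> (indicator A))) \<noteq> \<infinity>" by simp
      qed
      show "AE x in density \<mu> (indicator A). emeasure (\<kappa> x) (space (\<kappa> x)) \<le> ennreal 1"
        using \<kappa>p by (auto simp: prob_space.emeasure_space_1)
    qed (use C in auto)
    also have "\<dots> = (LINT x|density \<mu> (\<lambda>x. ennreal (indicator A x)). (LINT t|\<kappa> x. f t))"
      by (simp add: ennreal_indicator)
    also have "\<dots> = (LINT x:A|\<mu>. (LINT t|\<kappa> x. f t))"
      unfolding set_lebesgue_integral_def by (subst integral_density) auto
    finally show ?thesis .
  qed
  have \<kappa>bd: "\<bar>LINT t|\<kappa> x. f t\<bar> \<le> C" if f [measurable]: "f \<in> borel_measurable borel" and C: "\<And>t. \<bar>f t\<bar> \<le> C"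
    for f :: "real \<Rightarrow> real" and C x
  proof -
    interpret prob_space "\<kappa> x" by (rule \<kappa>p)
    have i: "integrable (\<kappa> x) f" by (rule integrable_const_bound[of _ C]) (use C in auto)
    have "expectation f \<le> C" "- C \<le> expectation f"
      using i C by (auto intro!: integral_le_const integral_ge_const simp: abs_le_iff minus_le_iff)
    then show ?thesis by (simp add: abs_le_iff minus_le_iff)
  qed
  \<comment> \<open>Real linear functionals allow a comparison of real densities on all Borel sets;
    \<open>u = 1\<close> and \<open>u = \<i>\<close> recover the real and imaginary parts.\<close>
  have bary: "AE x in \<mu>. (LINT t|\<kappa> x. inner u (\<psi> t)) = inner u x" for u
  proof -
    have ib: "\<bar>inner u v\<bar> \<le> cmod u * B" if "cmod v \<le> B" for v
      using Cauchy_Schwarz_ineq2[of u v] mult_left_mono[OF that, of "cmod u"] by simp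
    have "AE x in \<mu>. x \<in> K" unfolding \<mu>_def by (subst AE_distr_iff) (use \<phi>K in auto)
    obtain C where C: "\<And>x. x \<in> K \<Longrightarrow> cmod x \<le> C" using compact_imp_bounded[OF K] by (auto simp: bounded_iff)
    show ?thesis
    proof (rule density_unique_real)
      show "integrable \<mu> (\<lambda>x. LINT t|\<kappa> x. inner u (\<psi> t))"
        by (rule \<mu>.integrable_const_bound[of _ "cmod u * B"]) (use \<kappa>bd ib bd in auto)
      show i2: "integrable \<mu> (\<lambda>x. inner u x)"
        unfolding \<mu>_def by (subst integrable_distr_eq)
          (auto intro!: P.integrable_const_bound[of _ "cmod u * B"] simp: ib bd)
      fix A assume A: "A \<in> sets \<mu>"
      have [measurable]: "A \<in> sets borel" "\<phi> -` A \<in> sets borel" using A meas\<phi> by auto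
      have Pint: "set_integrable P (\<phi> -` A) (\<lambda>t. inner u (f t))"
        if [measurable]: "f \<in> borel_measurable borel" and "\<And>t. cmod (f t) \<le> B" for f
        unfolding set_integrable_def
        by (intro integrable_mult_indicator P.integrable_const_bound[of _ "cmod u * B"]) (use ib that in auto)
      have "(LINT t:\<phi> -` A|P. inner u (\<psi> t - \<phi> t)) = 0"
      proof (rule martingale_set_integral_zero[OF P _ _ _ mart])
        fix t show "\<bar>inner u (\<psi> t - \<phi> t)\<bar> \<le> cmod u * B + cmod u * B"
          unfolding inner_diff_right using ib[OF bd(1)[of t]] ib[OF bd(2)[of t]] by linarith
      qed (use A in auto)
      then have "(LINT t:\<phi> -` A|P. inner u (\<psi> t)) = (LINT t:\<phi> -` A|P. inner u (\<phi> t))"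
        unfolding inner_diff_right by (subst (asm) set_integral_diff) (use Pint bd in auto)
      also have "\<dots> = (LINT x:A|\<mu>. inner u x)"
        unfolding set_lebesgue_integral_def \<mu>_def
        by (subst integral_distr) (auto simp: indicator_def cong: if_cong)
      finally show "(LINT x:A|\<mu>. (LINT t|\<kappa> x. inner u (\<psi> t))) = (LINT x:A|\<mu>. inner u x)"
        using int[of A "\<lambda>t. inner u (\<psi> t)" "cmod u * B"] A ib bd by simp
    qed
  qed
  have inK: "AE x in \<mu>. (LINT t|\<kappa> x. indicat_real K (\<psi> t)) = 1"
  proof -
    have "AE x in \<mu>. (LINT t|\<kappa> x. 1 - indicat_real K (\<psi> t)) = 0"
    proof (subst integral_nonneg_eq_0_iff_AE[symmetric])
      show nn: "AE x in \<mu>. 0 \<le> (LINT t|\<kappa> x. 1 - indicat_real K (\<psi> t))"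
        by (intro AE_I2 integral_nonneg_AE) (auto split: split_indicator)
      show "integrable \<mu> (\<lambda>x. LINT t|\<kappa> x. 1 - indicat_real K (\<psi> t))"
      proof (rule \<mu>.integrable_const_bound[of _ 1])
        have "\<bar>LINT t|\<kappa> x. 1 - indicat_real K (\<psi> t)\<bar> \<le> 1" for x
          by (rule \<kappa>bd) (auto split: split_indicator)
        then show "AE x in \<mu>. norm (LINT t|\<kappa> x. 1 - indicat_real K (\<psi> t)) \<le> 1" by simp
      qed auto
      have "(LINT t:\<phi> -` UNIV|P. 1 - indicat_real K (\<psi> t)) = (LINT x:UNIV|\<mu>. LINT t|\<kappa> x. 1 - indicat_real K (\<psi> t))"
        by (rule int[of _ _ 1]) (auto split: split_indicator)
      moreover have "(LINT t:\<phi> -` UNIV|P. 1 - indicat_real K (\<psi> t)) = 0"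
        unfolding set_lebesgue_integral_def
        by (rule integral_eq_zero_AE) (use \<psi>K in \<open>auto elim!: eventually_mono\<close>)
      ultimately show "(LINT x|\<mu>. LINT t|\<kappa> x. 1 - indicat_real K (\<psi> t)) = 0"
        by (simp add: set_lebesgue_integral_def)
    qed
    moreover have "(LINT t|\<kappa> x. 1 - indicat_real K (\<psi> t)) = 1 - (LINT t|\<kappa> x. indicat_real K (\<psi> t))" for x
    proof -
      interpret prob_space "\<kappa> x" by (rule \<kappa>p)
      have "integrable (\<kappa> x) (\<lambda>t. indicat_real K (\<psi> t))"
        by (rule integrable_const_bound[of _ 1]) auto
      then show ?thesis by (simp add: prob_space)
    qed
    ultimately show ?thesis by simp
  qed
  define G where "G = {x. (LINT t|\<kappa> x. indicat_real K (\<psi> t)) = 1 \<and>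
      (LINT t|\<kappa> x. inner 1 (\<psi> t)) = inner 1 x \<and> (LINT t|\<kappa> x. inner \<i> (\<psi> t)) = inner \<i> x}"
  have G [measurable]: "G \<in> sets borel" unfolding G_def by measurable
  have AE_G: "AE x in \<mu>. x \<in> G" using inK bary[of 1] bary[of \<i>] by eventually_elim (simp add: G_def)
  \<comment> \<open>A dilation needs its barycenter and its support at every point of
    \<open>K\<close>, not just almost everywhere. On the exceptional set the point mass at
    \<open>x\<close> satisfies both.\<close>
  define T where "T x = (if x \<in> G then distr (\<kappa> x) borel \<psi> else return borel x)" for x
  have sets_T [simp, measurable_cong]: "sets (T x) = sets borel" for x by (simp add: T_def)
  have prob_T: "prob_space (T x)" for x
    unfolding T_def by (auto intro!: prob_space_return prob_space.prob_space_distr[OF \<kappa>p])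
  have T_K: "emeasure (T x) K = 1" if "x \<in> K" for x
  proof (cases "x \<in> G")
    case True
    interpret prob_space "\<kappa> x" by (rule \<kappa>p)
    have "measure (distr (\<kappa> x) borel \<psi>) K = (LINT y|distr (\<kappa> x) borel \<psi>. indicat_real K y)" by simp
    also have "\<dots> = 1" using True by (subst integral_distr) (auto simp: G_def)
    finally have "measure (T x) K = 1" using True by (simp add: T_def)
    then show ?thesis
      using finite_measure.emeasure_eq_measure[OF prob_space.finite_measure[OF prob_T[of x]], of K] by simp
  next
    case False then show ?thesis using that by (simp add: T_def)
  qed
  have T_AE: "AE y in T x. y \<in> K" if "x \<in> K" for x
  proof -
    interpret prob_space "T x" by (rule prob_T)
    have "prob K = 1" using T_K[OF that] by (simp add: emeasure_eq_measure)
    then show ?thesis using AE_in_set_eq_1[of K] by simp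
  qed
  have bar: "(LINT y:K|T x. y) = x" if x: "x \<in> K" for x
  proof -
    have "(LINT y:K|T x. y) = (LINT y|T x. y)"
      unfolding set_lebesgue_integral_def
      by (rule integral_cong_AE) (use T_AE[OF x] in \<open>auto elim!: eventually_mono\<close>)
    also have "\<dots> = x"
    proof (cases "x \<in> G")
      case True
      interpret prob_space "\<kappa> x" by (rule \<kappa>p)
      have i: "integrable (\<kappa> x) \<psi>" by (rule integrable_const_bound[of _ B]) (use bd in auto)
      have "(LINT y|T x. y) = (LINT t|\<kappa> x. \<psi> t)" using True by (simp add: T_def integral_distr)
      moreover have "Re (LINT t|\<kappa> x. \<psi> t) = Re x" "Im (LINT t|\<kappa> x. \<psi> t) = Im x"
        using True i by (auto simp: G_def inner_complex_def simp flip: integral_Re integral_Im)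
      ultimately show ?thesis by (simp add: complex_eq_iff)
    next
      case False
      then show ?thesis by (simp add: T_def integral_return)
    qed
    finally show ?thesis .
  qed
  \<comment> \<open>Test functions are continuous on \<open>K\<close> alone; extended by 0 they are
    Borel and bounded, which is all that \<open>int\<close> asks for.\<close>
  have cont: "(\<lambda>y. indicator K y *\<^sub>R f y) \<in> borel_measurable borel \<and> (\<exists>C. \<forall>y. \<bar>indicator K y *\<^sub>R f y\<bar> \<le> C)"
    if f: "continuous_on K f" for f :: "complex \<Rightarrow> real"
  proof
    show "(\<lambda>y. indicator K y *\<^sub>R f y) \<in> borel_measurable borel"
      by (rule borel_measurable_continuous_on_indicator[OF _ f]) simp
    obtain C where "\<And>y. y \<in> K \<Longrightarrow> \<bar>f y\<bar> \<le> C"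
      using compact_imp_bounded[OF compact_continuous_image[OF f K]] by (auto simp: bounded_iff)
    then have "\<bar>indicator K y *\<^sub>R f y\<bar> \<le> \<bar>C\<bar>" for y
      by (cases "y \<in> K") (auto intro: order_trans[OF _ abs_ge_self])
    then show "\<exists>C. \<forall>y. \<bar>indicator K y *\<^sub>R f y\<bar> \<le> C" by blast
  qed
  have Tint: "(LINT y:K|T x. f y) = (if x \<in> G then (LINT t|\<kappa> x. indicator K (\<psi> t) *\<^sub>R f (\<psi> t)) else indicator K x *\<^sub>R f x)"
    if f: "continuous_on K f" for f :: "complex \<Rightarrow> real" and x
    using cont[OF f] unfolding set_lebesgue_integral_def T_def by (auto simp: integral_distr integral_return)
  have Tmeas: "(\<lambda>x. LINT y:K|T x. f y) \<in> borel_measurable borel"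
    if f: "continuous_on K f" for f :: "complex \<Rightarrow> real"
  proof -
    have [measurable]: "(\<lambda>y. indicator K y *\<^sub>R f y) \<in> borel_measurable borel" using cont[OF f] by blast
    have "(\<lambda>t. (\<lambda>y. indicator K y *\<^sub>R f y) (\<psi> t)) \<in> borel_measurable borel" by measurable
    then have [measurable]: "(\<lambda>t. indicator K (\<psi> t) *\<^sub>R f (\<psi> t)) \<in> borel_measurable borel" by simp
    show ?thesis unfolding Tint[OF f] by measurable
  qed
  have "dilation K T"
    unfolding dilation_def prob_measure_on_def
    using prob_T T_K bar Tmeas by (auto intro: measurable_restrict_space1)
  moreover have "dilation_image K T \<mu> (distr P borel \<psi>)"
    unfolding dilation_image_def
  proof (intro conjI allI impI)
    show "prob_measure_on K (distr P borel \<psi>)"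
      unfolding prob_measure_on_def
    proof (intro conjI)
      show pr: "prob_space (distr P borel \<psi>)" by (rule P.prob_space_distr) simp
      interpret Q: prob_space "distr P borel \<psi>" by (rule pr)
      have "AE y in distr P borel \<psi>. y \<in> K" by (subst AE_distr_iff) (use \<psi>K in auto)
      then show "emeasure (distr P borel \<psi>) K = 1" by (intro Q.emeasure_eq_1_AE) auto
    qed simp
  next
    fix f :: "complex \<Rightarrow> real" assume f: "continuous_on K f"
    obtain C where C: "\<And>y. \<bar>indicator K y *\<^sub>R f y\<bar> \<le> C" using cont[OF f] by blast
    have gm [measurable]: "(\<lambda>y. indicator K y *\<^sub>R f y) \<in> borel_measurable borel" using cont[OF f] by blast
    have "(\<lambda>t. (\<lambda>y. indicator K y *\<^sub>R f y) (\<psi> t)) \<in> borel_measurable borel" by measurable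
    then have gm2 [measurable]: "(\<lambda>t. indicator K (\<psi> t) *\<^sub>R f (\<psi> t)) \<in> borel_measurable borel" by simp
    have "(LINT y:K|distr P borel \<psi>. f y) = (LINT t|P. indicator K (\<psi> t) *\<^sub>R f (\<psi> t))"
      unfolding set_lebesgue_integral_def by (rule integral_distr[OF _ gm]) measurable
    also have "\<dots> = (LINT t:\<phi> -` UNIV|P. indicator K (\<psi> t) *\<^sub>R f (\<psi> t))"
      by (simp add: set_lebesgue_integral_def)
    also have "\<dots> = (LINT x:UNIV|\<mu>. (LINT t|\<kappa> x. indicator K (\<psi> t) *\<^sub>R f (\<psi> t)))"
      by (rule int[OF _ gm2 C]) simp
    also have "\<dots> = (LINT x:K|\<mu>. (LINT y:K|T x. f y))"
    proof -
      have "AE x in \<mu>. x \<in> K" unfolding \<mu>_def by (subst AE_distr_iff) (use \<phi>K in auto)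
      then have ae: "AE x in \<mu>. indicator UNIV x *\<^sub>R (LINT t|\<kappa> x. indicator K (\<psi> t) *\<^sub>R f (\<psi> t)) =
          indicator K x *\<^sub>R (LINT y:K|T x. f y)"
        using AE_G by eventually_elim (simp add: Tint[OF f])
      have "(\<lambda>x. LINT t|\<kappa> x. indicator K (\<psi> t) *\<^sub>R f (\<psi> t)) \<in> borel_measurable borel" by measurable
      then have m1: "(\<lambda>x. LINT t|\<kappa> x. indicator K (\<psi> t) *\<^sub>R f (\<psi> t)) \<in> borel_measurable \<mu>"
        by (simp only: measurable_cong_sets[OF \<open>sets \<mu> = sets borel\<close> refl])
      have m2: "(\<lambda>x. LINT y:K|T x. f y) \<in> borel_measurable \<mu>"
        using Tmeas[OF f] by (simp only: measurable_cong_sets[OF \<open>sets \<mu> = sets borel\<close> refl])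
      show ?thesis
        unfolding set_lebesgue_integral_def[of \<mu>]
        by (rule integral_cong_AE[OF borel_measurable_scaleR[OF borel_measurable_indicator m1]
              borel_measurable_scaleR[OF borel_measurable_indicator m2] ae]) simp_all
    qed
    finally show "(LINT y:K|distr P borel \<psi>. f y) = (LINT x:K|\<mu>. (LINT y:K|T x. f y))" .
  qed
  ultimately show ?thesis unfolding \<mu>_def by blast
qed

section \<open>Limits of couplings\<close>

text \<open>Prokhorov's theorem for couplings on \<open>K \<times> K\<close>, reduced to Helly's theorem on the real line by
  lifting along a continuous surjection of an interval onto a superset of \<open>K \<times> K\<close>.\<close>

lemma coupling_limit:
  fixes q :: "nat \<Rightarrow> (complex \<times> complex) pmf"
  assumes K: "bounded K" and q: "\<And>j. set_pmf (q j) \<subseteq> K \<times> K"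
  shows "\<exists>(r :: nat \<Rightarrow> nat) (P :: real measure) (\<phi> :: real \<Rightarrow> complex) (\<psi> :: real \<Rightarrow> complex).
    strict_mono r \<and> real_distribution P \<and> continuous_on UNIV \<phi> \<and> continuous_on UNIV \<psi> \<and>
    bounded (range \<phi>) \<and> bounded (range \<psi>) \<and>
    (\<forall>G :: complex \<times> complex \<Rightarrow> real. continuous_on UNIV G \<longrightarrow>
       (\<lambda>j. LINT z|measure_pmf (q (r j)). G z) \<longlonglongrightarrow> (LINT t|P. G (\<phi> t, \<psi> t)))"
proof -
  obtain \<phi> \<psi> :: "real \<Rightarrow> complex" where c: "continuous_on UNIV \<phi>" "continuous_on UNIV \<psi>"
    and b: "bounded (range \<phi>)" "bounded (range \<psi>)"
    and surj: "\<And>x y. x \<in> K \<Longrightarrow> y \<in> K \<Longrightarrow> \<exists>t\<in>{0..1}. \<phi> t = x \<and> \<psi> t = y"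
    using space_filling_pair[OF K] by metis
  have "\<forall>z\<in>K \<times> K. \<exists>t. t \<in> {0..1} \<and> \<phi> t = fst z \<and> \<psi> t = snd z"
    using surj by (auto simp: Bex_def)
  \<comment> \<open>An arbitrary choice of parameters on the curve. Every function on a
    \<open>pmf\<close> is measurable, so the choice need not be Borel.\<close>
  from bchoice[OF this] obtain \<sigma> where
    "\<forall>z\<in>K \<times> K. \<sigma> z \<in> {0..1} \<and> \<phi> (\<sigma> z) = fst z \<and> \<psi> (\<sigma> z) = snd z" by blast
  then have \<sigma>: "\<And>z. z \<in> K \<times> K \<Longrightarrow> \<sigma> z \<in> {0..1} \<and> \<phi> (\<sigma> z) = fst z \<and> \<psi> (\<sigma> z) = snd z" by blast
  define D where "D j = distr (measure_pmf (q j)) borel \<sigma>" for j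
  have D: "real_distribution (D j)" for j
    unfolding D_def real_distribution_def real_distribution_axioms_def
    by (auto intro: measure_pmf.prob_space_distr)
  have "tight D"
    unfolding tight_def
  proof (intro conjI allI impI)
    fix e :: real assume e: "e > 0"
    have "measure (D j) {-1<..1} = 1" for j
    proof -
      have "measure (D j) {-1<..1} = measure (measure_pmf (q j)) (\<sigma> -` {-1<..1})"
        unfolding D_def by (subst measure_distr) auto
      also have "\<dots> = 1"
        by (subst measure_pmf.prob_eq_1) (use q \<sigma> in \<open>force simp: AE_measure_pmf_iff\<close>)+
      finally show ?thesis .
    qed
    then show "\<exists>a b. a < b \<and> (\<forall>n. 1 - e < measure (D n) {a<..b})"
      using e by (intro exI[of _ "-1"] exI[of _ 1]) auto
  qed (rule D)
  then obtain r P where r: "strict_mono r" and P: "real_distribution P" and w: "weak_conv_m (D \<circ> id \<circ> r) P"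
    using tight_imp_convergent_subsubsequence[of D id] by (auto simp: strict_mono_def)
  have "(\<lambda>j. LINT z|measure_pmf (q (r j)). G z) \<longlonglongrightarrow> (LINT t|P. G (\<phi> t, \<psi> t))"
    if G: "continuous_on UNIV G" for G :: "complex \<times> complex \<Rightarrow> real"
  proof -
    have cG: "continuous_on UNIV (\<lambda>t. G (\<phi> t, \<psi> t))"
      using continuous_on_compose2[OF G continuous_on_Pair[OF c]] by simp
    \<comment> \<open>\<open>G\<close> is bounded along the curve because its argument stays in a
      product of compact closures; weak convergence is tested against bounded functions.\<close>
    have "compact (closure (range \<phi>) \<times> closure (range \<psi>))" using b by (intro compact_Times) auto
    then have "bounded (G ` (closure (range \<phi>) \<times> closure (range \<psi>)))"
      by (intro compact_imp_bounded compact_continuous_image continuous_on_subset[OF G]) auto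
    then obtain C where "\<And>z. z \<in> closure (range \<phi>) \<times> closure (range \<psi>) \<Longrightarrow> norm (G z) \<le> C"
      by (auto simp: bounded_iff)
    moreover have "\<phi> t \<in> closure (range \<phi>)" "\<psi> t \<in> closure (range \<psi>)" for t
      by (auto intro!: closure_subset[THEN subsetD])
    ultimately have C: "norm (G (\<phi> t, \<psi> t)) \<le> C" for t by blast
    have "(\<lambda>j. LINT t|(D \<circ> id \<circ> r) j. G (\<phi> t, \<psi> t)) \<longlonglongrightarrow> (LINT t|P. G (\<phi> t, \<psi> t))"
      by (rule weak_conv_imp_integral_bdd_continuous_conv[OF _ P w])
         (use D C cG in \<open>auto simp: continuous_on_eq_continuous_at\<close>)
    moreover have "(LINT t|D j. G (\<phi> t, \<psi> t)) = (LINT z|measure_pmf (q j). G z)" for j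
    proof -
      have "(LINT t|D j. G (\<phi> t, \<psi> t)) = (LINT z|measure_pmf (q j). G (\<phi> (\<sigma> z), \<psi> (\<sigma> z)))"
        unfolding D_def using borel_measurable_continuous_onI[OF cG] by (subst integral_distr) auto
      also have "\<dots> = (LINT z|measure_pmf (q j). G z)"
        by (rule integral_cong_AE) (use q \<sigma> in \<open>auto simp: AE_measure_pmf_iff subset_eq\<close>)
      finally show ?thesis .
    qed
    ultimately show ?thesis by simp
  qed
  with r P c b show ?thesis by blast
qed

section \<open>Limits along an index set, and test functions on \<open>K\<close>\<close>

lemma tendsto_along_range:
  fixes r :: "nat \<Rightarrow> nat"
  assumes r: "strict_mono r" and f: "(\<lambda>j. f (r j)) \<longlonglongrightarrow> L"
  shows "(f \<longlongrightarrow> L) (inf sequentially (principal (range r)))"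
proof (rule topological_tendstoI)
  fix S assume "open S" "L \<in> S"
  from topological_tendstoD[OF f this] obtain N where N: "\<And>j. j \<ge> N \<Longrightarrow> f (r j) \<in> S"
    by (auto simp: eventually_sequentially)
  have "f m \<in> S" if "m \<ge> r N" "m \<in> range r" for m
    using that N strict_mono_less_eq[OF r] by auto
  then show "\<forall>\<^sub>F x in inf sequentially (principal (range r)). f x \<in> S"
    unfolding eventually_inf_principal eventually_sequentially by blast
qed

lemma convex_on_norm_power:
  fixes K :: "'a :: real_normed_vector set"
  assumes "convex K"
  shows "convex_on K (\<lambda>w. norm w ^ m)"
proof (rule convex_onI[OF _ assms])
  fix t :: real and x y :: 'a assume t: "0 < t" "t < 1"
  have pw: "convex_on {0..} (\<lambda>x :: real. x ^ m)"
    by (cases "even m") (auto intro: convex_power_odd convex_on_subset[OF convex_power_even])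
  have "norm ((1 - t) *\<^sub>R x + t *\<^sub>R y) \<le> (1 - t) * norm x + t * norm y"
    using norm_triangle_ineq[of "(1 - t) *\<^sub>R x" "t *\<^sub>R y"] t by simp
  then have "norm ((1 - t) *\<^sub>R x + t *\<^sub>R y) ^ m \<le> ((1 - t) * norm x + t * norm y) ^ m"
    by (intro power_mono) auto
  also have "\<dots> \<le> (1 - t) * norm x ^ m + t * norm y ^ m"
    using convex_onD[OF pw, of t "norm x" "norm y"] t by simp
  finally show "norm ((1 - t) *\<^sub>R x + t *\<^sub>R y) ^ m \<le> (1 - t) * norm x ^ m + t * norm y ^ m" .
qed

lemma sum_mset_ln:
  fixes f :: "'a \<Rightarrow> real"
  assumes "\<And>x. x \<in># X \<Longrightarrow> f x > 0"
  shows "(\<Sum>x\<in>#X. ln (f x)) = ln (\<Prod>x\<in>#X. f x) \<and> (\<Prod>x\<in>#X. f x) > 0"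
  using assms
proof (induction X)
  case (add x X)
  then have "f x > 0" "(\<Sum>x\<in>#X. ln (f x)) = ln (\<Prod>x\<in>#X. f x)" "(\<Prod>x\<in>#X. f x) > 0" by auto
  then show ?case by (simp add: ln_mult_pos)
qed simp

text \<open>Weak limits are tested on the whole plane, whereas the Choquet order and the logarithmic
  kernel supply functions that are continuous only on \<open>K\<close>.\<close>

lemma tietze_real:
  fixes f :: "complex \<Rightarrow> real"
  assumes "compact K" "continuous_on K f"
  obtains g where "continuous_on UNIV g" "bounded (range g)" "\<And>x. x \<in> K \<Longrightarrow> g x = f x"
proof -
  obtain C where C: "\<And>x. x \<in> K \<Longrightarrow> norm (f x) \<le> C"
    using compact_imp_bounded[OF compact_continuous_image[OF assms(2,1)]] by (auto simp: bounded_iff)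
  obtain g where g: "continuous_on UNIV g" "\<And>x. x \<in> K \<Longrightarrow> g x = f x" "\<And>x. x \<in> UNIV \<Longrightarrow> norm (g x) \<le> \<bar>C\<bar>"
    by (rule Tietze[of K f UNIV "\<bar>C\<bar>"])
       (use assms C in \<open>auto intro: compact_imp_closed order_trans[OF _ abs_ge_self]\<close>)
  then show ?thesis using that by (auto simp: bounded_iff)
qed

theorem corollary6:
  fixes k :: nat
    and \<zeta> :: "nat \<Rightarrow> nat \<Rightarrow> complex" and a :: "nat \<Rightarrow> nat \<Rightarrow> real"
    and Q2 Q1 :: "nat \<Rightarrow> complex poly"
    and K :: "complex set"
    and S V :: "nat \<Rightarrow> nat \<Rightarrow> complex poly"
    and n :: "nat \<Rightarrow> nat"
  assumes k: "k \<ge> 2"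
    and a_pos: "\<And>p l. p \<ge> k \<Longrightarrow> l \<in> {1..p} \<Longrightarrow> a l p > 0"
    and Q2: "\<And>p. p \<ge> k \<Longrightarrow> Q2 p = (\<Prod>l=1..p. [:- \<zeta> l p, 1:])"
    and Q1: "\<And>p z. p \<ge> k \<Longrightarrow> poly (Q2 p) z \<noteq> 0 \<Longrightarrow>
               poly (Q1 p) z / poly (Q2 p) z = (\<Sum>l=1..p. of_real (a l p) / (z - \<zeta> l p))"
    and solvable: "\<And>p. p \<ge> k \<Longrightarrow> solvable k p (Q2 p) (Q1 p)"
    and K: "convex K" "compact K"
    and zeros_in_K: "\<And>p. p \<ge> k \<Longrightarrow> {z. poly (Q2 p) z = 0} \<subseteq> K"
    and S_monic: "\<And>p m. p \<ge> k \<Longrightarrow> m \<ge> k - 1 \<Longrightarrow> lead_coeff (S p m) = 1"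
    and V_degree: "\<And>p m. p \<ge> k \<Longrightarrow> m \<ge> k - 1 \<Longrightarrow> degree (V p m) = p - k"
    and V_monic: "\<And>p m. p \<ge> k \<Longrightarrow> m \<ge> k - 1 \<Longrightarrow> lead_coeff (V p m) = 1"
    and S_V: "\<And>p m. p \<ge> k \<Longrightarrow> m \<ge> k - 1 \<Longrightarrow>
               \<exists>c. c \<noteq> 0 \<and> higher_heine_stieltjes k p (Q2 p) (Q1 p) m (S p m) (smult c (V p m))"
    and n: "\<And>p. p \<ge> k \<Longrightarrow> n p \<ge> k - 1"
  shows "\<exists>\<Gamma> \<mu>V \<mu>Q. \<Gamma> \<subseteq> {1..} \<and> infinite \<Gamma> \<and>
           weak_star_limit \<Gamma> (\<lambda>p. root_measure (V p (n p))) \<mu>V \<and>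
           weak_star_limit \<Gamma> (\<lambda>p. root_measure (Q2 p)) \<mu>Q \<and>
           choquet_le K \<mu>V \<mu>Q \<and>
           (\<exists>T. dilation K T \<and> dilation_image K T \<mu>V \<mu>Q) \<and>
           (\<forall>m. abs_moment \<mu>V m \<le> abs_moment \<mu>Q m) \<and>
           (\<forall>z. z \<notin> K \<longrightarrow> log_potential \<mu>V z \<ge> log_potential \<mu>Q z)"
proof -
  have hs: "\<exists>c. heine_stieltjes k p (\<lambda>l. \<zeta> l p) (\<lambda>l. a l p) (Q2 p) (Q1 p) (S p (n p)) (V p (n p)) c"
    if p: "p \<ge> k" for p
  proof -
    note np = n[OF p]
    obtain c where c: "c \<noteq> 0" "higher_heine_stieltjes k p (Q2 p) (Q1 p) (n p) (S p (n p)) (smult c (V p (n p)))"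
      using S_V[OF p np] by blast
    have "S p (n p) \<noteq> 0" "V p (n p) \<noteq> 0" using S_monic[OF p np] V_monic[OF p np] by auto
    then have "heine_stieltjes k p (\<lambda>l. \<zeta> l p) (\<lambda>l. a l p) (Q2 p) (Q1 p) (S p (n p)) (V p (n p)) c"
      using k p a_pos[OF p] Q2[OF p] Q1[OF p] np c
      by unfold_locales (auto simp: higher_heine_stieltjes_def)
    then show ?thesis by blast
  qed
  define X where "X p = proots (V p (n p))" for p
  define Y where "Y p = proots (Q2 p)" for p
  have dQ: "degree (Q2 p) = p" "Q2 p \<noteq> 0" if "p \<ge> k" for p
    using Q2[OF that] by (simp_all add: degree_prod_sum_eq)
  have sX: "size (X p) = p - k" if "p \<ge> k" for p
    using V_degree[OF that n[OF that]] by (simp add: X_def size_proots_complex)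
  have sY: "size (Y p) = p" if "p \<ge> k" for p using dQ[OF that] by (simp add: Y_def size_proots_complex)
  have YK: "set_mset (Y p) \<subseteq> K" if "p \<ge> k" for p
    using zeros_in_K[OF that] dQ[OF that] by (auto simp: Y_def)
  have mj: "maj 1 (X p) (Y p)" if "p \<ge> k" for p
    using hs[OF that] heine_stieltjes.maj_V_Q2 unfolding X_def Y_def by blast
  have XK: "set_mset (X p) \<subseteq> K" if "p \<ge> k" for p by (rule maj_subset[OF mj K(1) YK]) (use that in auto)
  have bound: "(\<exists>\<kappa>>0. \<forall>p\<ge>k. \<kappa> ^ k * (\<Prod>y\<in>#Y p. cmod (z - y)) \<le> (\<Prod>y\<in>#X p. cmod (z - y)))"
    if z: "z \<notin> K" for z
  proof -
    obtain \<kappa> where \<kappa>: "\<kappa> > 0" "\<And>Y t R. weighted_deriv Y t R \<Longrightarrow> set_mset Y \<subseteq> K \<Longrightarrow>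
       \<kappa> * (\<Prod>y\<in>#Y. cmod (z - y)) \<le> (\<Prod>y\<in>#proots R. cmod (z - y))"
      using weighted_deriv_prod_bound[OF K z] by metis
    show ?thesis
    proof (intro exI conjI allI impI)
      fix p assume p: "p \<ge> k"
      then obtain c where "heine_stieltjes k p (\<lambda>l. \<zeta> l p) (\<lambda>l. a l p) (Q2 p) (Q1 p) (S p (n p)) (V p (n p)) c"
        using hs by blast
      then show "\<kappa> ^ k * (\<Prod>y\<in>#Y p. cmod (z - y)) \<le> (\<Prod>y\<in>#X p. cmod (z - y))"
        unfolding X_def Y_def
      proof (rule heine_stieltjes.prod_dist_bound[OF _ K(1) compact_imp_closed[OF K(2)] _ z \<kappa>(1)])
        show "set_mset (proots (Q2 p)) \<subseteq> K" using YK[OF p] by (simp only: Y_def)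
      qed (rule \<kappa>(2))
    qed (rule \<kappa>(1))
  qed
  define good where "good p q \<longleftrightarrow> set_pmf q \<subseteq> K \<times> K \<and>
      (\<forall>f :: complex \<Rightarrow> real. (LINT z|measure_pmf q. f (fst z)) = (\<Sum>x\<in>#X p. f x) / real (size (X p))) \<and>
      (\<forall>(f :: complex \<Rightarrow> real) B. (\<forall>y\<in>#Y p. \<bar>f y\<bar> \<le> B) \<longrightarrow>
        \<bar>(LINT z|measure_pmf q. f (snd z)) - (\<Sum>y\<in>#Y p. f y) / real (size (Y p))\<bar>
          \<le> 2 * B * (real (size (Y p)) - real (size (X p))) / real (size (Y p))) \<and>
      (\<forall>(h :: complex \<Rightarrow> real) u. (LINT z|measure_pmf q. h (fst z) * inner u (snd z - fst z)) = 0) \<and>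
      (\<forall>f. convex_on K f \<longrightarrow> (LINT z|measure_pmf q. f (fst z)) \<le> (LINT z|measure_pmf q. f (snd z)))" for p and q :: "(complex \<times> complex) pmf"
  \<comment> \<open>For \<open>p = k\<close> the polynomial \<open>V\<close> is constant and has no
    zeros to couple. This is why the sequence of couplings starts at \<open>k + 1\<close>.\<close>
  have "\<exists>q. good p q"
    if p: "p > k" for p
  proof -
    have ne: "X p \<noteq> {#}" using sX[of p] p by auto
    show ?thesis
    proof (rule maj_coupling[OF mj[OF less_imp_le[OF p]] ne])
      fix q :: "(complex \<times> complex) pmf"
      assume q: "set_pmf q \<subseteq> set_mset (X p) \<times> set_mset (Y p)"
        "\<And>f :: complex \<Rightarrow> real. (LINT z|measure_pmf q. f (fst z)) = (\<Sum>x\<in>#X p. f x) / real (size (X p))"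
        "\<And>(f :: complex \<Rightarrow> real) B. (\<And>y. y \<in># Y p \<Longrightarrow> \<bar>f y\<bar> \<le> B) \<Longrightarrow>
         \<bar>(LINT z|measure_pmf q. f (snd z)) - (\<Sum>y\<in>#Y p. f y) / real (size (Y p))\<bar>
           \<le> 2 * B * (real (size (Y p)) - real (size (X p))) / real (size (Y p))"
        "\<And>(h :: complex \<Rightarrow> real) u. (LINT z|measure_pmf q. h (fst z) * inner u (snd z - fst z)) = 0"
        "\<And>C f. convex_on C f \<Longrightarrow> set_mset (Y p) \<subseteq> C \<Longrightarrow>
          (LINT z|measure_pmf q. f (fst z)) \<le> (LINT z|measure_pmf q. f (snd z))"
      have "set_pmf q \<subseteq> K \<times> K" using q(1) XK[of p] YK[of p] p by auto
      then show ?thesis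
        using q(2-4) q(5)[OF _ YK[OF less_imp_le[OF p]]] unfolding good_def
        by (intro exI[of _ q] conjI allI impI) blast+
    qed
  qed
  then obtain Q where Q: "\<And>p. p > k \<Longrightarrow> good p (Q p)" by metis
  have Q_K: "\<And>p. p > k \<Longrightarrow> set_pmf (Q p) \<subseteq> K \<times> K" and
    Q_fst: "\<And>p (f :: complex \<Rightarrow> real). p > k \<Longrightarrow> (LINT z|measure_pmf (Q p). f (fst z)) = (\<Sum>x\<in>#X p. f x) / real (size (X p))" and
    Q_snd: "\<And>p (f :: complex \<Rightarrow> real) B. p > k \<Longrightarrow> (\<forall>y\<in>#Y p. \<bar>f y\<bar> \<le> B) \<Longrightarrow>
        \<bar>(LINT z|measure_pmf (Q p). f (snd z)) - (\<Sum>y\<in>#Y p. f y) / real (size (Y p))\<bar>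
          \<le> 2 * B * (real (size (Y p)) - real (size (X p))) / real (size (Y p))" and
    Q_mart: "\<And>p (h :: complex \<Rightarrow> real) u. p > k \<Longrightarrow> (LINT z|measure_pmf (Q p). h (fst z) * inner u (snd z - fst z)) = 0" and
    Q_convex: "\<And>p f. p > k \<Longrightarrow> convex_on K f \<Longrightarrow> (LINT z|measure_pmf (Q p). f (fst z)) \<le> (LINT z|measure_pmf (Q p). f (snd z))"
    using Q unfolding good_def by blast+
  have "set_pmf (Q (k + 1 + j)) \<subseteq> K \<times> K" for j by (rule Q_K) simp
  from coupling_limit[where q = "\<lambda>j. Q (k + 1 + j)", OF compact_imp_bounded[OF K(2)] this]
  obtain r P \<phi> \<psi> where r: "strict_mono r" and P: "real_distribution P"
    and c: "continuous_on UNIV \<phi>" "continuous_on UNIV \<psi>" and b: "bounded (range \<phi>)" "bounded (range \<psi>)"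
    and lim0: "\<And>G :: complex \<times> complex \<Rightarrow> real. continuous_on UNIV G \<Longrightarrow>
       (\<lambda>j. LINT z|measure_pmf (Q (k + 1 + r j)). G z) \<longlonglongrightarrow> (LINT t|P. G (\<phi> t, \<psi> t))"
    by blast
  define s where "s j = k + 1 + r j" for j
  have s: "strict_mono s" using r by (simp add: strict_mono_def s_def)
  have sk: "s j > k" for j by (simp add: s_def)
  note lim = lim0[folded s_def]
  interpret P: real_distribution P by fact
  have [measurable]: "\<phi> \<in> borel_measurable borel" "\<psi> \<in> borel_measurable borel"
    using c by (auto intro: borel_measurable_continuous_onI)
  have Kc: "closed K" using K by (rule_tac compact_imp_closed)
  have Kne: "K \<noteq> {}" using Q_K[OF sk[of 0]] set_pmf_not_empty[of "Q (s 0)"] by auto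
  have [measurable]: "K \<in> sets borel" using Kc by simp
  have lim_fst: "(\<lambda>j. LINT z|measure_pmf (Q (s j)). f (fst z)) \<longlonglongrightarrow> (LINT t|P. f (\<phi> t))"
    and lim_snd: "(\<lambda>j. LINT z|measure_pmf (Q (s j)). f (snd z)) \<longlonglongrightarrow> (LINT t|P. f (\<psi> t))"
    if f: "continuous_on UNIV f" for f :: "complex \<Rightarrow> real"
  proof -
    have "continuous_on UNIV (\<lambda>z :: complex \<times> complex. f (fst z))" "continuous_on UNIV (\<lambda>z :: complex \<times> complex. f (snd z))"
      by (auto intro!: continuous_on_compose2[OF f] continuous_intros)
    from this[THEN lim] show "(\<lambda>j. LINT z|measure_pmf (Q (s j)). f (fst z)) \<longlonglongrightarrow> (LINT t|P. f (\<phi> t))"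
      "(\<lambda>j. LINT z|measure_pmf (Q (s j)). f (snd z)) \<longlonglongrightarrow> (LINT t|P. f (\<psi> t))" by simp_all
  qed
  have Q_mem: "fst z \<in> K" "snd z \<in> K" if "z \<in> set_pmf (Q (s j))" for z j
    using Q_K[OF sk] that by (auto simp: mem_Times_iff subset_eq)
  \<comment> \<open>Concentration on \<open>K\<close> passes to the limit through
    \<open>infdist\<close>: it is continuous and nonnegative, and its integral vanishes for every
    coupling, hence also for the limit. Closedness of \<open>K\<close> then places the limit in
    \<open>K\<close>.\<close>
  have inf0: "(LINT z|measure_pmf (Q (s j)). infdist (fst z) K) = 0"
    "(LINT z|measure_pmf (Q (s j)). infdist (snd z) K) = 0" for j
    by (rule integral_eq_zero_AE; simp add: AE_measure_pmf_iff Q_mem)+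
  have AE_K: "AE t in P. g t \<in> K"
    if g: "continuous_on UNIV g" "bounded (range g)" and 0: "(LINT t|P. infdist (g t) K) = 0" for g :: "real \<Rightarrow> complex"
  proof -
    have m: "(\<lambda>t. infdist (g t) K) \<in> borel_measurable borel"
      by (intro borel_measurable_continuous_onI continuous_intros g)
    have "compact (closure (range g))" using g by simp
    then have "bounded ((\<lambda>x. infdist x K) ` closure (range g))"
      by (intro compact_imp_bounded compact_continuous_image continuous_intros)
    then obtain C where "\<And>x. x \<in> closure (range g) \<Longrightarrow> norm (infdist x K) \<le> C" by (auto simp: bounded_iff)
    moreover have "g t \<in> closure (range g)" for t by (auto intro!: closure_subset[THEN subsetD])
    ultimately have "norm (infdist (g t) K) \<le> C" for t by blast
    then have "integrable P (\<lambda>t. infdist (g t) K)"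
      using m by (intro P.integrable_const_bound[of _ C]) auto
    then have "AE t in P. infdist (g t) K = 0"
      using 0 by (subst integral_nonneg_eq_0_iff_AE[symmetric]) (auto simp: infdist_nonneg)
    then show ?thesis by (simp add: in_closed_iff_infdist_zero[OF Kc Kne])
  qed
  have ci: "continuous_on UNIV (\<lambda>x :: complex. infdist x K)" by (intro continuous_intros)
  have \<phi>K: "AE t in P. \<phi> t \<in> K"
    using lim_fst[OF ci] unfolding inf0 by (intro AE_K c b) (simp add: LIMSEQ_const_iff)
  have \<psi>K: "AE t in P. \<psi> t \<in> K"
    using lim_snd[OF ci] unfolding inf0 by (intro AE_K c b) (simp add: LIMSEQ_const_iff)
  define \<mu> where "\<mu> = distr P borel \<phi>"
  define \<nu> where "\<nu> = distr P borel \<psi>"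
  have pm: "prob_space (distr P borel g) \<and> emeasure (distr P borel g) K = 1"
    if [measurable]: "g \<in> borel_measurable borel" and g: "AE t in P. g t \<in> K" for g
  proof
    show pr: "prob_space (distr P borel g)" by (rule P.prob_space_distr) simp
    interpret G: prob_space "distr P borel g" by (rule pr)
    have "AE y in distr P borel g. y \<in> K" by (subst AE_distr_iff) (use g in auto)
    then show "emeasure (distr P borel g) K = 1" by (intro G.emeasure_eq_1_AE) auto
  qed
  have pm\<mu>: "prob_measure_on K \<mu>" and pm\<nu>: "prob_measure_on K \<nu>"
    using pm[of \<phi>] pm[of \<psi>] \<phi>K \<psi>K by (auto simp: prob_measure_on_def \<mu>_def \<nu>_def)
  \<comment> \<open>\<open>f'\<close> is a continuous extension of \<open>f\<close>, the form in
    which limits are available. \<open>h\<close> is any Borel function that agrees with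
    \<open>f\<close> on \<open>K\<close>, such as the logarithmic kernel on the whole plane, and has
    the same integral because the law of \<open>g\<close> is carried by \<open>K\<close>.\<close>
  have set_int: "(LINT x:K|distr P borel g. f x) = (LINT t|P. f' (g t))"
    "h \<in> borel_measurable borel \<Longrightarrow> (\<And>x. x \<in> K \<Longrightarrow> h x = f x) \<Longrightarrow> (LINT x|distr P borel g. h x) = (LINT t|P. f' (g t))"
    if [measurable]: "g \<in> borel_measurable borel" and g: "AE t in P. g t \<in> K"
      and f: "continuous_on K f" and f': "continuous_on UNIV f'" "\<And>x. x \<in> K \<Longrightarrow> f' x = f x" for g f f' and h :: "complex \<Rightarrow> real"
  proof -
    have [measurable]: "f' \<in> borel_measurable borel" by (rule borel_measurable_continuous_onI[OF f'(1)])
    have fm: "(\<lambda>y. indicator K y *\<^sub>R f y) \<in> borel_measurable borel"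
      by (rule borel_measurable_continuous_on_indicator[OF _ f]) simp
    have gP: "g \<in> P \<rightarrow>\<^sub>M borel" by simp
    have "(LINT x:K|distr P borel g. f x) = (LINT t|P. indicator K (g t) *\<^sub>R f (g t))"
      unfolding set_lebesgue_integral_def by (rule integral_distr[OF gP fm])
    also have "\<dots> = (LINT t|P. f' (g t))"
    proof (rule integral_cong_AE)
      show "(\<lambda>t. indicator K (g t) *\<^sub>R f (g t)) \<in> borel_measurable P" using measurable_compose[OF gP fm] .
      show "AE t in P. indicator K (g t) *\<^sub>R f (g t) = f' (g t)" using g by eventually_elim (simp add: f'(2))
    qed simp
    finally show "(LINT x:K|distr P borel g. f x) = (LINT t|P. f' (g t))" .
    assume h [measurable]: "h \<in> borel_measurable borel" and hf: "\<And>x. x \<in> K \<Longrightarrow> h x = f x"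
    have "(LINT x|distr P borel g. h x) = (LINT t|P. h (g t))" by (rule integral_distr) simp_all
    also have "\<dots> = (LINT t|P. f' (g t))"
    proof (rule integral_cong_AE)
      show "AE t in P. h (g t) = f' (g t)" using g by eventually_elim (simp add: f'(2) hf)
    qed simp_all
    finally show "(LINT x|distr P borel g. h x) = (LINT t|P. f' (g t))" .
  qed
  have rm: "(LINT z|root_measure (V (s j) (n (s j))). f z) = (LINT z|measure_pmf (Q (s j)). f (fst z))"
    "(LINT z|root_measure (Q2 (s j)). f z) = (\<Sum>y\<in>#Y (s j). f y) / real (size (Y (s j)))"
    if "f \<in> borel_measurable borel" for f :: "complex \<Rightarrow> real" and j
  proof -
    have sj: "s j > k" "s j \<ge> k" using sk[of j] by auto
    have "degree (V (s j) (n (s j))) \<ge> 1" using V_degree[OF sj(2) n[OF sj(2)]] sj by simp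
    then show "(LINT z|root_measure (V (s j) (n (s j))). f z) = (LINT z|measure_pmf (Q (s j)). f (fst z))"
      using that by (simp add: integral_root_measure Q_fst[OF sj(1)] X_def size_proots_complex)
    have "degree (Q2 (s j)) \<ge> 1" using dQ[OF sj(2)] k sj by simp
    then show "(LINT z|root_measure (Q2 (s j)). f z) = (\<Sum>y\<in>#Y (s j). f y) / real (size (Y (s j)))"
      using that by (simp add: integral_root_measure Y_def size_proots_complex)
  qed
  have s_inf: "filterlim (\<lambda>j. real (s j)) at_top sequentially"
    by (rule filterlim_compose[OF filterlim_real_sequentially filterlim_subseq[OF s]])
  have lim_Y: "(\<lambda>j. (\<Sum>y\<in>#Y (s j). f y) / real (size (Y (s j)))) \<longlonglongrightarrow> (LINT t|P. f (\<psi> t))"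
    if f: "continuous_on UNIV f" "bounded (range f)" for f :: "complex \<Rightarrow> real"
  proof -
    obtain B where B: "\<And>x. \<bar>f x\<bar> \<le> B" using f(2) by (auto simp: bounded_iff)
    let ?d = "\<lambda>j. (LINT z|measure_pmf (Q (s j)). f (snd z)) - (\<Sum>y\<in>#Y (s j). f y) / real (size (Y (s j)))"
    \<comment> \<open>The multisets differ in size by exactly \<open>k\<close>, so the marginal
      defect of the coupling is of order \<open>k / s j\<close>.\<close>
    have "\<bar>?d j\<bar> \<le> 2 * B * real k / real (s j)" for j
    proof -
      have sj: "s j > k" "s j \<ge> k" using sk[of j] by auto
      show ?thesis using Q_snd[OF sj(1), of f B] B sX[OF sj(2)] sY[OF sj(2)] sj by (simp add: of_nat_diff)
    qed
    moreover have "(\<lambda>j. 2 * B * real k / real (s j)) \<longlonglongrightarrow> 0"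
      by (intro real_tendsto_divide_at_top[OF tendsto_const s_inf])
    ultimately have "?d \<longlonglongrightarrow> 0"
      by (intro Lim_null_comparison[of ?d]) (auto intro!: always_eventually)
    from tendsto_diff[OF lim_snd[OF f(1)] this] show ?thesis by simp
  qed
  have wV: "weak_star_limit (range s) (\<lambda>p. root_measure (V p (n p))) \<mu>"
    unfolding weak_star_limit_def
  proof (intro conjI allI impI)
    show "prob_space \<mu>" "sets \<mu> = sets borel" using pm\<mu> by (auto simp: prob_measure_on_def)
    fix f :: "complex \<Rightarrow> real" assume f: "continuous_on UNIV f \<and> bounded (range f)"
    then have [measurable]: "f \<in> borel_measurable borel" by (auto intro: borel_measurable_continuous_onI)
    have "(LINT z|\<mu>. f z) = (LINT t|P. f (\<phi> t))" unfolding \<mu>_def by (rule integral_distr) simp_all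
    then show "((\<lambda>p. LINT z|root_measure (V p (n p)). f z) \<longlongrightarrow> (LINT z|\<mu>. f z)) (inf sequentially (principal (range s)))"
      using f lim_fst[of f] by (intro tendsto_along_range[OF s]) (simp add: rm)
  qed
  have wQ: "weak_star_limit (range s) (\<lambda>p. root_measure (Q2 p)) \<nu>"
    unfolding weak_star_limit_def
  proof (intro conjI allI impI)
    show "prob_space \<nu>" "sets \<nu> = sets borel" using pm\<nu> by (auto simp: prob_measure_on_def)
    fix f :: "complex \<Rightarrow> real" assume f: "continuous_on UNIV f \<and> bounded (range f)"
    then have [measurable]: "f \<in> borel_measurable borel" by (auto intro: borel_measurable_continuous_onI)
    have "(LINT z|\<nu>. f z) = (LINT t|P. f (\<psi> t))" unfolding \<nu>_def by (rule integral_distr) simp_all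
    then show "((\<lambda>p. LINT z|root_measure (Q2 p). f z) \<longlongrightarrow> (LINT z|\<nu>. f z)) (inf sequentially (principal (range s)))"
      using f lim_Y[of f] by (intro tendsto_along_range[OF s]) (simp add: rm)
  qed
  have ch: "choquet_le K \<mu> \<nu>"
    unfolding choquet_le_def
  proof (intro conjI allI impI pm\<mu> pm\<nu>)
    fix f :: "complex \<Rightarrow> real" assume f: "continuous_on K f \<and> convex_on K f"
    obtain f' where f': "continuous_on UNIV f'" "bounded (range f')" "\<And>x. x \<in> K \<Longrightarrow> f' x = f x"
      using tietze_real[OF K(2)] f by metis
    have eq: "(LINT z|measure_pmf (Q (s j)). f' (fst z)) = (LINT z|measure_pmf (Q (s j)). f (fst z))"
      "(LINT z|measure_pmf (Q (s j)). f' (snd z)) = (LINT z|measure_pmf (Q (s j)). f (snd z))" for j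
      by (rule integral_cong_AE; simp add: AE_measure_pmf_iff Q_mem f'(3))+
    have "(LINT t|P. f' (\<phi> t)) \<le> (LINT t|P. f' (\<psi> t))"
      by (rule LIMSEQ_le[OF lim_fst[OF f'(1)] lim_snd[OF f'(1)]])
         (use Q_convex[OF sk] f in \<open>auto simp: eq\<close>)
    then show "(LINT x:K|\<mu>. f x) \<le> (LINT x:K|\<nu>. f x)"
      unfolding \<mu>_def \<nu>_def using f f' \<phi>K \<psi>K by (simp add: set_int(1)[of _ f f'])
  qed
  have dil: "\<exists>T. dilation K T \<and> dilation_image K T \<mu> \<nu>"
  proof -
    obtain B1 B2 where "\<And>t. cmod (\<phi> t) \<le> B1" "\<And>t. cmod (\<psi> t) \<le> B2" using b by (auto simp: bounded_iff)
    then have B: "\<And>t. cmod (\<phi> t) \<le> max B1 B2" "\<And>t. cmod (\<psi> t) \<le> max B1 B2" by (auto simp: le_max_iff_disj)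
    have "(LINT t|P. h (\<phi> t) * inner u (\<psi> t - \<phi> t)) = 0" if h: "continuous_on UNIV h" for h :: "complex \<Rightarrow> real" and u
    proof -
      have "continuous_on UNIV (\<lambda>z :: complex \<times> complex. h (fst z) * inner u (snd z - fst z))"
        by (intro continuous_intros continuous_on_compose2[OF h]) auto
      from lim[OF this] show ?thesis by (simp add: Q_mart[OF sk] LIMSEQ_const_iff)
    qed
    then show ?thesis unfolding \<mu>_def \<nu>_def
      using martingale_dilation[OF P _ _ B K(2) \<phi>K \<psi>K] by simp
  qed
  have mom: "abs_moment \<mu> m \<le> abs_moment \<nu> m" for m
  proof -
    have cm: "continuous_on A (\<lambda>w. cmod w ^ m)" for A by (intro continuous_intros)
    have "abs_moment (distr P borel g) m = (LINT w:K|distr P borel g. cmod w ^ m)"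
      if "g \<in> borel_measurable borel" "AE t in P. g t \<in> K" for g
      unfolding abs_moment_def set_int(1)[OF that cm cm refl]
      by (rule set_int(2)[OF that cm cm refl]) auto
    then show ?thesis
      using ch cm convex_on_norm_power[OF K(1), of m] \<phi>K \<psi>K unfolding choquet_le_def \<mu>_def \<nu>_def by simp
  qed
  have pot: "log_potential \<mu> z \<ge> log_potential \<nu> z" if z: "z \<notin> K" for z
  proof -
    let ?l = "\<lambda>w. ln (cmod (z - w))"
    have cl: "continuous_on K ?l" using z by (intro continuous_intros) auto
    obtain f' where f': "continuous_on UNIV f'" "bounded (range f')" "\<And>x. x \<in> K \<Longrightarrow> f' x = ?l x"
      using tietze_real[OF K(2) cl] by metis
    have lp: "log_potential (distr P borel g) z = (LINT t|P. f' (g t))"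
      if "g \<in> borel_measurable borel" "AE t in P. g t \<in> K" for g
      unfolding log_potential_def by (rule set_int(2)[OF that cl f'(1,3)]) auto
    obtain \<kappa> where \<kappa>: "\<kappa> > 0" "\<And>p. p \<ge> k \<Longrightarrow> \<kappa> ^ k * (\<Prod>y\<in>#Y p. cmod (z - y)) \<le> (\<Prod>y\<in>#X p. cmod (z - y))"
      using bound[OF z] by blast
    let ?my = "\<lambda>j. (\<Sum>y\<in>#Y (s j). f' y) / real (size (Y (s j)))"
    \<comment> \<open>Take logarithms of the product bound and divide by the degree
      \<open>s j - k\<close> of \<open>V\<close>. The factor \<open>s j / (s j - k)\<close> corrects
      the mean over \<open>Y\<close>, which is taken over \<open>s j\<close> points; it tends to 1,
      and the term with \<open>ln \<kappa>\<close> tends to 0 because \<open>k\<close> is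
      fixed.\<close>
    have le: "?my j * (real (s j) / (real (s j) - real k)) + k * ln \<kappa> / (real (s j) - real k)
        \<le> (LINT z|measure_pmf (Q (s j)). f' (fst z))" for j
    proof -
      have sj: "s j > k" "s j \<ge> k" using sk[of j] by auto
      have pos: "cmod (z - y) > 0" if "y \<in> K" for y using that z by auto
      have fX: "(\<Sum>x\<in>#X (s j). f' x) = (\<Sum>x\<in>#X (s j). ?l x)"
        and fY: "(\<Sum>x\<in>#Y (s j). f' x) = (\<Sum>x\<in>#Y (s j). ?l x)"
        using XK[OF sj(2)] YK[OF sj(2)] f'(3) by (auto intro!: arg_cong[where f = sum_mset] image_mset_cong)
      have lX: "(\<Sum>x\<in>#X (s j). ?l x) = ln (\<Prod>x\<in>#X (s j). cmod (z - x)) \<and> (\<Prod>x\<in>#X (s j). cmod (z - x)) > 0"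
        by (rule sum_mset_ln) (use XK[OF sj(2)] pos in auto)
      have lY: "(\<Sum>x\<in>#Y (s j). ?l x) = ln (\<Prod>x\<in>#Y (s j). cmod (z - x)) \<and> (\<Prod>x\<in>#Y (s j). cmod (z - x)) > 0"
        by (rule sum_mset_ln) (use YK[OF sj(2)] pos in auto)
      have le_ln: "ln (\<kappa> ^ k * (\<Prod>y\<in>#Y (s j). cmod (z - y))) \<le> ln (\<Prod>y\<in>#X (s j). cmod (z - y))"
        using \<kappa>(2)[OF sj(2)] \<kappa>(1) lX lY by simp
      have "k * ln \<kappa> + (\<Sum>x\<in>#Y (s j). f' x) \<le> (\<Sum>x\<in>#X (s j). f' x)"
      proof -
        have "ln (\<kappa> ^ k * (\<Prod>y\<in>#Y (s j). cmod (z - y))) = ln (\<kappa> ^ k) + ln (\<Prod>y\<in>#Y (s j). cmod (z - y))"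
          using lY \<kappa>(1) by (intro ln_mult_pos) auto
        moreover have "ln (\<kappa> ^ k) = k * ln \<kappa>" by (rule ln_realpow)
        ultimately show ?thesis using le_ln lX lY unfolding fX fY by linarith
      qed
      then have "(k * ln \<kappa> + (\<Sum>x\<in>#Y (s j). f' x)) / (real (s j) - real k) \<le> (LINT z|measure_pmf (Q (s j)). f' (fst z))"
        using sj sX[OF sj(2)] unfolding Q_fst[OF sj(1)] by (simp add: of_nat_diff divide_right_mono)
      then show ?thesis using sj sY[OF sj(2)] by (simp add: add_divide_distrib add.commute)
    qed
    have d_inf: "filterlim (\<lambda>j. real (s j) - real k) at_top sequentially"
      using filterlim_tendsto_add_at_top[OF tendsto_const[of "- real k"] s_inf] by simp
    have "(\<lambda>j. 1 + real k / (real (s j) - real k)) \<longlonglongrightarrow> 1 + 0"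
      by (intro tendsto_add tendsto_const real_tendsto_divide_at_top[OF tendsto_const d_inf])
    moreover have "1 + real k / (real (s j) - real k) = real (s j) / (real (s j) - real k)" for j
      using sk[of j] by (simp add: field_simps)
    ultimately have "(\<lambda>j. real (s j) / (real (s j) - real k)) \<longlonglongrightarrow> 1" by simp
    moreover have "(\<lambda>j. k * ln \<kappa> / (real (s j) - real k)) \<longlonglongrightarrow> 0"
      by (rule real_tendsto_divide_at_top[OF tendsto_const d_inf])
    ultimately have "(\<lambda>j. ?my j * (real (s j) / (real (s j) - real k)) + k * ln \<kappa> / (real (s j) - real k))
        \<longlonglongrightarrow> (LINT t|P. f' (\<psi> t)) * 1 + 0"
      by (intro tendsto_add tendsto_mult lim_Y f')
    from LIMSEQ_le[OF this lim_fst[OF f'(1)]] le show ?thesis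
      unfolding \<mu>_def \<nu>_def using \<phi>K \<psi>K by (simp add: lp)
  qed
  have s1: "s j \<ge> 1" for j using sk[of j] by linarith
  show ?thesis
  proof (rule exI[of _ "range s"], rule exI[of _ \<mu>], rule exI[of _ \<nu>], intro conjI allI impI)
    show "range s \<subseteq> {1..}" using s1 by auto
    show "infinite (range s)" using s by (intro range_inj_infinite strict_mono_imp_inj_on)
    show "abs_moment \<mu> m \<le> abs_moment \<nu> m" for m by (rule mom)
    show "log_potential \<nu> z \<le> log_potential \<mu> z" if "z \<notin> K" for z using that by (rule pot)
  qed (fact wV wQ ch dil)+
qed

end
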